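(* Let $0\le \gamma<1$ and let $K>0$. Then, given any finite $p\ge 1$, the functions $Q_N(u,w)$ converge, as $N\to\infty$, to some limit $Q=Q(u,w)$ in $L^p(\mu\otimes\mu_{1-\gamma}\otimes\mu_{-\gamma})$. Moreover, there exists $C_p>0$ such that $$\sup_{N\in\mathbb{N}}\Big\| \mathbf 1_{\{|\int_{\mathbb{T}^2} :|u_N|^2:\,dx|\le K\}}\, e^{-Q_N(u,w)}\Big\|_{L^p(\mu\otimes\mu_{1-\gamma}\otimes\mu_{-\gamma})}\le C_p<\infty .$$ In particular, $$\lim_{N\to\infty}\mathbf 1_{\{|\int_{\mathbb{T}^2} :|u_N|^2:\,dx|\le K\}}\, e^{-Q_N(u,w)}=\mathbf 1_{\{|\int_{\mathbb{T}^2} :|u|^2:\,dx|\le K\}}\, e^{-Q(u,w)}\quad\text{in } L^p(\mu\otimes\mu_{1-\gamma}\otimes\mu_{-\gamma}). \qquad ( * )$$ As a consequence, the truncated renormalized Gibbs measures $$d\vec\rho_{\gamma,N}(u,w,\partial_t w)=Z_N^{-1}\mathbf 1_{\{|\int_{\mathbb{T}^2} :|u_N|^2:\,dx|\le K\}}\,e^{-Q_N(u,w)}\,d(\mu\otimes\mu_{1-\gamma}\otimes\mu_{-\gamma})(u,w,\partial_t w)$$ converge, in the sense of $( * )$, to the Gibbs measure $\vec\rho_\gamma$ given by $$d\vec\rho_{\gamma}(u,w,\partial_t w)=Z^{-1}\mathbf 1_{\{|\int_{\mathbb{T}^2} :|u|^2:\,dx|\le K\}}\,e^{-Q(u,w)}\,d(\mu\otimes\mu_{1-\gamma}\otimes\mu_{-\gamma})(u,w,\partial_t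 w).$$ Furthermore, the resulting Gibbs measure $\vec\rho_\gamma$ is absolutely continuous with respect to the Gaussian field $\mu\otimes\mu_{1-\gamma}\otimes\mu_{-\gamma}$.
   Context: $\mathbb{T}^2=(\mathbb{R}/2\pi\mathbb{Z})^2$ is endowed with the normalized Lebesgue measure $(2\pi)^{-2}dx$, and $\langle n\rangle=(1+|n|^2)^{1/2}$. Let $\{g_n,h_n,\ell_n\}_{n\in\mathbb{Z}^2}$ be standard complex-valued Gaussian random variables on a probability space $(\Omega,\mathcal F,\mathbb P)$, independent except for the constraints $h_{-n}=\overline{h_n}$ and $\ell_{-n}=\overline{\ell_n}$ (so $h_0,\ell_0\sim N_{\mathbb R}(0,1)$, and all other variables have independent real and imaginary parts with law $N_{\mathbb R}(0,\frac12)$). The Gaussian measure $\mu\otimes\mu_{1-\gamma}\otimes\mu_{-\gamma}$ (with $\mu=\mu_1$) is the law of the random triple of distributions $(u,w_0,w_1)$ on $\mathbb T^2$, $$u=\sum_{n\in\mathbb Z^2}\frac{g_n}{\langle n\rangle}e^{i n\cdot x},\quad w_0=\sum_{n\in\mathbb Z^2}\frac{h_n}{\langle n\rangle^{1-\gamma}}e^{i n\cdot x},\quad w_1=\sum_{n\in\mathbb Z^2}\frac{\ell_n}{\langle n\rangle^{-\gamma}}e^{i n\cdot x};$$ a generic element is written $(u,w,\partial_t w)$, where $u$ is complex-valued and $w,\partial_t w$ are real-valued. For $N\in\mathbb N$, $\pi_N$ is the Fourier projector $\pi_N f=\sum_{|n|\le N}\widehat f(n)e^{in\cdot x}$, $u_N=\pi_N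 u$, $\sigma_N=\mathbb E[|u_N(x)|^2]=\sum_{|n|\le N}\langle n\rangle^{-2}$, the Wick power is $:|u_N|^2:\;=|u_N|^2-\sigma_N$, and $$Q_N(u,w)=\frac12\int_{\mathbb T^2}:|u_N|^2:\,w\,dx .$$ $\int_{\mathbb T^2}:|u|^2:\,dx$ denotes the limit of $\int_{\mathbb T^2}:|u_N|^2:\,dx$ as $N\to\infty$ (in $L^p(\mu)$). $Z_N,Z$ are normalization constants making the measures probability measures. *)

theory Defs
  imports "HOL-Probability.Probability"
begin

section \<open>Fourier modes on the torus\<close>

type_synonym mode = "int \<times> int"

text \<open>Functions on the torus are functions on the plane, \<open>2\<pi>\<close>-periodic in both variables.\<close>

type_synonym plane = "real \<times> real"

definition freq :: "mode \<Rightarrow> plane" where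
  "freq n = (real_of_int (fst n), real_of_int (snd n))"

definition jbracket :: "mode \<Rightarrow> real" where
  "jbracket n = sqrt (1 + (norm (freq n))\<^sup>2)"

definition modes_upto :: "nat \<Rightarrow> mode set" where
  "modes_upto N = {n. norm (freq n) \<le> real N}"

definition character :: "mode \<Rightarrow> plane \<Rightarrow> complex" where
  "character n x = exp (\<i> * complex_of_real (freq n \<bullet> x))"

text \<open>Normalized Lebesgue measure on a fundamental domain.\<close>

definition torus :: "plane measure" where
  "torus = uniform_measure lborel ({0..2 * pi} \<times> {0..2 * pi})"


section \<open>Distributions on the torus\<close>

definition partial :: "plane \<Rightarrow> (plane \<Rightarrow> complex) \<Rightarrow> plane \<Rightarrow> complex" where
  "partial b f x = frechet_derivative f (at x) b"

text \<open>Iterated partial derivatives, in the coordinate directions listed in the first argument.\<close>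

definition partials :: "plane list \<Rightarrow> (plane \<Rightarrow> complex) \<Rightarrow> plane \<Rightarrow> complex" where
  "partials bs f = foldr partial bs f"

definition smooth :: "(plane \<Rightarrow> complex) \<Rightarrow> bool" where
  "smooth f \<longleftrightarrow> (\<forall>bs \<in> lists Basis. \<forall>x. partials bs f differentiable (at x))"

definition test_functions :: "(plane \<Rightarrow> complex) set" where
  "test_functions = {\<phi>. smooth \<phi> \<and>
     (\<forall>x. \<phi> (x + (2 * pi, 0)) = \<phi> x) \<and> (\<forall>x. \<phi> (x + (0, 2 * pi)) = \<phi> x)}"

text \<open>The supremum is finite on test functions, which are periodic and smooth.\<close>

definition Ck_norm :: "nat \<Rightarrow> (plane \<Rightarrow> complex) \<Rightarrow> real" where
  "Ck_norm k \<phi> = (\<Sum>bs \<in> {bs \<in> lists Basis. length bs \<le> k}. SUP x. norm (partials bs \<phi> x))"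

type_synonym dist = "(plane \<Rightarrow> complex) \<Rightarrow> complex"

text \<open>
  Continuous complex-linear functionals on the test functions. Being extensional makes equality
  of distributions coincide with equality of HOL functions. The pairing is bilinear: a function
  \<open>f\<close> corresponds to the functional sending \<open>\<phi>\<close> to the integral of \<open>f \<phi>\<close> over the torus.
\<close>

definition distributions :: "dist set" where
  "distributions = {T \<in> extensional test_functions.
     (\<forall>\<phi> \<in> test_functions. \<forall>\<psi> \<in> test_functions. \<forall>a b.
        T (\<lambda>x. a * \<phi> x + b * \<psi> x) = a * T \<phi> + b * T \<psi>) \<and>
     (\<exists>k C. \<forall>\<phi> \<in> test_functions. norm (T \<phi>) \<le> C * Ck_norm k \<phi>)}"

definition real_distributions :: "dist set" where
  "real_distributions = {T \<in> distributions. \<forall>\<phi> \<in> test_functions. T (\<lambda>x. cnj (\<phi> x)) = cnj (T \<phi>)}"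

text \<open>
  Both spaces carry the \<open>\<sigma>\<close>-algebra generated by the evaluations at test functions. On each
  separable Sobolev space inside the distributions it induces the Borel \<open>\<sigma>\<close>-algebra.
\<close>

definition dist_space :: "dist measure" where
  "dist_space = restrict_space (\<Pi>\<^sub>M \<phi> \<in> test_functions. borel) distributions"

definition real_dist_space :: "dist measure" where
  "real_dist_space = restrict_space (\<Pi>\<^sub>M \<phi> \<in> test_functions. borel) real_distributions"

definition fourier_coeff :: "dist \<Rightarrow> mode \<Rightarrow> complex" where
  "fourier_coeff T n = T (character (- n))"

text \<open>The Fourier series with coefficients \<open>c\<close> converges to \<open>T\<close> in the sense of distributions.\<close>

definition is_fourier_series :: "(mode \<Rightarrow> complex) \<Rightarrow> dist \<Rightarrow> bool" where
  "is_fourier_series c T \<longleftrightarrow> T \<in> distributions \<and>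
     (\<forall>\<phi> \<in> test_functions.
        (\<lambda>N. \<Sum>n \<in> modes_upto N. c n * (\<integral>x. character n x * \<phi> x \<partial>torus)) \<longlonglongrightarrow> T \<phi>)"


section \<open>The Gaussian data\<close>

text \<open>\<^const>\<open>normal_density\<close> takes the standard deviation, so the variances here are \<open>1/2\<close>.\<close>

definition std_complex_gaussian :: "'a measure \<Rightarrow> ('a \<Rightarrow> complex) \<Rightarrow> bool" where
  "std_complex_gaussian M X \<longleftrightarrow>
     distributed M lborel (\<lambda>\<omega>. Re (X \<omega>)) (normal_density 0 (sqrt (1 / 2))) \<and>
     distributed M lborel (\<lambda>\<omega>. Im (X \<omega>)) (normal_density 0 (sqrt (1 / 2))) \<and>
     prob_space.indep_var M borel (\<lambda>\<omega>. Re (X \<omega>)) borel (\<lambda>\<omega>. Im (X \<omega>))"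

definition hermitian_gaussian :: "'a measure \<Rightarrow> (mode \<Rightarrow> 'a \<Rightarrow> complex) \<Rightarrow> bool" where
  "hermitian_gaussian M h \<longleftrightarrow>
     (\<forall>n. h n \<in> borel_measurable M) \<and>
     (\<forall>n. AE \<omega> in M. h (- n) \<omega> = cnj (h n \<omega>)) \<and>
     distributed M lborel (\<lambda>\<omega>. Re (h 0 \<omega>)) std_normal_density \<and>
     (\<forall>n. n \<noteq> 0 \<longrightarrow> std_complex_gaussian M (h n))"

text \<open>A set of representatives of the modes modulo \<open>n \<mapsto> -n\<close>.\<close>

definition half_modes :: "mode set" where
  "half_modes = {n. 0 < fst n \<or> (fst n = 0 \<and> 0 \<le> snd n)}"

text \<open>
  Independence up to the constraints \<open>h\<^sub>-\<^sub>n = cnj h\<^sub>n\<close> and \<open>l\<^sub>-\<^sub>n = cnj l\<^sub>n\<close>: the variables that remain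
  after keeping one index of each pair \<open>{n, -n}\<close> for \<open>h\<close> and \<open>l\<close> are jointly independent.
\<close>

definition gaussian_family ::
  "'a measure \<Rightarrow> (mode \<Rightarrow> 'a \<Rightarrow> complex) \<Rightarrow> (mode \<Rightarrow> 'a \<Rightarrow> complex) \<Rightarrow> (mode \<Rightarrow> 'a \<Rightarrow> complex) \<Rightarrow> bool"
  where
  "gaussian_family M g h l \<longleftrightarrow>
     prob_space M \<and>
     (\<forall>n. std_complex_gaussian M (g n)) \<and> hermitian_gaussian M h \<and> hermitian_gaussian M l \<and>
     prob_space.indep_vars M (\<lambda>_. borel) (case_sum g (case_sum h l))
       (UNIV <+> half_modes <+> half_modes)"

text \<open>
  \<open>u\<close> is a random distribution and \<open>w0\<close>, \<open>w1\<close> are random real distributions, almost surely given by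
  their random Fourier series.
\<close>

definition gaussian_fields ::
  "real \<Rightarrow> 'a measure \<Rightarrow> (mode \<Rightarrow> 'a \<Rightarrow> complex) \<Rightarrow> (mode \<Rightarrow> 'a \<Rightarrow> complex) \<Rightarrow> (mode \<Rightarrow> 'a \<Rightarrow> complex)
     \<Rightarrow> ('a \<Rightarrow> dist) \<Rightarrow> ('a \<Rightarrow> dist) \<Rightarrow> ('a \<Rightarrow> dist) \<Rightarrow> bool" where
  "gaussian_fields \<gamma> M g h l u w0 w1 \<longleftrightarrow>
     u \<in> measurable M dist_space \<and>
     w0 \<in> measurable M real_dist_space \<and>
     w1 \<in> measurable M real_dist_space \<and>
     (AE \<omega> in M. is_fourier_series (\<lambda>n. g n \<omega> / of_real (jbracket n)) (u \<omega>)) \<and>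
     (AE \<omega> in M. is_fourier_series (\<lambda>n. h n \<omega> / of_real (jbracket n powr (1 - \<gamma>))) (w0 \<omega>)) \<and>
     (AE \<omega> in M. is_fourier_series (\<lambda>n. l n \<omega> / of_real (jbracket n powr (- \<gamma>))) (w1 \<omega>))"

definition law_u :: "'a measure \<Rightarrow> ('a \<Rightarrow> dist) \<Rightarrow> dist measure" where
  "law_u M u = distr M dist_space u"

definition law_triple ::
  "'a measure \<Rightarrow> ('a \<Rightarrow> dist) \<Rightarrow> ('a \<Rightarrow> dist) \<Rightarrow> ('a \<Rightarrow> dist) \<Rightarrow> (dist \<times> dist \<times> dist) measure" where
  "law_triple M u w0 w1 =
     distr M (dist_space \<Otimes>\<^sub>M real_dist_space \<Otimes>\<^sub>M real_dist_space) (\<lambda>\<omega>. (u \<omega>, w0 \<omega>, w1 \<omega>))"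


section \<open>The renormalized interaction\<close>

definition trunc :: "nat \<Rightarrow> dist \<Rightarrow> plane \<Rightarrow> complex" where
  "trunc N u x = (\<Sum>n \<in> modes_upto N. fourier_coeff u n * character n x)"

definition sigma_N :: "nat \<Rightarrow> real" where
  "sigma_N N = (\<Sum>n \<in> modes_upto N. 1 / (jbracket n)\<^sup>2)"

definition wick_square :: "nat \<Rightarrow> dist \<Rightarrow> plane \<Rightarrow> real" where
  "wick_square N u x = (cmod (trunc N u x))\<^sup>2 - sigma_N N"

definition wick_mass :: "nat \<Rightarrow> dist \<Rightarrow> real" where
  "wick_mass N u = (\<integral>x. wick_square N u x \<partial>torus)"

text \<open>
  The integral of the trigonometric polynomial \<^term>\<open>wick_square N u\<close> against \<open>w\<close> is a duality
  pairing, which is real for real distributions \<open>w\<close>.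
\<close>

definition Q_N :: "nat \<Rightarrow> dist \<Rightarrow> dist \<Rightarrow> real" where
  "Q_N N u w = 1 / 2 * Re (w (\<lambda>x. complex_of_real (wick_square N u x)))"


section \<open>Convergence in \<open>L\<^sup>p\<close> and Gibbs measures\<close>

definition in_Lp :: "'b measure \<Rightarrow> real \<Rightarrow> ('b \<Rightarrow> real) \<Rightarrow> bool" where
  "in_Lp \<nu> p f \<longleftrightarrow> f \<in> borel_measurable \<nu> \<and> integrable \<nu> (\<lambda>x. \<bar>f x\<bar> powr p)"

definition Lp_norm :: "'b measure \<Rightarrow> real \<Rightarrow> ('b \<Rightarrow> real) \<Rightarrow> real" where
  "Lp_norm \<nu> p f = (\<integral>x. \<bar>f x\<bar> powr p \<partial>\<nu>) powr (1 / p)"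

definition Lp_tendsto :: "'b measure \<Rightarrow> real \<Rightarrow> (nat \<Rightarrow> 'b \<Rightarrow> real) \<Rightarrow> ('b \<Rightarrow> real) \<Rightarrow> bool" where
  "Lp_tendsto \<nu> p F f \<longleftrightarrow>
     (\<forall>N. in_Lp \<nu> p (F N)) \<and> in_Lp \<nu> p f \<and>
     (\<lambda>N. Lp_norm \<nu> p (\<lambda>x. F N x - f x)) \<longlonglongrightarrow> 0"

definition cutoff_weight ::
  "real \<Rightarrow> (dist \<Rightarrow> real) \<Rightarrow> (dist \<Rightarrow> dist \<Rightarrow> real) \<Rightarrow> dist \<times> dist \<times> dist \<Rightarrow> real" where
  "cutoff_weight K m Q = (\<lambda>(u, w, w'). indicator {u. \<bar>m u\<bar> \<le> K} u * exp (- Q u w))"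

text \<open>
  Here \<open>Z\<close> is the integral of the unnormalized density \<open>f\<close>; that \<open>gibbs_measure \<nu> f\<close> is a probability
  measure presupposes \<open>0 < Z < \<infinity>\<close>, as division by zero gives zero.
\<close>

definition gibbs_density :: "'b measure \<Rightarrow> ('b \<Rightarrow> real) \<Rightarrow> 'b \<Rightarrow> real" where
  "gibbs_density \<nu> f x = (let Z = (\<integral>y. f y \<partial>\<nu>) in f x / Z)"

definition gibbs_measure :: "'b measure \<Rightarrow> ('b \<Rightarrow> real) \<Rightarrow> 'b measure" where
  "gibbs_measure \<nu> f = density \<nu> (\<lambda>x. ennreal (gibbs_density \<nu> f x))"

end

theory Submission
  imports Defs
begin

text \<open>
  Conditionally on \<open>u\<close>, the interaction is a Gaussian variable, so its exponential moments reduce to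
  bounding the expectation of \<open>exp (C \<parallel>:|u\<^sub>N|\<^sup>2:\<parallel>\<^sup>2)\<close> on the cutoff event, the norm being that of
  \<open>H\<^bsup>-(1-\<gamma>)\<^esup>\<close>. The zero mode is controlled by the cutoff. The other modes are generated by adding the
  variables \<open>g\<^sub>n\<close> one at a time in order of increasing \<open>|n|\<close>: given the past, each increment is linear in
  \<open>g\<^sub>n\<close> and its conditional variance is controlled by the mass of the preceding modes, which gives an
  exponential supermartingale. The mass up to frequency \<open>2\<^sup>k\<close> is \<open>O(k)\<close> at all scales beyond the last one at
  which the Wick mass of the remaining modes drops below \<open>-1\<close>. That this last scale is \<open>2\<^sup>k\<close> has probability
  at most \<open>exp (- c 4\<^sup>k)\<close>, whereas the modes below it contribute at most a factor
  \<open>exp (C k\<^sup>2 2\<^bsup>(1+\<gamma>)k\<^esup>)\<close>. The same supermartingale, without cutoff, gives the convergence of the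
  moments. The Wick mass is the sum of \<open>|g\<^sub>0|\<^sup>2\<close> and an independent variable. Hence its limit
  has no atom at \<open>\<plusminus>K\<close>, so that the cutoffs converge, and the cutoff event has positive probability.
\<close>

section \<open>Gaussian exponential moments\<close>

text \<open>The squared norm is a quartic form in the Gaussians, so without the cutoff its
  exponential has infinite expectation as soon as a nonzero mode is present; with it, the obvious
  bound still grows with \<open>N\<close>, the mass being allowed to reach size
  \<open>log N\<close>. Moreover the cutoff looks at the whole field and is not adapted to the order
  in which the modes are added. Hence the supermartingale runs without cutoff: it carries the
  accumulated load in its exponent, where the load both damps the squared norm and is subtracted.
  The cutoff enters only afterwards, pointwise, as a bound on that load; the damping then costs at
  most a factor \<open>e\<close>, and an arbitrarily large constant is afforded by starting from a
  scale with small tail \<open>tau\<close>. Throughout, \<open>s = 1 - \<gamma>\<close>, and the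
  kernel \<open><m>^(-s)\<close> dominates the true weight \<open><m>^(-2s)\<close>. This loss is
  harmless and keeps the lattice sums geometric. That \<open>s\<close> is positive makes the loads
  summable and lets \<open>4^k\<close> beat \<open>k^2 * 2^((2 - s) * k)\<close>.\<close>

lemma (in prob_space) nn_integral_indep_var:
  assumes "indep_var S X T Y" and f: "f \<in> borel_measurable (S \<Otimes>\<^sub>M T)"
  shows "(\<integral>\<^sup>+ \<omega>. f (X \<omega>, Y \<omega>) \<partial>M) = (\<integral>\<^sup>+ \<omega>. \<integral>\<^sup>+ \<omega>'. f (X \<omega>, Y \<omega>') \<partial>M \<partial>M)"
proof -
  have X[measurable]: "X \<in> measurable M S" and Y[measurable]: "Y \<in> measurable M T"
    using assms(1) by (auto dest: indep_var_rv1 indep_var_rv2)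
  have eq: "distr M S X \<Otimes>\<^sub>M distr M T Y = distr M (S \<Otimes>\<^sub>M T) (\<lambda>\<omega>. (X \<omega>, Y \<omega>))"
    using assms(1) by (simp add: indep_var_distribution_eq)
  interpret Y: prob_space "distr M T Y" by (rule prob_space_distr) simp
  have f': "f \<in> borel_measurable (distr M S X \<Otimes>\<^sub>M distr M T Y)"
    using f by (simp cong: measurable_cong_sets)
  have "(\<integral>\<^sup>+ \<omega>. f (X \<omega>, Y \<omega>) \<partial>M) = integral\<^sup>N (distr M S X \<Otimes>\<^sub>M distr M T Y) f"
    unfolding eq using f by (subst nn_integral_distr) auto
  also have "\<dots> = (\<integral>\<^sup>+ x. \<integral>\<^sup>+ y. f (x, y) \<partial>distr M T Y \<partial>distr M S X)"
    using Y.nn_integral_fst[OF f'] by simp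
  also have "\<dots> = (\<integral>\<^sup>+ x. \<integral>\<^sup>+ \<omega>'. f (x, Y \<omega>') \<partial>M \<partial>distr M S X)"
    using f by (intro nn_integral_cong, subst nn_integral_distr) auto
  also have "\<dots> = (\<integral>\<^sup>+ \<omega>. \<integral>\<^sup>+ \<omega>'. f (X \<omega>, Y \<omega>') \<partial>M \<partial>M)"
    using f by (subst nn_integral_distr) auto
  finally show ?thesis .
qed

text \<open>With variance 1/2 the density is proportional to \<open>exp (- x\<^sup>2)\<close>, so
  completing the square leaves a Gaussian of variance \<open>1 / (2 * (1 - T))\<close>, whence
  \<open>T < 1\<close>. The quadratic term is included because a new mode changes a squared norm by
  a linear and a quadratic term.\<close>

lemma nn_integral_normal_density_exp:
  fixes a T :: real
  assumes X: "distributed M lborel X (normal_density 0 (sqrt (1 / 2)))" and T: "T < 1"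
  shows "(\<integral>\<^sup>+ \<omega>. ennreal (exp (a * X \<omega> + T * (X \<omega>)\<^sup>2)) \<partial>M)
           = ennreal (exp (a\<^sup>2 / (4 * (1 - T))) / sqrt (1 - T))"
proof -
  define \<mu> \<sigma> c where "\<mu> = a / (2 * (1 - T))" and "\<sigma> = sqrt (1 / (2 * (1 - T)))"
    and "c = exp (a\<^sup>2 / (4 * (1 - T))) / sqrt (1 - T)"
  have pos: "0 < 1 - T" "0 < \<sigma>" using T by (auto simp: \<sigma>_def)
  have eq: "normal_density 0 (sqrt (1 / 2)) x * exp (a * x + T * x\<^sup>2) = c * normal_density \<mu> \<sigma> x" for x
  proof -
    have "a * x - r * x\<^sup>2 = a\<^sup>2 / (4 * r) - (x - a / (2 * r))\<^sup>2 * r" if "0 < r" for r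
      using that by (simp add: power2_eq_square field_simps)
    from this[OF pos(1)]
    have "- x\<^sup>2 + (a * x + T * x\<^sup>2) = a\<^sup>2 / (4 * (1 - T)) - (x - \<mu>)\<^sup>2 * (1 - T)"
      by (simp add: \<mu>_def algebra_simps)
    then have "exp (- x\<^sup>2) * exp (a * x + T * x\<^sup>2) = exp (a\<^sup>2 / (4 * (1 - T))) * exp (- (x - \<mu>)\<^sup>2 * (1 - T))"
      by (simp flip: exp_add)
    moreover have "normal_density 0 (sqrt (1 / 2)) x = exp (- x\<^sup>2) / sqrt pi"
      by (simp add: normal_density_def power_divide)
    moreover have "normal_density \<mu> \<sigma> x = sqrt (1 - T) * exp (- (x - \<mu>)\<^sup>2 * (1 - T)) / sqrt pi"
    proof -
      have *: "\<sigma>\<^sup>2 = 1 / (2 * (1 - T))" using pos by (simp add: \<sigma>_def)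
      have "2 * \<sigma>\<^sup>2 = 1 / (1 - T)" "2 * pi * \<sigma>\<^sup>2 = pi / (1 - T)"
        unfolding * using pos by (simp_all add: field_simps)
      then show ?thesis
        unfolding normal_density_def using pos by (simp add: real_sqrt_divide)
    qed
    ultimately show ?thesis
      using pos by (simp add: c_def mult_ac)
  qed
  have "(\<integral>\<^sup>+ \<omega>. ennreal (exp (a * X \<omega> + T * (X \<omega>)\<^sup>2)) \<partial>M)
      = (\<integral>\<^sup>+ x. ennreal (normal_density 0 (sqrt (1 / 2)) x) * ennreal (exp (a * x + T * x\<^sup>2)) \<partial>lborel)"
    by (rule distributed_nn_integral[OF X, symmetric]) simp
  also have "\<dots> = (\<integral>\<^sup>+ x. ennreal c * ennreal (normal_density \<mu> \<sigma> x) \<partial>lborel)"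
    using pos by (intro nn_integral_cong) (auto simp: eq c_def ennreal_mult[symmetric] simp del: ennreal_mult')
  also have "\<dots> = ennreal c * (\<integral>\<^sup>+ x. ennreal (normal_density \<mu> \<sigma> x) \<partial>lborel)"
    by (rule nn_integral_cmult) simp
  also have "(\<integral>\<^sup>+ x. ennreal (normal_density \<mu> \<sigma> x) \<partial>lborel) = 1"
    using pos by (subst nn_integral_eq_integral) auto
  finally show ?thesis by (simp add: c_def)
qed

lemma (in prob_space) nn_integral_std_complex_gaussian_exp:
  fixes z :: complex and T :: real
  assumes X: "std_complex_gaussian M X" and T: "T < 1"
  shows "(\<integral>\<^sup>+ \<omega>. ennreal (exp (Re (z * X \<omega>) + T * (cmod (X \<omega>))\<^sup>2)) \<partial>M)
           = ennreal (exp ((cmod z)\<^sup>2 / (4 * (1 - T))) / (1 - T))"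
proof -
  let ?f = "\<lambda>(x, y). ennreal (exp (Re z * x + T * x\<^sup>2)) * ennreal (exp (- Im z * y + T * y\<^sup>2))"
  have ind: "indep_var borel (\<lambda>\<omega>. Re (X \<omega>)) borel (\<lambda>\<omega>. Im (X \<omega>))"
    and d: "distributed M lborel (\<lambda>\<omega>. Re (X \<omega>)) (normal_density 0 (sqrt (1 / 2)))"
           "distributed M lborel (\<lambda>\<omega>. Im (X \<omega>)) (normal_density 0 (sqrt (1 / 2)))"
    using X by (auto simp: std_complex_gaussian_def)
  have [measurable]: "(\<lambda>\<omega>. Re (X \<omega>)) \<in> borel_measurable M" "(\<lambda>\<omega>. Im (X \<omega>)) \<in> borel_measurable M"
    using ind by (auto dest: indep_var_rv1 indep_var_rv2)
  have "(\<integral>\<^sup>+ \<omega>. ennreal (exp (Re (z * X \<omega>) + T * (cmod (X \<omega>))\<^sup>2)) \<partial>M)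
      = (\<integral>\<^sup>+ \<omega>. ?f (Re (X \<omega>), Im (X \<omega>)) \<partial>M)"
    by (intro nn_integral_cong)
       (simp add: cmod_power2 algebra_simps ennreal_mult[symmetric] exp_add[symmetric] del: ennreal_mult')
  also have "\<dots> = (\<integral>\<^sup>+ \<omega>. \<integral>\<^sup>+ \<omega>'. ?f (Re (X \<omega>), Im (X \<omega>')) \<partial>M \<partial>M)"
    by (rule nn_integral_indep_var[OF ind]) measurable
  also have "\<dots> = ennreal (exp ((Re z)\<^sup>2 / (4 * (1 - T))) / sqrt (1 - T)) *
      ennreal (exp ((- Im z)\<^sup>2 / (4 * (1 - T))) / sqrt (1 - T))"
  proof -
    have "(\<integral>\<^sup>+ \<omega>'. ?f (x, Im (X \<omega>')) \<partial>M) = ennreal (exp (Re z * x + T * x\<^sup>2)) *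
        ennreal (exp ((- Im z)\<^sup>2 / (4 * (1 - T))) / sqrt (1 - T))" for x
      unfolding split_conv nn_integral_normal_density_exp[OF d(2) T, symmetric]
      by (rule nn_integral_cmult) measurable
    then show ?thesis
      unfolding nn_integral_normal_density_exp[OF d(1) T, symmetric]
      by (simp add: nn_integral_multc)
  qed
  also have "\<dots> = ennreal (exp ((cmod z)\<^sup>2 / (4 * (1 - T))) / (1 - T))"
    using T by (simp add: ennreal_mult[symmetric] exp_add[symmetric] cmod_power2 add_divide_distrib real_sqrt_mult[symmetric] del: ennreal_mult')
  finally show ?thesis .
qed

section \<open>Adding one Gaussian mode\<close>

text \<open>Fourier coefficient at \<open>m\<close> of the squared modulus of the trigonometric
  polynomial with coefficients \<open>v\<close> on \<open>A\<close>.\<close>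

definition corr :: "mode set \<Rightarrow> (mode \<Rightarrow> complex) \<Rightarrow> mode \<Rightarrow> complex" where
  "corr A v m = (\<Sum>a\<in>A. if a - m \<in> A then v a * cnj (v (a - m)) else 0)"

text \<open>Up to a constant, the load of \<open>n\<close> bounds the conditional variance of the increment of the
  correlations when the mode \<open>n\<close> is added to those in \<open>A\<close>.\<close>

definition load :: "real \<Rightarrow> mode set \<Rightarrow> (mode \<Rightarrow> complex) \<Rightarrow> mode \<Rightarrow> real" where
  "load s A v n = 4 / (jbracket n)\<^sup>2 * (\<Sum>a\<in>A. jbracket (n - a) powr (- s) * (cmod (v a))\<^sup>2)"

text \<open>The head of the list is the mode added last.\<close>

fun total_load :: "real \<Rightarrow> mode set \<Rightarrow> mode list \<Rightarrow> (mode \<Rightarrow> complex) \<Rightarrow> real" where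
  "total_load s A [] v = 0"
| "total_load s A (n # ns) v = total_load s A ns v + load s (A \<union> set ns) v n"

definition coef :: "(mode \<Rightarrow> complex) \<Rightarrow> mode \<Rightarrow> complex" where
  "coef c n = c n / of_real (jbracket n)"

text \<open>In the application \<open>\<rho> m\<close> is \<open><m>^(-2s)\<close> and
  \<open>D\<close> holds one mode of each pair of nonzero opposite modes, so this is half the
  squared Sobolev norm of order \<open>- s\<close> off the zero mode.\<close>

definition wnorm2 :: "(mode \<Rightarrow> real) \<Rightarrow> mode set \<Rightarrow> (mode \<Rightarrow> complex) \<Rightarrow> real" where
  "wnorm2 \<rho> D F = (\<Sum>m\<in>D. \<rho> m * (cmod (F m))\<^sup>2)"

lemma jbracket_ge_1 [simp]: "1 \<le> jbracket n"
  by (simp add: jbracket_def)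

lemma jbracket_pos [simp]: "0 < jbracket n"
  using jbracket_ge_1[of n] by linarith

lemma jbracket_nonzero [simp]: "jbracket n \<noteq> 0"
  using jbracket_pos[of n] by linarith

lemma jbracket_uminus [simp]: "jbracket (- n) = jbracket n"
  by (simp add: jbracket_def freq_def norm_prod_def)

lemma wnorm2_nonneg: "(\<And>m. 0 \<le> \<rho> m) \<Longrightarrow> 0 \<le> wnorm2 \<rho> D F"
  by (auto simp: wnorm2_def intro!: sum_nonneg)

lemma load_nonneg: "0 \<le> load s A v n"
  by (simp add: load_def sum_nonneg)

lemma total_load_nonneg: "0 \<le> total_load s A ns v"
  by (induction ns) (auto intro: add_nonneg_nonneg load_nonneg)

lemma corr_cong: "(\<And>a. a \<in> A \<Longrightarrow> v a = v' a) \<Longrightarrow> corr A v m = corr A v' m"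
  unfolding corr_def by (intro sum.cong) auto

lemma load_cong: "(\<And>a. a \<in> A \<Longrightarrow> v a = v' a) \<Longrightarrow> load s A v n = load s A v' n"
  unfolding load_def by (intro arg_cong2[where f="(*)"] sum.cong) auto

lemma total_load_cong:
  "(\<And>a. a \<in> A \<union> set ns \<Longrightarrow> v a = v' a) \<Longrightarrow> total_load s A ns v = total_load s A ns v'"
  by (induction ns) (auto intro!: arg_cong2[where f="(+)"] load_cong)

text \<open>The new mode pairs with the old ones in two ways, as first and as second factor. For
  \<open>m \<noteq> 0\<close> it does not pair with itself, so the increment is real-linear in
  \<open>v n\<close>; this is why the zero mode is treated apart.\<close>

lemma corr_insert:
  assumes "finite A" "n \<notin> A" "m \<noteq> 0"
  shows "corr (insert n A) v m = corr A v m + v n * cnj (if n - m \<in> A then v (n - m) else 0)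
           + cnj (v n) * (if n + m \<in> A then v (n + m) else 0)"
proof -
  have eq: "a - m = n \<longleftrightarrow> a = n + m" for a by (auto simp: algebra_simps)
  have "(\<Sum>a\<in>A. if a - m \<in> insert n A then v a * cnj (v (a - m)) else 0)
      = (\<Sum>a\<in>A. (if a - m \<in> A then v a * cnj (v (a - m)) else 0) + (if a = n + m then v a * cnj (v n) else 0))"
    using assms by (intro sum.cong) (auto simp: eq)
  also have "\<dots> = corr A v m + (\<Sum>a\<in>A. if a = n + m then v a * cnj (v n) else 0)"
    by (simp add: corr_def sum.distrib)
  also have "(\<Sum>a\<in>A. if a = n + m then v a * cnj (v n) else 0) = cnj (v n) * (if n + m \<in> A then v (n + m) else 0)"
    using assms by (auto simp: sum.delta)
  finally show ?thesis
    using assms by (simp add: corr_def)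
qed

text \<open>Expansion of the square: \<open>Z\<close> collects the cross terms and is bounded by
  Cauchy-Schwarz. That this bound has the norm of \<open>G\<close> as a factor is what later allows
  the Gaussian moment of the linear term to be absorbed into \<open>wnorm2 \<rho> D G\<close>
  itself.\<close>

lemma wnorm2_perturb:
  fixes G p q :: "mode \<Rightarrow> complex"
  assumes "finite D" and \<rho>: "\<And>m. 0 \<le> \<rho> m"
    and S: "2 * (wnorm2 \<rho> D p + wnorm2 \<rho> D q) \<le> S"
  obtains Z where "(cmod Z)\<^sup>2 \<le> 4 * wnorm2 \<rho> D G * S"
    and "\<And>z. wnorm2 \<rho> D (\<lambda>m. G m + z * cnj (p m) + cnj z * q m) \<le> wnorm2 \<rho> D G + Re (Z * z) + S * (cmod z)\<^sup>2"
proof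
  let ?S = "2 * (wnorm2 \<rho> D p + wnorm2 \<rho> D q)"
  define Z where "Z = 2 * (\<Sum>m\<in>D. of_real (\<rho> m) * (cnj (G m) * cnj (p m) + G m * cnj (q m)))"
  have sq: "(cmod (p m) + cmod (q m))\<^sup>2 \<le> 2 * (cmod (p m))\<^sup>2 + 2 * (cmod (q m))\<^sup>2" for m
    using sum_squares_bound[of "cmod (p m)" "cmod (q m)"] by (simp add: power2_sum)
  have sumsq: "(\<Sum>m\<in>D. \<rho> m * (cmod (p m) + cmod (q m))\<^sup>2) \<le> S"
  proof -
    have "(\<Sum>m\<in>D. \<rho> m * (cmod (p m) + cmod (q m))\<^sup>2) \<le> (\<Sum>m\<in>D. \<rho> m * (2 * (cmod (p m))\<^sup>2 + 2 * (cmod (q m))\<^sup>2))"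
      using \<rho> sq by (intro sum_mono mult_left_mono) auto
    also have "\<dots> = ?S" by (simp add: wnorm2_def sum_distrib_left sum.distrib algebra_simps)
    finally show ?thesis using S by linarith
  qed
  have "cmod Z \<le> 2 * (\<Sum>m\<in>D. \<rho> m * (cmod (G m) * (cmod (p m) + cmod (q m))))"
  proof -
    have "cmod (\<Sum>m\<in>D. of_real (\<rho> m) * (cnj (G m) * cnj (p m) + G m * cnj (q m)))
       \<le> (\<Sum>m\<in>D. \<rho> m * (cmod (G m) * (cmod (p m) + cmod (q m))))"
    proof (rule order.trans[OF norm_sum], rule sum_mono)
      fix m
      have "cmod (cnj (G m) * cnj (p m) + G m * cnj (q m)) \<le> cmod (G m) * (cmod (p m) + cmod (q m))"
        by (rule order.trans[OF norm_triangle_ineq]) (simp add: norm_mult algebra_simps)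
      then show "cmod (of_real (\<rho> m) * (cnj (G m) * cnj (p m) + G m * cnj (q m)))
          \<le> \<rho> m * (cmod (G m) * (cmod (p m) + cmod (q m)))"
        using \<rho>[of m] by (simp add: norm_mult mult_left_mono)
    qed
    then show ?thesis by (simp add: Z_def norm_mult)
  qed
  also have "(\<Sum>m\<in>D. \<rho> m * (cmod (G m) * (cmod (p m) + cmod (q m))))
      = (\<Sum>m\<in>D. (sqrt (\<rho> m) * cmod (G m)) * (sqrt (\<rho> m) * (cmod (p m) + cmod (q m))))"
    using \<rho> by (intro sum.cong) (auto simp: mult_ac)
  finally have "(cmod Z)\<^sup>2 \<le> (2 * (\<Sum>m\<in>D. (sqrt (\<rho> m) * cmod (G m)) * (sqrt (\<rho> m) * (cmod (p m) + cmod (q m)))))\<^sup>2"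
    by (intro power_mono) auto
  also have "\<dots> = 4 * (\<Sum>m\<in>D. (sqrt (\<rho> m) * cmod (G m)) * (sqrt (\<rho> m) * (cmod (p m) + cmod (q m))))\<^sup>2"
    by (simp add: power_mult_distrib)
  also have "\<dots> \<le> 4 * ((\<Sum>m\<in>D. (sqrt (\<rho> m) * cmod (G m))\<^sup>2) * (\<Sum>m\<in>D. (sqrt (\<rho> m) * (cmod (p m) + cmod (q m)))\<^sup>2))"
    using Cauchy_Schwarz_ineq_sum by (intro mult_left_mono) auto
  also have "\<dots> = 4 * (wnorm2 \<rho> D G * (\<Sum>m\<in>D. \<rho> m * (cmod (p m) + cmod (q m))\<^sup>2))"
    using \<rho> by (simp add: wnorm2_def power_mult_distrib)
  also have "\<dots> \<le> 4 * (wnorm2 \<rho> D G * S)"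
    using sumsq wnorm2_nonneg[OF \<rho>] by (intro mult_left_mono) auto
  finally show "(cmod Z)\<^sup>2 \<le> 4 * wnorm2 \<rho> D G * S" by simp
  fix z
  have *: "\<rho> m * (cmod (G m + z * cnj (p m) + cnj z * q m))\<^sup>2 \<le> \<rho> m * (cmod (G m))\<^sup>2
      + Re (2 * (of_real (\<rho> m) * (cnj (G m) * cnj (p m) + G m * cnj (q m))) * z)
      + \<rho> m * (cmod (p m) + cmod (q m))\<^sup>2 * (cmod z)\<^sup>2" for m
  proof -
    let ?d = "z * cnj (p m) + cnj z * q m"
    have "cmod ?d \<le> (cmod (p m) + cmod (q m)) * cmod z"
      by (rule order.trans[OF norm_triangle_ineq]) (simp add: norm_mult algebra_simps)
    then have d: "(cmod ?d)\<^sup>2 \<le> (cmod (p m) + cmod (q m))\<^sup>2 * (cmod z)\<^sup>2"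
      by (metis power_mono norm_ge_zero power_mult_distrib)
    have "(cmod (G m + ?d))\<^sup>2 = (cmod (G m))\<^sup>2 + 2 * Re (cnj (G m) * ?d) + (cmod ?d)\<^sup>2"
      unfolding cmod_power2 by (simp add: power2_eq_square algebra_simps)
    also have "Re (cnj (G m) * ?d) = Re ((cnj (G m) * cnj (p m) + G m * cnj (q m)) * z)"
      by (simp add: algebra_simps)
    finally have "(cmod (G m + ?d))\<^sup>2 \<le> (cmod (G m))\<^sup>2 + 2 * Re ((cnj (G m) * cnj (p m) + G m * cnj (q m)) * z)
       + (cmod (p m) + cmod (q m))\<^sup>2 * (cmod z)\<^sup>2" using d by linarith
    from mult_left_mono[OF this \<rho>[of m]] show ?thesis
      by (simp add: algebra_simps)
  qed
  have "wnorm2 \<rho> D (\<lambda>m. G m + z * cnj (p m) + cnj z * q m)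
     \<le> (\<Sum>m\<in>D. \<rho> m * (cmod (G m))\<^sup>2
      + Re (2 * (of_real (\<rho> m) * (cnj (G m) * cnj (p m) + G m * cnj (q m))) * z)
      + \<rho> m * (cmod (p m) + cmod (q m))\<^sup>2 * (cmod z)\<^sup>2)"
    unfolding wnorm2_def by (rule sum_mono) (rule *)
  also have "\<dots> = wnorm2 \<rho> D G + Re (Z * z) + (\<Sum>m\<in>D. \<rho> m * (cmod (p m) + cmod (q m))\<^sup>2) * (cmod z)\<^sup>2"
    unfolding Z_def wnorm2_def sum.distrib Re_sum[symmetric] sum_distrib_right sum_distrib_left ..
  also have "\<dots> \<le> wnorm2 \<rho> D G + Re (Z * z) + S * (cmod z)\<^sup>2"
    using sumsq by (intro add_left_mono mult_right_mono) auto
  finally show "wnorm2 \<rho> D (\<lambda>m. G m + z * cnj (p m) + cnj z * q m) \<le> wnorm2 \<rho> D G + Re (Z * z) + S * (cmod z)\<^sup>2" .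
qed

text \<open>The substitutions \<open>a = n - m\<close> and \<open>a = n + m\<close> turn both sums
  over the output frequency into sums over the old modes, as \<open>m\<close> and
  \<open>n - a\<close> have the same length. The two norms and the factor 2 account for the 4 in
  \<open>load\<close>.\<close>

lemma wnorm2_increment_le_load:
  assumes "finite A" "finite D" and \<rho>: "\<And>m. 0 \<le> \<rho> m" "\<And>m. \<rho> m \<le> jbracket m powr (- s)"
  shows "2 * (wnorm2 \<rho> D (\<lambda>m. if n - m \<in> A then v (n - m) else 0)
            + wnorm2 \<rho> D (\<lambda>m. if n + m \<in> A then v (n + m) else 0)) \<le> (jbracket n)\<^sup>2 * load s A v n"
proof -
  have *: "wnorm2 \<rho> D (\<lambda>m. if h m \<in> A then v (h m) else 0) \<le> (\<Sum>a\<in>A. jbracket (n - a) powr (- s) * (cmod (v a))\<^sup>2)"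
    if h: "inj h" "\<And>m. jbracket (n - h m) = jbracket m" for h
  proof -
    have "wnorm2 \<rho> D (\<lambda>m. if h m \<in> A then v (h m) else 0)
       = (\<Sum>m\<in>{m\<in>D. h m \<in> A}. \<rho> m * (cmod (v (h m)))\<^sup>2)"
      unfolding wnorm2_def using assms(2) by (intro sum.mono_neutral_cong_right) auto
    also have "\<dots> \<le> (\<Sum>m\<in>{m\<in>D. h m \<in> A}. jbracket (n - h m) powr (- s) * (cmod (v (h m)))\<^sup>2)"
      using \<rho> h by (intro sum_mono mult_right_mono) auto
    also have "\<dots> = (\<Sum>a\<in>h ` {m\<in>D. h m \<in> A}. jbracket (n - a) powr (- s) * (cmod (v a))\<^sup>2)"
      using h(1) by (subst sum.reindex) (auto intro: inj_on_subset)
    also have "\<dots> \<le> (\<Sum>a\<in>A. jbracket (n - a) powr (- s) * (cmod (v a))\<^sup>2)"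
      using assms(1) by (intro sum_mono2) auto
    finally show ?thesis .
  qed
  have "wnorm2 \<rho> D (\<lambda>m. if n - m \<in> A then v (n - m) else 0) \<le> (\<Sum>a\<in>A. jbracket (n - a) powr (- s) * (cmod (v a))\<^sup>2)"
    by (rule *) (auto simp: inj_def)
  moreover have "wnorm2 \<rho> D (\<lambda>m. if n + m \<in> A then v (n + m) else 0) \<le> (\<Sum>a\<in>A. jbracket (n - a) powr (- s) * (cmod (v a))\<^sup>2)"
    by (rule *) (auto simp: inj_def)
  ultimately show ?thesis by (simp add: load_def)
qed

text \<open>Here \<open>T\<close> is the load of the past, \<open>L\<close> that of the new mode,
  \<open>H\<close> the present squared norm and \<open>R\<close> the squared coefficient of the
  linear term. The Gaussian moment produces a factor
  \<open>1 / (1 - \<phi> * L) \<le> exp (2 * \<theta> * L)\<close>, paid for by the subtracted load,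
  and multiplies \<open>\<phi> * H\<close> by at most \<open>1 + 2 * \<theta> * L\<close>, paid for
  by the shrinking of the coefficient because \<open>exp (- x) * (1 + x) \<le> 1\<close>.\<close>

lemma supermartingale_exponent:
  fixes \<theta> T L H R :: real
  assumes pos: "0 \<le> \<theta>" "0 \<le> T" "0 \<le> L" "0 \<le> H"
    and \<phi>: "\<phi> = \<theta> * exp (- 2 * \<theta> * (T + L))"
    and R: "R \<le> 4 * H * L"
  shows "\<phi> * L < 1"
    and "exp (\<phi> * H - 2 * \<theta> * (T + L)) * (exp (\<phi>\<^sup>2 * R / (4 * (1 - \<phi> * L))) / (1 - \<phi> * L))
           \<le> exp (\<theta> * exp (- 2 * \<theta> * T) * H - 2 * \<theta> * T)"
proof -
  define \<psi> where "\<psi> = \<theta> * exp (- 2 * \<theta> * T)"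
  have \<psi>: "0 \<le> \<psi>" "\<psi> \<le> \<theta>" using pos by (auto simp: \<psi>_def mult_left_le)
  have \<phi>\<psi>: "\<phi> = \<psi> * exp (- 2 * \<theta> * L)"
    by (simp add: \<phi> \<psi>_def exp_add[symmetric] algebra_simps)
  have e: "exp (- 2 * \<theta> * L) * (1 + 2 * \<theta> * L) \<le> 1"
  proof -
    have "exp (- 2 * \<theta> * L) * (1 + 2 * \<theta> * L) \<le> exp (- 2 * \<theta> * L) * exp (2 * \<theta> * L)"
      by (intro mult_left_mono exp_ge_add_one_self) auto
    then show ?thesis by (simp add: exp_add[symmetric])
  qed
  have \<phi>0: "0 \<le> \<phi>" "\<phi> \<le> \<theta>" using \<psi> pos by (auto simp: \<phi> mult_left_le)
  define t where "t = \<phi> * L"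
  \<comment> \<open>With \<open>x = \<theta> * L\<close> the product \<open>\<phi> * L\<close> is at
    most \<open>x * exp (- 2 * x)\<close>, hence at most 1/2 however large \<open>\<theta>\<close>
    is.\<close>
  have t: "0 \<le> t" "t \<le> 1 / 2" "t \<le> \<theta> * L"
  proof -
    show "0 \<le> t" "t \<le> \<theta> * L" using \<phi>0 pos by (auto simp: t_def mult_right_mono)
    have "\<phi> * L \<le> \<theta> * exp (- 2 * \<theta> * L) * L"
      unfolding \<phi>\<psi> using \<psi> pos by (intro mult_right_mono) auto
    also have "2 * \<dots> = exp (- 2 * \<theta> * L) * (1 + 2 * \<theta> * L) - exp (- 2 * \<theta> * L)" by (simp add: algebra_simps)
    finally show "t \<le> 1 / 2" using e exp_gt_zero[of "- 2 * \<theta> * L"] unfolding t_def by linarith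
  qed
  show "\<phi> * L < 1" using t unfolding t_def by linarith
  have "1 \<le> (1 - t) * (1 + 2 * t)" using t mult_left_mono[OF t(2) t(1)] by (simp add: algebra_simps)
  also have "\<dots> \<le> (1 - t) * exp (2 * t)" using t by (intro mult_left_mono exp_ge_add_one_self) auto
  finally have "1 / (1 - t) \<le> exp (2 * t)" using t by (simp add: field_simps)
  also have "\<dots> \<le> exp (2 * \<theta> * L)" using t by simp
  finally have a: "1 / (1 - t) \<le> exp (2 * \<theta> * L)" .
  have "\<phi>\<^sup>2 * R / (4 * (1 - t)) \<le> \<phi>\<^sup>2 * (4 * H * L) / (4 * (1 - t))"
    using t R by (intro divide_right_mono mult_left_mono) auto
  also have "\<dots> = \<phi> * H * (t / (1 - t))" using t by (simp add: t_def power2_eq_square field_simps)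
  also have "\<dots> \<le> \<phi> * H * (2 * (\<theta> * L))"
  proof (rule mult_left_mono)
    have "t / (1 - t) \<le> 2 * t" using t mult_left_mono[OF t(2) t(1)] by (simp add: field_simps)
    then show "t / (1 - t) \<le> 2 * (\<theta> * L)" using t by linarith
  qed (use \<phi>0 pos in auto)
  finally have "\<phi> * H + \<phi>\<^sup>2 * R / (4 * (1 - t)) \<le> \<psi> * H * (exp (- 2 * \<theta> * L) * (1 + 2 * \<theta> * L))"
    by (simp add: \<phi>\<psi> algebra_simps)
  also have "\<dots> \<le> \<psi> * H" using e \<psi> pos by (intro mult_left_le) auto
  finally have b: "\<phi> * H + \<phi>\<^sup>2 * R / (4 * (1 - t)) \<le> \<psi> * H" .
  have "exp (\<phi> * H - 2 * \<theta> * (T + L)) * (exp (\<phi>\<^sup>2 * R / (4 * (1 - t))) / (1 - t))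
      = exp (\<phi> * H + \<phi>\<^sup>2 * R / (4 * (1 - t)) - 2 * \<theta> * (T + L)) * (1 / (1 - t))"
    by (simp add: exp_add exp_diff)
  also have "\<dots> \<le> exp (\<psi> * H - 2 * \<theta> * (T + L)) * exp (2 * \<theta> * L)"
    using a b t by (intro mult_mono) auto
  also have "\<dots> = exp (\<psi> * H - 2 * \<theta> * T)" by (simp add: exp_add[symmetric] algebra_simps)
  finally show "exp (\<phi> * H - 2 * \<theta> * (T + L)) * (exp (\<phi>\<^sup>2 * R / (4 * (1 - \<phi> * L))) / (1 - \<phi> * L))
           \<le> exp (\<theta> * exp (- 2 * \<theta> * T) * H - 2 * \<theta> * T)"
    unfolding t_def \<psi>_def .
qed

section \<open>Independent modes and the exponential supermartingale\<close>

locale gaussian_modes = prob_space M for M :: "'a measure" +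
  fixes g :: "mode \<Rightarrow> 'a \<Rightarrow> complex"
  assumes gauss: "std_complex_gaussian M (g n)"
    and indep: "indep_vars (\<lambda>_. borel) g UNIV"
begin

lemma g_measurable [measurable]: "g n \<in> borel_measurable M"
  using indep unfolding indep_vars_def by blast

lemma indep_var_restrict_modes:
  assumes "A \<inter> B = {}"
  shows "indep_var (PiM A (\<lambda>_. borel)) (\<lambda>\<omega>. restrict (\<lambda>a. g a \<omega>) A)
           (PiM B (\<lambda>_. borel)) (\<lambda>\<omega>. restrict (\<lambda>a. g a \<omega>) B)"
  using assms by (intro indep_var_restrict[OF indep]) auto

end

lemma measurable_cmod_sq [measurable (raw)]:
  "f \<in> borel_measurable N \<Longrightarrow> (\<lambda>x. (cmod (f x))\<^sup>2) \<in> borel_measurable N"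
  by measurable

lemma borel_measurable_cnj [measurable (raw)]:
  "f \<in> borel_measurable N \<Longrightarrow> (\<lambda>x. cnj (f x)) \<in> borel_measurable N"
  by (rule borel_measurable_continuous_on[OF continuous_on_cnj[OF continuous_on_id]])

lemma borel_measurable_corr:
  assumes "\<And>a. a \<in> A \<Longrightarrow> (\<lambda>x. V x a) \<in> borel_measurable N"
  shows "(\<lambda>x. corr A (V x) m) \<in> borel_measurable N"
  unfolding corr_def
proof (rule borel_measurable_sum)
  fix a assume a: "a \<in> A"
  show "(\<lambda>x. if a - m \<in> A then V x a * cnj (V x (a - m)) else 0) \<in> borel_measurable N"
    using assms[OF a] assms[of "a - m"] by (cases "a - m \<in> A") auto
qed

lemma borel_measurable_wnorm2:
  assumes "\<And>m. m \<in> D \<Longrightarrow> (\<lambda>x. F x m) \<in> borel_measurable N"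
  shows "(\<lambda>x. wnorm2 \<rho> D (F x)) \<in> borel_measurable N"
  unfolding wnorm2_def
  by (intro borel_measurable_sum borel_measurable_times borel_measurable_const measurable_cmod_sq assms)

lemma borel_measurable_load:
  assumes "\<And>a. a \<in> A \<Longrightarrow> (\<lambda>x. V x a) \<in> borel_measurable N"
  shows "(\<lambda>x. load s A (V x) n) \<in> borel_measurable N"
  unfolding load_def
  by (intro borel_measurable_sum borel_measurable_times borel_measurable_const measurable_cmod_sq assms)

lemma borel_measurable_total_load:
  assumes "\<And>a. a \<in> A \<union> set ns \<Longrightarrow> (\<lambda>x. V x a) \<in> borel_measurable N"
  shows "(\<lambda>x. total_load s A ns (V x)) \<in> borel_measurable N"
  using assms by (induction ns) (auto intro!: borel_measurable_add borel_measurable_load)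

lemma borel_measurable_coef:
  assumes "(\<lambda>x. c x n) \<in> borel_measurable N"
  shows "(\<lambda>x. coef (c x) n) \<in> borel_measurable N"
  unfolding coef_def using assms by measurable

text \<open>Exponent of the supermartingale after the modes in \<open>ns\<close> have been added to
  those in \<open>A\<close>. Only what \<open>ns\<close> contributes to the correlations is
  measured, so the low modes in \<open>A\<close> can be estimated separately. The argument
  \<open>c\<close> holds the standard Gaussians, before division by the brackets.\<close>

definition energy :: "real \<Rightarrow> real \<Rightarrow> (mode \<Rightarrow> real) \<Rightarrow> mode set \<Rightarrow> mode set \<Rightarrow> mode list \<Rightarrow> (mode \<Rightarrow> complex) \<Rightarrow> real" where
  "energy \<theta> s \<rho> D A ns c =
     \<theta> * exp (- 2 * \<theta> * total_load s A ns (coef c))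
       * wnorm2 \<rho> D (\<lambda>m. corr (A \<union> set ns) (coef c) m - corr A (coef c) m)
     - 2 * \<theta> * total_load s A ns (coef c)"

lemma coef_cong: "c a = c' a \<Longrightarrow> coef c a = coef c' a"
  by (simp add: coef_def)

lemma energy_cong:
  assumes "\<And>a. a \<in> A \<union> set ns \<Longrightarrow> c a = c' a"
  shows "energy \<theta> s \<rho> D A ns c = energy \<theta> s \<rho> D A ns c'"
proof -
  have "total_load s A ns (coef c) = total_load s A ns (coef c')"
    by (intro total_load_cong coef_cong assms)
  moreover have "corr (A \<union> set ns) (coef c) m = corr (A \<union> set ns) (coef c') m"
    and "corr A (coef c) m = corr A (coef c') m" for m
    using assms by (auto intro!: corr_cong coef_cong)
  ultimately show ?thesis by (simp add: energy_def)
qed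

lemma borel_measurable_energy:
  assumes "\<And>a. a \<in> A \<union> set ns \<Longrightarrow> (\<lambda>x. c x a) \<in> borel_measurable N"
  shows "(\<lambda>x. energy \<theta> s \<rho> D A ns (c x)) \<in> borel_measurable N"
proof -
  have [measurable]: "(\<lambda>x. total_load s A ns (coef (c x))) \<in> borel_measurable N"
    by (intro borel_measurable_total_load borel_measurable_coef assms)
  have [measurable]: "(\<lambda>x. wnorm2 \<rho> D (\<lambda>m. corr (A \<union> set ns) (coef (c x)) m - corr A (coef (c x)) m)) \<in> borel_measurable N"
    by (intro borel_measurable_wnorm2 borel_measurable_diff borel_measurable_corr borel_measurable_coef assms) auto
  show ?thesis unfolding energy_def by measurable
qed

context gaussian_modes
begin

text \<open>
  The factor \<open>exp (- 2 \<theta> T)\<close>, with \<open>T\<close> the total load, shrinks the coefficient of the squared norm just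
  enough at every step to absorb the growth of the exponential moment, whatever the size of \<open>\<theta>\<close>.
\<close>

lemma nn_integral_energy_le_1:
  assumes "0 \<le> \<theta>" "finite A" "finite D" "0 \<notin> D"
    and \<rho>: "\<And>m. 0 \<le> \<rho> m" "\<And>m. \<rho> m \<le> jbracket m powr (- s)"
    and "distinct ns" "set ns \<inter> A = {}"
  shows "(\<integral>\<^sup>+ \<omega>. ennreal (exp (energy \<theta> s \<rho> D A ns (\<lambda>a. g a \<omega>))) \<partial>M) \<le> 1"
  using assms(7,8)
proof (induction ns)
  case Nil
  have "energy \<theta> s \<rho> D A [] c = 0" for c by (simp add: energy_def wnorm2_def)
  then show ?case by (simp add: emeasure_space_1)
next
  case (Cons n ns)
  define B where "B = A \<union> set ns"
  have nB: "n \<notin> B" and "finite B" using Cons.prems assms(2) by (auto simp: B_def)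
  let ?E = "energy \<theta> s \<rho> D A"
  let ?f = "\<lambda>(x, y). ennreal (exp (?E (n # ns) (x(n := y n))))"
  have meas: "?f \<in> borel_measurable (PiM B (\<lambda>_. borel) \<Otimes>\<^sub>M PiM {n} (\<lambda>_. borel))"
  proof -
    have "(\<lambda>p. ?E (n # ns) ((fst p)(n := snd p n))) \<in> borel_measurable (PiM B (\<lambda>_. borel) \<Otimes>\<^sub>M PiM {n} (\<lambda>_. borel))"
    proof (rule borel_measurable_energy)
      fix a assume "a \<in> A \<union> set (n # ns)"
      then consider "a = n" | "a \<noteq> n" "a \<in> B" by (auto simp: B_def)
      then show "(\<lambda>p. ((fst p)(n := snd p n)) a) \<in> borel_measurable (PiM B (\<lambda>_. borel) \<Otimes>\<^sub>M PiM {n} (\<lambda>_. borel))"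
      proof cases
        case 2
        then show ?thesis
          by simp
      qed simp
    qed
    then show ?thesis by (simp add: split_beta')
  qed
  \<comment> \<open>The conditional expectation given the past \<open>x\<close>: the supermartingale
    property.\<close>
  have step: "(\<integral>\<^sup>+ \<omega>. ?f (x, restrict (\<lambda>a. g a \<omega>) {n}) \<partial>M) \<le> ennreal (exp (?E ns x))" for x
  proof -
    define G where "G m = corr B (coef x) m - corr A (coef x) m" for m
    define p q where "p m = (if n - m \<in> B then coef x (n - m) else 0)"
      and "q m = (if n + m \<in> B then coef x (n + m) else 0)" for m
    define L where "L = load s B (coef x) n"
    define T where "T = total_load s A ns (coef x)"
    define \<phi> where "\<phi> = \<theta> * exp (- 2 * \<theta> * (T + L))"
    have S: "2 * (wnorm2 \<rho> D p + wnorm2 \<rho> D q) \<le> (jbracket n)\<^sup>2 * L"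
      unfolding p_def q_def L_def by (intro wnorm2_increment_le_load \<open>finite B\<close> assms)
    obtain Z where Z: "(cmod Z)\<^sup>2 \<le> 4 * wnorm2 \<rho> D G * ((jbracket n)\<^sup>2 * L)"
      and le: "\<And>z. wnorm2 \<rho> D (\<lambda>m. G m + z * cnj (p m) + cnj z * q m) \<le> wnorm2 \<rho> D G + Re (Z * z) + (jbracket n)\<^sup>2 * L * (cmod z)\<^sup>2"
      by (rule wnorm2_perturb[OF \<open>finite D\<close> \<rho>(1) S, where G = G]) (rule that)
    \<comment> \<open>Passing from the coefficient of the new mode to its Gaussian divides by the
      bracket, which cancels the factor \<open>(jbracket n)\<^sup>2\<close> in the bound on
      \<open>Z\<close>.\<close>
    define H R z' where "H = wnorm2 \<rho> D G" and "R = (cmod Z)\<^sup>2 / (jbracket n)\<^sup>2" and "z' = of_real \<phi> * Z / of_real (jbracket n)"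
    have pos: "0 \<le> T" "0 \<le> L" "0 \<le> H" "0 \<le> \<phi>"
      using assms(1) wnorm2_nonneg[OF \<rho>(1)] by (auto simp: T_def L_def H_def \<phi>_def total_load_nonneg load_nonneg)
    have R: "R \<le> 4 * H * L" using Z by (simp add: R_def H_def divide_le_eq mult_ac)
    note se = supermartingale_exponent[OF assms(1) pos(1-3) \<phi>_def R]
    have E: "?E (n # ns) (x(n := y)) \<le> \<phi> * H - 2 * \<theta> * (T + L) + (Re (z' * y) + \<phi> * L * (cmod y)\<^sup>2)" for y
    proof -
      let ?c = "coef (x(n := y))"
      have c: "?c a = coef x a" if "a \<in> B" for a using that nB by (auto simp: coef_def)
      have cn: "?c n = y / of_real (jbracket n)" by (simp add: coef_def)
      have "total_load s A (n # ns) ?c = T + L"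
        unfolding T_def L_def total_load.simps B_def[symmetric] using c
        by (intro arg_cong2[where f="(+)"] total_load_cong load_cong) (auto simp: B_def)
      moreover have "wnorm2 \<rho> D (\<lambda>m. corr (A \<union> set (n # ns)) ?c m - corr A ?c m)
          = wnorm2 \<rho> D (\<lambda>m. G m + ?c n * cnj (p m) + cnj (?c n) * q m)"
        unfolding wnorm2_def
      proof (intro sum.cong refl arg_cong2[where f="(*)"] arg_cong[where f="\<lambda>x. (cmod x)\<^sup>2"])
        fix m assume "m \<in> D"
        then have "m \<noteq> 0" using \<open>0 \<notin> D\<close> by auto
        have "corr (A \<union> set (n # ns)) ?c m = corr B ?c m + ?c n * cnj (if n - m \<in> B then ?c (n - m) else 0)
           + cnj (?c n) * (if n + m \<in> B then ?c (n + m) else 0)"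
          using corr_insert[OF \<open>finite B\<close> nB \<open>m \<noteq> 0\<close>] by (simp add: B_def)
        moreover have "corr B ?c m = corr B (coef x) m" by (intro corr_cong c)
        moreover have "corr A ?c m = corr A (coef x) m" by (intro corr_cong c) (auto simp: B_def)
        moreover have "(if n - m \<in> B then ?c (n - m) else 0) = p m" "(if n + m \<in> B then ?c (n + m) else 0) = q m"
          using c by (auto simp: p_def q_def)
        ultimately show "corr (A \<union> set (n # ns)) ?c m - corr A ?c m = G m + ?c n * cnj (p m) + cnj (?c n) * q m"
          by (simp add: G_def)
      qed
      ultimately have "?E (n # ns) (x(n := y)) = \<phi> * wnorm2 \<rho> D (\<lambda>m. G m + ?c n * cnj (p m) + cnj (?c n) * q m) - 2 * \<theta> * (T + L)"
        by (simp add: energy_def \<phi>_def)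
      also have "\<dots> \<le> \<phi> * (H + Re (Z * ?c n) + (jbracket n)\<^sup>2 * L * (cmod (?c n))\<^sup>2) - 2 * \<theta> * (T + L)"
        using mult_left_mono[OF le[of "?c n"] pos(4)] by (simp add: H_def)
      also have "(jbracket n)\<^sup>2 * L * (cmod (?c n))\<^sup>2 = L * (cmod y)\<^sup>2"
        by (simp add: cn norm_divide power_divide)
      also have "\<phi> * (H + Re (Z * ?c n) + L * (cmod y)\<^sup>2) = \<phi> * H + Re (of_real \<phi> * (Z * ?c n)) + \<phi> * L * (cmod y)\<^sup>2"
        by (simp add: algebra_simps)
      also have "of_real \<phi> * (Z * ?c n) = z' * y" by (simp add: cn z'_def)
      finally show ?thesis by linarith
    qed
    have "(\<integral>\<^sup>+ \<omega>. ?f (x, restrict (\<lambda>a. g a \<omega>) {n}) \<partial>M) \<le> (\<integral>\<^sup>+ \<omega>. ennreal (exp (\<phi> * H - 2 * \<theta> * (T + L))) * ennreal (exp (Re (z' * g n \<omega>) + \<phi> * L * (cmod (g n \<omega>))\<^sup>2)) \<partial>M)"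
      using E by (intro nn_integral_mono) (simp add: ennreal_mult[symmetric] exp_add[symmetric] ennreal_leI del: ennreal_mult'' ennreal_mult')
    also have "\<dots> = ennreal (exp (\<phi> * H - 2 * \<theta> * (T + L))) * ennreal (exp ((cmod z')\<^sup>2 / (4 * (1 - \<phi> * L))) / (1 - \<phi> * L))"
      unfolding nn_integral_std_complex_gaussian_exp[OF gauss[of n] se(1), symmetric]
      by (rule nn_integral_cmult) measurable
    also have "(cmod z')\<^sup>2 = \<phi>\<^sup>2 * R"
      by (simp add: z'_def R_def norm_mult norm_divide power_mult_distrib power_divide)
    also have "ennreal (exp (\<phi> * H - 2 * \<theta> * (T + L))) * ennreal (exp (\<phi>\<^sup>2 * R / (4 * (1 - \<phi> * L))) / (1 - \<phi> * L))
       \<le> ennreal (exp (\<theta> * exp (- 2 * \<theta> * T) * H - 2 * \<theta> * T))"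
      using se by (subst ennreal_mult[symmetric]) (auto intro: ennreal_leI)
    also have "\<theta> * exp (- 2 * \<theta> * T) * H - 2 * \<theta> * T = ?E ns x"
      by (simp add: energy_def T_def H_def G_def[abs_def] B_def)
    finally show ?thesis .
  qed
  have "(\<integral>\<^sup>+ \<omega>. ennreal (exp (?E (n # ns) (\<lambda>a. g a \<omega>))) \<partial>M)
      = (\<integral>\<^sup>+ \<omega>. ?f (restrict (\<lambda>a. g a \<omega>) B, restrict (\<lambda>a. g a \<omega>) {n}) \<partial>M)"
  proof (intro nn_integral_cong)
    fix \<omega>
    have "?E (n # ns) (\<lambda>a. g a \<omega>) = ?E (n # ns) ((restrict (\<lambda>a. g a \<omega>) B)(n := g n \<omega>))"
      by (rule energy_cong) (auto simp: B_def)
    then show "ennreal (exp (?E (n # ns) (\<lambda>a. g a \<omega>))) = ?f (restrict (\<lambda>a. g a \<omega>) B, restrict (\<lambda>a. g a \<omega>) {n})"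
      by simp
  qed
  also have "\<dots> = (\<integral>\<^sup>+ \<omega>. \<integral>\<^sup>+ \<omega>'. ?f (restrict (\<lambda>a. g a \<omega>) B, restrict (\<lambda>a. g a \<omega>') {n}) \<partial>M \<partial>M)"
    using nB by (intro nn_integral_indep_var[OF indep_var_restrict_modes meas]) simp
  also have "\<dots> \<le> (\<integral>\<^sup>+ \<omega>. ennreal (exp (?E ns (restrict (\<lambda>a. g a \<omega>) B))) \<partial>M)"
    by (intro nn_integral_mono step)
  also have "\<dots> = (\<integral>\<^sup>+ \<omega>. ennreal (exp (?E ns (\<lambda>a. g a \<omega>))) \<partial>M)"
  proof (intro nn_integral_cong)
    fix \<omega>
    have "?E ns (restrict (\<lambda>a. g a \<omega>) B) = ?E ns (\<lambda>a. g a \<omega>)"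
      by (rule energy_cong) (auto simp: B_def)
    then show "ennreal (exp (?E ns (restrict (\<lambda>a. g a \<omega>) B))) = ennreal (exp (?E ns (\<lambda>a. g a \<omega>)))"
      by simp
  qed
  also have "\<dots> \<le> 1" using Cons by auto
  finally show ?case .
qed

end

section \<open>Counting lattice points\<close>

definition mass :: "mode set \<Rightarrow> (mode \<Rightarrow> complex) \<Rightarrow> real" where
  "mass A v = (\<Sum>a\<in>A. (cmod (v a))\<^sup>2)"

definition shell :: "nat \<Rightarrow> mode set" where
  "shell k = modes_upto (2 ^ Suc k) - modes_upto (2 ^ k)"

lemma abs_fst_le_norm_freq: "\<bar>real_of_int (fst n)\<bar> \<le> norm (freq n)"
  and abs_snd_le_norm_freq: "\<bar>real_of_int (snd n)\<bar> \<le> norm (freq n)"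
  using norm_fst_le[of "real_of_int (fst n)" "real_of_int (snd n)"]
    norm_snd_le[of "real_of_int (snd n)" "real_of_int (fst n)"] by (auto simp: freq_def)

lemma modes_upto_subset_box: "modes_upto N \<subseteq> {- int N..int N} \<times> {- int N..int N}"
proof
  fix n assume "n \<in> modes_upto N"
  then have "\<bar>real_of_int (fst n)\<bar> \<le> real N" "\<bar>real_of_int (snd n)\<bar> \<le> real N"
    using abs_fst_le_norm_freq[of n] abs_snd_le_norm_freq[of n] by (auto simp: modes_upto_def)
  then have "\<bar>fst n\<bar> \<le> int N" "\<bar>snd n\<bar> \<le> int N" by linarith+
  then show "n \<in> {- int N..int N} \<times> {- int N..int N}" by (cases n) auto
qed

lemma finite_modes_upto [simp]: "finite (modes_upto N)"
  by (rule finite_subset[OF modes_upto_subset_box]) simp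

lemma card_modes_upto: "card (modes_upto N) \<le> (2 * N + 1)\<^sup>2"
proof -
  have "card (modes_upto N) \<le> card ({- int N..int N} \<times> {- int N..int N})"
    by (rule card_mono[OF _ modes_upto_subset_box]) simp
  also have "\<dots> = (2 * N + 1)\<^sup>2" by (simp add: power2_eq_square nat_add_distrib nat_mult_distrib)
  finally show ?thesis .
qed

lemma modes_upto_mono: "L \<le> N \<Longrightarrow> modes_upto L \<subseteq> modes_upto N"
  unfolding modes_upto_def by (intro Collect_mono impI) linarith

lemma zero_in_modes_upto [simp]: "0 \<in> modes_upto N"
  by (simp add: modes_upto_def freq_def)

lemma diff_in_modes_upto:
  assumes "a \<in> modes_upto L" "b \<in> modes_upto N"
  shows "a - b \<in> modes_upto (L + N)"
proof -
  have "freq (a - b) = freq a - freq b" by (simp add: freq_def)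
  then have "norm (freq (a - b)) \<le> norm (freq a) + norm (freq b)" by (simp add: norm_triangle_ineq4)
  then show ?thesis using assms by (simp add: modes_upto_def)
qed

lemma jbracket_gt: "n \<notin> modes_upto N \<Longrightarrow> real N < jbracket n"
  using power_strict_mono[of "real N" "norm (freq n)" 2]
  unfolding jbracket_def modes_upto_def by (intro real_less_rsqrt) auto

lemma finite_shell [simp]: "finite (shell k)" by (simp add: shell_def)

lemma jbracket_shell: "n \<in> shell k \<Longrightarrow> 2 ^ k \<le> jbracket n"
  using jbracket_gt[of n "2 ^ k"] by (auto simp: shell_def)

lemma power2_of_power2: "(2 ^ k)\<^sup>2 = (4 :: 'b :: comm_semiring_1) ^ k"
  by (simp add: power2_eq_square flip: power_mult_distrib)

lemma card_shell: "real (card (shell k)) \<le> 25 * 4 ^ k"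
proof -
  have "card (shell k) \<le> card (modes_upto (2 ^ Suc k))"
    by (intro card_mono) (auto simp: shell_def)
  also have "\<dots> \<le> (2 * 2 ^ Suc k + 1)\<^sup>2" by (rule card_modes_upto)
  \<comment> \<open>\<open>2 * 2 ^ Suc k + 1 \<le> 5 * 2 ^ k\<close>: the origin of the 25 in all
    shell estimates.\<close>
  also have "\<dots> \<le> (5 * 2 ^ k)\<^sup>2"
    by (intro power_mono) auto
  also have "\<dots> = 25 * 4 ^ k" by (simp add: power_mult_distrib power2_of_power2)
  finally show ?thesis using of_nat_mono by fastforce
qed

lemma sum_shell_le:
  fixes c :: real
  assumes "\<And>n. n \<in> shell k \<Longrightarrow> f n \<le> c" "0 \<le> c"
  shows "sum f (shell k) \<le> 25 * 4 ^ k * c"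
proof -
  have "sum f (shell k) \<le> real (card (shell k)) * c"
    using sum_bounded_above[of "shell k" f c] assms by simp
  also have "\<dots> \<le> 25 * 4 ^ k * c" using card_shell assms by (intro mult_right_mono)
  finally show ?thesis .
qed

lemma sum_modes_upto_Suc:
  "sum f (modes_upto (2 ^ Suc k)) = sum f (modes_upto (2 ^ k)) + sum f (shell k)" for f :: "mode \<Rightarrow> real"
  using sum.subset_diff[OF modes_upto_mono[of "2 ^ k" "2 ^ Suc k"], of f]
  unfolding shell_def by (simp add: add.commute)

lemma shells_Suc: "k \<le> K \<Longrightarrow> modes_upto (2 ^ Suc K) - modes_upto (2 ^ k) = (modes_upto (2 ^ K) - modes_upto (2 ^ k)) \<union> shell K"
  using modes_upto_mono[of "2 ^ K" "2 ^ Suc K"] modes_upto_mono[of "2 ^ k" "2 ^ K"] by (auto simp: shell_def)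

lemma sum_shells:
  fixes f :: "mode \<Rightarrow> real"
  assumes "k \<le> K"
  shows "sum f (modes_upto (2 ^ K) - modes_upto (2 ^ k)) = (\<Sum>j\<in>{k..<K}. sum f (shell j))"
  using assms
proof (induction rule: dec_induct)
  case (step K)
  show ?case unfolding shells_Suc[OF step(1)]
    by (subst sum.union_disjoint) (use step in \<open>auto simp: shell_def\<close>)
qed simp

lemma sum_modes_upto_1_le: "(\<And>n. f n \<le> 1) \<Longrightarrow> sum f (modes_upto 1) \<le> (25::real)"
proof -
  assume "\<And>n. f n \<le> (1::real)"
  then have "sum f (modes_upto 1) \<le> real (card (modes_upto 1)) * 1"
    using sum_bounded_above[of "modes_upto 1" f 1] by simp
  also have "real (card (modes_upto 1)) \<le> 9" using card_modes_upto[of 1] by simp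
  finally show ?thesis by simp
qed

text \<open>For \<open>s \<le> 1\<close> the ratio \<open>4 * 2 powr (- s)\<close> is at least 2, so
  the total at most doubles with each shell and the constant 25 survives the induction.\<close>

lemma sum_jbracket_powr_le:
  assumes s: "0 \<le> s" "s \<le> 1"
  shows "(\<Sum>m\<in>modes_upto (2 ^ k). jbracket m powr (- s)) \<le> 25 * (4 * 2 powr (- s)) ^ k"
proof (induction k)
  case 0
  have "jbracket m powr (- s) \<le> 1" for m
    using s powr_mono[of "- s" 0 "jbracket m"] by simp
  then show ?case using sum_modes_upto_1_le by simp
next
  case (Suc k)
  define x where "x = 4 * 2 powr (- s)"
  have x: "2 \<le> x"
    using powr_mono[of "- 1" "- s" 2] s by (simp add: x_def powr_minus_divide field_simps)
  have "(\<Sum>m\<in>shell k. jbracket m powr (- s)) \<le> 25 * 4 ^ k * (2 ^ k) powr (- s)"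
    using s by (intro sum_shell_le powr_mono2' jbracket_shell) auto
  also have "(2 ^ k) powr (- s) = (2 powr (- s)) ^ k"
    by (simp add: powr_powr mult_ac flip: powr_realpow)
  also have "25 * 4 ^ k * \<dots> = 25 * x ^ k" by (simp add: x_def power_mult_distrib)
  finally have "(\<Sum>m\<in>shell k. jbracket m powr (- s)) \<le> 25 * x ^ k" .
  with Suc have "(\<Sum>m\<in>modes_upto (2 ^ Suc k). jbracket m powr (- s)) \<le> 2 * (25 * x ^ k)"
    unfolding sum_modes_upto_Suc x_def by linarith
  also have "\<dots> \<le> x * (25 * x ^ k)" using x by (intro mult_right_mono) auto
  finally show ?case by (simp add: x_def)
qed

text \<open>On the shell the bracket of \<open>n\<close> is at least \<open>2 ^ k\<close>, and
  \<open>n - a\<close> runs injectively through modes of length at most \<open>2 ^ (k + 2)\<close>.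
  The constant is \<open>4 * 25 * 4 ^ 2\<close>, the last factor coming from the two additional
  scales.\<close>

lemma sum_shell_kernel_le:
  assumes s: "0 \<le> s" "s \<le> 1" and a: "a \<in> modes_upto (2 ^ Suc k)"
  shows "(\<Sum>n\<in>shell k. 4 / (jbracket n)\<^sup>2 * jbracket (n - a) powr (- s)) \<le> 1600 * (2 powr (- s)) ^ k"
proof -
  define r where "r = 2 powr (- s)"
  have r: "0 \<le> r" "r \<le> 1" using powr_mono[of "- s" 0 2] s by (auto simp: r_def)
  have "(\<Sum>n\<in>shell k. 4 / (jbracket n)\<^sup>2 * jbracket (n - a) powr (- s))
      \<le> (\<Sum>n\<in>shell k. 4 / 4 ^ k * jbracket (n - a) powr (- s))"
  proof (intro sum_mono mult_right_mono divide_left_mono)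
    fix n assume "n \<in> shell k"
    from power_mono[OF jbracket_shell[OF this], of 2]
    show "4 ^ k \<le> (jbracket n)\<^sup>2" by (simp add: power2_of_power2)
  qed auto
  also have "\<dots> = 4 / 4 ^ k * (\<Sum>n\<in>shell k. jbracket (n - a) powr (- s))" by (simp add: sum_distrib_left)
  also have "\<dots> \<le> 4 / 4 ^ k * (25 * (4 * r) ^ Suc (Suc k))"
  proof (rule mult_left_mono)
    have "(\<Sum>n\<in>shell k. jbracket (n - a) powr (- s)) = (\<Sum>m\<in>(\<lambda>n. n - a) ` shell k. jbracket m powr (- s))"
      by (subst sum.reindex) (auto simp: inj_on_def)
    also have "\<dots> \<le> (\<Sum>m\<in>modes_upto (2 ^ Suc (Suc k)). jbracket m powr (- s))"
    proof (rule sum_mono2)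
      show "(\<lambda>n. n - a) ` shell k \<subseteq> modes_upto (2 ^ Suc (Suc k))"
        using diff_in_modes_upto[OF _ a, of _ "2 ^ Suc k"] by (auto simp: shell_def)
    qed auto
    also have "\<dots> \<le> 25 * (4 * r) ^ Suc (Suc k)" unfolding r_def by (rule sum_jbracket_powr_le[OF s])
    finally show "(\<Sum>n\<in>shell k. jbracket (n - a) powr (- s)) \<le> 25 * (4 * r) ^ Suc (Suc k)" .
  qed simp
  also have "\<dots> = 1600 * r ^ k * (r * r)"
    by (simp add: power_mult_distrib field_simps)
  also have "\<dots> \<le> 1600 * r ^ k" using r by (intro mult_left_le) (auto simp: mult_le_one)
  finally show ?thesis unfolding r_def by simp
qed

lemma sigma_N_mono: "L \<le> N \<Longrightarrow> sigma_N L \<le> sigma_N N"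
  unfolding sigma_N_def by (intro sum_mono2 modes_upto_mono) auto

text \<open>Every shell contributes at most 25, whence the logarithmic growth of the renormalization
  constant.\<close>

lemma sigma_N_pow2_le: "sigma_N (2 ^ k) \<le> 25 * (real k + 1)"
proof (induction k)
  case 0
  have "1 / (jbracket m)\<^sup>2 \<le> 1" for m using power_mono[OF jbracket_ge_1, of 2 m] by (simp add: divide_le_eq)
  then show ?case using sum_modes_upto_1_le by (simp add: sigma_N_def)
next
  case (Suc k)
  have "1 / (jbracket m)\<^sup>2 \<le> 1 / 4 ^ k" if "m \<in> shell k" for m
    using power_mono[OF jbracket_shell[OF that], of 2]
    by (intro divide_left_mono) (auto simp: power2_of_power2)
  then have "(\<Sum>n\<in>shell k. 1 / (jbracket n)\<^sup>2) \<le> 25 * 4 ^ k * (1 / 4 ^ k)"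
    by (intro sum_shell_le) auto
  with Suc show ?case unfolding sigma_N_def sum_modes_upto_Suc by simp
qed

text \<open>The sum is the variance of the Wick mass of the modes in \<open>S\<close>. Shell
  \<open>j\<close> contributes at most \<open>25 / 4 ^ j\<close>; the bound
  \<open>50 / 4 ^ k - 50 / 4 ^ K\<close> is carried through the induction because its increments
  leave room for that.\<close>

lemma sum_jbracket4_le:
  assumes S: "finite S" "S \<inter> modes_upto (2 ^ k) = {}"
  shows "(\<Sum>n\<in>S. 1 / jbracket n ^ 4) \<le> 50 / 4 ^ k"
proof -
  have "\<exists>K\<ge>k. S \<subseteq> modes_upto (2 ^ K)"
  proof -
    obtain R where R: "\<And>n. n \<in> S \<Longrightarrow> norm (freq n) \<le> R"
      using bdd_above_finite[of "(\<lambda>n. norm (freq n)) ` S"] S(1) by (auto simp: bdd_above_def)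
    obtain K where K: "R < 2 ^ K" using real_arch_pow[of 2 R] by auto
    have "S \<subseteq> modes_upto (2 ^ max K k)"
    proof
      fix n assume "n \<in> S"
      have "(2::real) ^ K \<le> 2 ^ max K k" by (intro power_increasing) auto
      with R[OF \<open>n \<in> S\<close>] K show "n \<in> modes_upto (2 ^ max K k)" unfolding modes_upto_def mem_Collect_eq of_nat_power of_nat_numeral by linarith
    qed
    then show ?thesis by (intro exI[of _ "max K k"]) auto
  qed
  then obtain K where K: "k \<le> K" "S \<subseteq> modes_upto (2 ^ K)" by auto
  have "(\<Sum>n\<in>S. 1 / jbracket n ^ 4) \<le> (\<Sum>n\<in>modes_upto (2 ^ K) - modes_upto (2 ^ k). 1 / jbracket n ^ 4)"
    using S K by (intro sum_mono2) auto
  also have "\<dots> \<le> 50 / 4 ^ k - 50 / 4 ^ K"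
    unfolding sum_shells[OF K(1)] using K(1)
  proof (induction rule: dec_induct)
    case (step K)
    have "(\<Sum>n\<in>shell K. 1 / jbracket n ^ 4) \<le> 25 * 4 ^ K * (1 / (2 ^ K) ^ 4)"
      by (intro sum_shell_le divide_left_mono power_mono jbracket_shell) auto
    also have "((2::real) ^ K) ^ 4 = 4 ^ K * 4 ^ K"
      using power2_of_power2[of K, where 'b=real] by (simp add: power4_eq_xxxx power2_eq_square)
    finally have "(\<Sum>n\<in>shell K. 1 / jbracket n ^ 4) \<le> 25 / 4 ^ K" by simp
    moreover have "(\<Sum>j\<in>{k..<Suc K}. \<Sum>n\<in>shell j. 1 / jbracket n ^ 4)
        = (\<Sum>j\<in>{k..<K}. \<Sum>n\<in>shell j. 1 / jbracket n ^ 4) + (\<Sum>n\<in>shell K. 1 / jbracket n ^ 4)"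
      using step(1) by simp
    moreover have "50 / 4 ^ K = 2 * (25 / (4::real) ^ K)" "50 / 4 ^ Suc K = (25 / 4 ^ K) / (2::real)"
      "(0::real) \<le> 25 / 4 ^ K" by simp_all
    moreover have "b \<le> z - y" if "a \<le> e" "b = c + a" "x = 2 * e" "y = e / 2" "0 \<le> e" "c \<le> z - x"
      for a b c e x y z :: real using that by linarith
    ultimately show ?case using step(3) by blast
  qed simp
  also have "\<dots> \<le> 50 / 4 ^ k" by simp
  finally show ?thesis .
qed

text \<open>The load along a list depends on how modes of equal length are ordered. Here every mode
  no longer than \<open>n\<close>, including \<open>n\<close> itself, counts as its past, which
  gives an upper bound free of the list.\<close>

definition full_load :: "real \<Rightarrow> nat \<Rightarrow> nat \<Rightarrow> (mode \<Rightarrow> complex) \<Rightarrow> real" where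
  "full_load s L N v = (\<Sum>n\<in>modes_upto N - modes_upto L. load s {a \<in> modes_upto N. norm (freq a) \<le> norm (freq n)} v n)"

lemma load_mono: "finite B \<Longrightarrow> A \<subseteq> B \<Longrightarrow> load s A v n \<le> load s B v n"
  unfolding load_def by (intro mult_left_mono sum_mono2) auto

lemma total_load_le_full_load:
  assumes "set ns = modes_upto N - modes_upto L" "distinct ns" "L \<le> N"
    and "sorted_wrt (\<lambda>a b. norm (freq b) \<le> norm (freq a)) ns"
  shows "total_load s (modes_upto L) ns v \<le> full_load s L N v"
proof -
  have "total_load s (modes_upto L) ns v \<le> (\<Sum>n\<in>set ns. load s {a \<in> modes_upto N. norm (freq a) \<le> norm (freq n)} v n)"
    if "set ns \<subseteq> modes_upto N - modes_upto L" "distinct ns" "sorted_wrt (\<lambda>a b. norm (freq b) \<le> norm (freq a)) ns" for ns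
    using that
  proof (induction ns)
    case (Cons n ns)
    have "load s (modes_upto L \<union> set ns) v n \<le> load s {a \<in> modes_upto N. norm (freq a) \<le> norm (freq n)} v n"
    proof (rule load_mono)
      have "norm (freq a) \<le> norm (freq n)" if "a \<in> modes_upto L" for a
        using that Cons.prems(1) by (auto simp: modes_upto_def)
      then show "modes_upto L \<union> set ns \<subseteq> {a \<in> modes_upto N. norm (freq a) \<le> norm (freq n)}"
        using Cons.prems modes_upto_mono[OF assms(3)] by auto
    qed simp
    with Cons show ?case by simp
  qed simp
  from this[of ns] assms show ?thesis by (simp add: full_load_def)
qed

text \<open>The modes \<open>n\<close> are grouped by shell: the past of a mode in shell
  \<open>j\<close> lies below \<open>2 ^ Suc j\<close>, and after exchanging the sums
  \<open>sum_shell_kernel_le\<close> applies at every old mode. So the load of a shell is controlled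
  by the mass alone, with a geometric gain.\<close>

lemma full_load_le:
  assumes s: "0 \<le> s" "s \<le> 1" and N: "N \<le> 2 ^ K" "k \<le> K"
  shows "full_load s (min N (2 ^ k)) N v
    \<le> (\<Sum>j\<in>{k..<K}. 1600 * (2 powr (- s)) ^ j * mass (modes_upto (min N (2 ^ Suc j))) v)"
proof -
  define f where "f n = (if n \<in> modes_upto N then load s {a \<in> modes_upto N. norm (freq a) \<le> norm (freq n)} v n else 0)" for n
  have "modes_upto N - modes_upto (min N (2 ^ k)) \<subseteq> modes_upto (2 ^ K) - modes_upto (2 ^ k)"
    using modes_upto_mono[OF N(1)] by (auto simp: min_def)
  moreover have "full_load s (min N (2 ^ k)) N v = sum f (modes_upto N - modes_upto (min N (2 ^ k)))"
    unfolding full_load_def by (intro sum.cong) (auto simp: f_def)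
  moreover have "0 \<le> f n" for n by (simp add: f_def load_nonneg)
  ultimately have "full_load s (min N (2 ^ k)) N v \<le> sum f (modes_upto (2 ^ K) - modes_upto (2 ^ k))"
    by (simp add: sum_mono2)
  also have "\<dots> = (\<Sum>j\<in>{k..<K}. sum f (shell j))" by (rule sum_shells[OF N(2)])
  also have "\<dots> \<le> (\<Sum>j\<in>{k..<K}. 1600 * (2 powr (- s)) ^ j * mass (modes_upto (min N (2 ^ Suc j))) v)"
  proof (rule sum_mono)
    fix j
    let ?P = "modes_upto (min N (2 ^ Suc j))"
    have P: "?P \<subseteq> modes_upto (2 ^ Suc j)" by (intro modes_upto_mono) simp
    have "sum f (shell j) \<le> (\<Sum>n\<in>shell j. load s ?P v n)"
    proof (rule sum_mono)
      fix n assume n: "n \<in> shell j"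
      have "{a \<in> modes_upto N. norm (freq a) \<le> norm (freq n)} \<subseteq> ?P"
        using n by (auto simp: shell_def modes_upto_def min_def)
      then show "f n \<le> load s ?P v n" by (auto simp: f_def load_nonneg intro: load_mono)
    qed
    also have "\<dots> = (\<Sum>a\<in>?P. (\<Sum>n\<in>shell j. 4 / (jbracket n)\<^sup>2 * jbracket (n - a) powr (- s)) * (cmod (v a))\<^sup>2)"
      unfolding load_def sum_distrib_left sum_distrib_right by (subst sum.swap) (simp add: mult_ac)
    also have "\<dots> \<le> (\<Sum>a\<in>?P. 1600 * (2 powr (- s)) ^ j * (cmod (v a))\<^sup>2)"
      using s P by (intro sum_mono mult_right_mono sum_shell_kernel_le) auto
    finally show "sum f (shell j) \<le> 1600 * (2 powr (- s)) ^ j * mass ?P v"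
      by (simp add: mass_def sum_distrib_left)
  qed
  finally show ?thesis .
qed

lemma exists_sorted_list:
  fixes w :: "'b \<Rightarrow> real"
  assumes "finite S"
  obtains ns where "set ns = S" "distinct ns" "sorted_wrt (\<lambda>a b. w b \<le> w a) ns"
proof -
  obtain xs where xs: "set xs = S" "distinct xs" using finite_distinct_list[OF assms] by auto
  show thesis
  proof (rule that)
  show "set (rev (sort_key w xs)) = S" "distinct (rev (sort_key w xs))" using xs by auto
  show "sorted_wrt (\<lambda>a b. w b \<le> w a) (rev (sort_key w xs))"
    using sorted_sort_key[of w xs] by (simp add: sorted_wrt_rev sorted_map)
  qed
qed

section \<open>Moments of the Wick mass\<close>

text \<open>The left side is the moment generating function at \<open>x\<close> of
  \<open>(cmod X)\<^sup>2 - 1\<close> for a standard complex Gaussian \<open>X\<close>. The bound of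
  sub-Gaussian type holds for all negative \<open>x\<close>, as the lower tail of the Wick mass
  requires.\<close>

lemma exp_div_one_minus_le:
  fixes x :: real
  assumes "x \<le> 1 / 2"
  shows "exp (- x) / (1 - x) \<le> exp (2 * x\<^sup>2)"
proof -
  have "- x - 2 * x\<^sup>2 \<le> ln (1 - x)"
  proof -
    consider "0 \<le> x" | "- 1 \<le> x" "x < 0" | "x < - 1" by linarith
    then show ?thesis
    proof cases
      case 1 then show ?thesis using ln_one_minus_pos_lower_bound[of x] assms by simp
    next
      case 2
      then have "- x - x\<^sup>2 \<le> ln (1 - x)" using ln_one_plus_pos_lower_bound[of "- x"] by simp
      then show ?thesis using zero_le_power2[of x] by linarith
    next
      case 3
      have "- x * 1 \<le> - x * - x" using 3 by (intro mult_left_mono) auto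
      then have "- x \<le> x\<^sup>2" by (simp add: power2_eq_square)
      moreover have "0 \<le> ln (1 - x)" using 3 by (intro ln_ge_zero) auto
      ultimately show ?thesis using zero_le_power2[of x] by linarith
    qed
  qed
  then have "exp (- x - 2 * x\<^sup>2) \<le> 1 - x" using assms by (simp add: ln_ge_iff)
  then have "exp (- x) \<le> exp (2 * x\<^sup>2) * (1 - x)" by (simp add: exp_diff divide_le_eq mult.commute)
  then show ?thesis using assms by (simp add: divide_le_eq)
qed

lemma inverse_one_minus_le_exp:
  fixes x :: real
  assumes "0 \<le> x" "x \<le> 1 / 2"
  shows "1 / (1 - x) \<le> exp (2 * x)"
proof -
  have "1 \<le> (1 - x) * (1 + 2 * x)" using assms mult_left_mono[OF assms(2,1)] by (simp add: algebra_simps)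
  also have "\<dots> \<le> (1 - x) * exp (2 * x)" using assms by (intro mult_left_mono exp_ge_add_one_self) auto
  finally show ?thesis using assms by (simp add: field_simps)
qed

lemma power_le_fact_exp:
  fixes x :: real
  assumes "0 \<le> x"
  shows "x ^ q \<le> fact q * exp x"
proof -
  have "x ^ q /\<^sub>R fact q \<le> (\<Sum>n. x ^ n /\<^sub>R fact n)"
    using sum_le_suminf[OF summable_exp_generic[of x], of "{q}"] assms by simp
  then show ?thesis by (simp add: exp_def field_simps)
qed

lemma power_even_le_fact_exp: "x ^ (2 * q) \<le> fact (2 * q) * (exp x + exp (- x))" for x :: real
proof -
  have "x ^ (2 * q) = \<bar>x\<bar> ^ (2 * q)" by (simp add: power_mult)
  also have "\<dots> \<le> fact (2 * q) * exp \<bar>x\<bar>" by (rule power_le_fact_exp) simp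
  also have "\<dots> \<le> fact (2 * q) * (exp x + exp (- x))" by (intro mult_left_mono) (auto simp: abs_if)
  finally show ?thesis .
qed

text \<open>A summand is the constant of \<open>sum_shell_kernel_le\<close> times the bound \<open>25 (n + 2)\<close> on
  \<open>sigma_N (2\<^bsup>n + 1\<^esup>)\<close>; the tail \<open>tau s k\<close> bounds the expected load of the modes beyond \<open>2\<^sup>k\<close>.\<close>

definition tau_term :: "real \<Rightarrow> nat \<Rightarrow> real" where
  "tau_term s n = 40000 * (real n + 2) * (2 powr (- s)) ^ n"

definition tau :: "real \<Rightarrow> nat \<Rightarrow> real" where
  "tau s k = suminf (tau_term s) - sum (tau_term s) {..<k}"

lemma summable_tau_term:
  assumes "0 < s"
  shows "summable (tau_term s)"
proof -
  define r where "r = 2 powr (- s)"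
  have r: "0 < r" "r < 1" using assms by (auto simp: r_def powr_less_one)
  have "summable (\<lambda>n. real (Suc n) * r ^ n)"
    using geometric_deriv_sums[of r] r by (auto simp: sums_iff)
  moreover have "summable (\<lambda>n. r ^ n)" using r by (simp add: summable_geometric)
  ultimately have "summable (\<lambda>n. 40000 * (real (Suc n) * r ^ n + r ^ n))"
    by (intro summable_mult summable_add)
  then show ?thesis by (simp add: tau_term_def[abs_def] r_def algebra_simps)
qed

lemma tau_term_pos: "0 < tau_term s n"
  by (simp add: tau_term_def)

lemma sum_le_tau:
  assumes "0 < s" "k \<le> K"
  shows "sum (tau_term s) {k..<K} \<le> tau s k"
proof -
  have "sum (tau_term s) {..<K} \<le> suminf (tau_term s)"
    using tau_term_pos less_imp_le by (intro sum_le_suminf summable_tau_term assms) auto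
  moreover have "sum (tau_term s) {..<K} = sum (tau_term s) {..<k} + sum (tau_term s) {k..<K}"
    using assms(2) by (subst sum.union_disjoint[symmetric]) (auto intro!: sum.cong)
  ultimately show ?thesis by (simp add: tau_def)
qed

lemma tau_pos: "0 < s \<Longrightarrow> 0 < tau s k"
  using sum_le_tau[of s k "Suc k"] tau_term_pos[of s k] by simp

lemma tau_tendsto_0: "0 < s \<Longrightarrow> tau s \<longlonglongrightarrow> 0"
  unfolding tau_def[abs_def] using tendsto_diff[OF tendsto_const summable_LIMSEQ[OF summable_tau_term], of s "suminf (tau_term s)"] by simp

section \<open>Exponential moments of the Wick mass and of the load\<close>

context gaussian_modes
begin

lemma nn_integral_exp_square_sum:
  assumes "finite S" "\<And>a. a \<in> S \<Longrightarrow> d a < 1"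
  shows "(\<integral>\<^sup>+ \<omega>. ennreal (exp (\<Sum>a\<in>S. d a * (cmod (g a \<omega>))\<^sup>2)) \<partial>M) = ennreal (\<Prod>a\<in>S. 1 / (1 - d a))"
proof -
  have ind: "indep_vars (\<lambda>_. borel) (\<lambda>a \<omega>. ennreal (exp (d a * (cmod (g a \<omega>))\<^sup>2))) S"
    by (rule indep_vars_compose2[OF indep_vars_subset[OF indep]]) auto
  have "(\<integral>\<^sup>+ \<omega>. ennreal (exp (\<Sum>a\<in>S. d a * (cmod (g a \<omega>))\<^sup>2)) \<partial>M)
      = (\<integral>\<^sup>+ \<omega>. (\<Prod>a\<in>S. ennreal (exp (d a * (cmod (g a \<omega>))\<^sup>2))) \<partial>M)"
    using assms by (simp add: exp_sum prod_ennreal)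
  also have "\<dots> = (\<Prod>a\<in>S. \<integral>\<^sup>+ \<omega>. ennreal (exp (d a * (cmod (g a \<omega>))\<^sup>2)) \<partial>M)"
    by (rule indep_vars_nn_integral[OF assms(1) ind]) simp
  also have "\<dots> = (\<Prod>a\<in>S. ennreal (1 / (1 - d a)))"
  proof (intro prod.cong refl)
    fix a assume "a \<in> S"
    from nn_integral_std_complex_gaussian_exp[OF gauss[of a] assms(2)[OF this], of 0]
    show "(\<integral>\<^sup>+ \<omega>. ennreal (exp (d a * (cmod (g a \<omega>))\<^sup>2)) \<partial>M) = ennreal (1 / (1 - d a))" by simp
  qed
  also have "\<dots> = ennreal (\<Prod>a\<in>S. 1 / (1 - d a))"
    using assms(2) by (intro prod_ennreal) (simp add: less_imp_le)
  finally show ?thesis .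
qed

lemma nn_integral_exp_square_sum_le:
  assumes "finite S" "\<And>a. a \<in> S \<Longrightarrow> 0 \<le> d a" "\<And>a. a \<in> S \<Longrightarrow> d a \<le> 1 / 2"
  shows "(\<integral>\<^sup>+ \<omega>. ennreal (exp (\<Sum>a\<in>S. d a * (cmod (g a \<omega>))\<^sup>2)) \<partial>M) \<le> ennreal (exp (2 * sum d S))"
proof -
  have "d a < 1" if "a \<in> S" for a using assms(3)[OF that] by simp
  moreover have "(\<Prod>a\<in>S. 1 / (1 - d a)) \<le> (\<Prod>a\<in>S. exp (2 * d a))"
    using assms by (intro prod_mono) (force intro: inverse_one_minus_le_exp)
  ultimately show ?thesis
    using assms(1) by (simp add: nn_integral_exp_square_sum exp_sum[symmetric] sum_distrib_left ennreal_leI)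
qed

definition wick :: "mode set \<Rightarrow> 'a \<Rightarrow> real" where
  "wick S \<omega> = (\<Sum>a\<in>S. ((cmod (g a \<omega>))\<^sup>2 - 1) / (jbracket a)\<^sup>2)"

abbreviation modes_at :: "'a \<Rightarrow> mode \<Rightarrow> complex" where
  "modes_at \<omega> \<equiv> coef (\<lambda>a. g a \<omega>)"

lemma wick_measurable [measurable]: "wick S \<in> borel_measurable M"
  unfolding wick_def[abs_def] by measurable

lemma mass_modes_at: "mass S (modes_at \<omega>) = wick S \<omega> + (\<Sum>a\<in>S. 1 / (jbracket a)\<^sup>2)"
  by (simp add: mass_def wick_def coef_def norm_divide power_divide diff_divide_distrib sum_subtractf)

lemma wick_diff: "finite S \<Longrightarrow> R \<subseteq> S \<Longrightarrow> wick S \<omega> - wick R \<omega> = wick (S - R) \<omega>"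
  unfolding wick_def by (simp add: sum_diff)

text \<open>By independence the moment generating functions multiply. Centring removes the linear
  term in \<open>t\<close>, whose coefficient would be the divergent sum of
  \<open>1 / (jbracket a)\<^sup>2\<close>, and leaves the convergent sum of inverse fourth
  powers.\<close>

lemma nn_integral_exp_wick_le:
  assumes "finite S" "\<And>a. a \<in> S \<Longrightarrow> t / (jbracket a)\<^sup>2 \<le> 1 / 2"
  shows "(\<integral>\<^sup>+ \<omega>. ennreal (exp (t * wick S \<omega>)) \<partial>M) \<le> ennreal (exp (2 * t\<^sup>2 * (\<Sum>a\<in>S. 1 / jbracket a ^ 4)))"
proof -
  define d where "d a = t / (jbracket a)\<^sup>2" for a
  have d: "d a \<le> 1 / 2" if "a \<in> S" for a using assms(2)[OF that] by (simp add: d_def)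
  have "t * wick S \<omega> = (\<Sum>a\<in>S. d a * (cmod (g a \<omega>))\<^sup>2) + (\<Sum>a\<in>S. - d a)" for \<omega>
    by (simp add: wick_def sum_distrib_left d_def diff_divide_distrib right_diff_distrib sum_subtractf sum_negf)
  then have "(\<integral>\<^sup>+ \<omega>. ennreal (exp (t * wick S \<omega>)) \<partial>M)
     = (\<integral>\<^sup>+ \<omega>. ennreal (exp (\<Sum>a\<in>S. d a * (cmod (g a \<omega>))\<^sup>2)) * ennreal (exp (\<Sum>a\<in>S. - d a)) \<partial>M)"
    by (simp add: exp_add ennreal_mult)
  also have "\<dots> = (\<integral>\<^sup>+ \<omega>. ennreal (exp (\<Sum>a\<in>S. d a * (cmod (g a \<omega>))\<^sup>2)) \<partial>M) * ennreal (exp (\<Sum>a\<in>S. - d a))"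
    by (rule nn_integral_multc) measurable
  also have "\<dots> = ennreal (\<Prod>a\<in>S. 1 / (1 - d a)) * ennreal (exp (\<Sum>a\<in>S. - d a))"
    using d assms(1) by (subst nn_integral_exp_square_sum) force+
  also have "\<dots> = ennreal ((\<Prod>a\<in>S. 1 / (1 - d a)) * (\<Prod>a\<in>S. exp (- d a)))"
    using d assms(1) by (subst ennreal_mult) (force intro!: prod_nonneg simp: exp_sum)+
  also have "(\<Prod>a\<in>S. 1 / (1 - d a)) * (\<Prod>a\<in>S. exp (- d a)) = (\<Prod>a\<in>S. exp (- d a) / (1 - d a))"
    by (simp add: prod.distrib[symmetric])
  also have "ennreal \<dots> \<le> ennreal (\<Prod>a\<in>S. exp (2 * (d a)\<^sup>2))"
    using d by (intro ennreal_leI prod_mono) (force intro: exp_div_one_minus_le)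
  also have "(\<Prod>a\<in>S. exp (2 * (d a)\<^sup>2)) = exp (2 * t\<^sup>2 * (\<Sum>a\<in>S. 1 / jbracket a ^ 4))"
    using assms(1) by (simp add: exp_sum[symmetric] sum_distrib_left d_def power_divide)
  finally show ?thesis .
qed

text \<open>At \<open>t = 1 / (2 * sqrt \<kappa>)\<close> and at \<open>- t\<close> the exponential
  moment is at most \<open>e\<close>, hence at most 3. The power is dominated by the sum of the two
  exponentials, which gives the 6; the factor \<open>4 ^ q * \<kappa> ^ q\<close> is
  \<open>t\<close> to the power \<open>- 2 * q\<close>.\<close>

lemma nn_integral_wick_power_le:
  assumes "finite S" "(\<Sum>a\<in>S. 1 / jbracket a ^ 4) \<le> \<kappa>" "0 < \<kappa>"
  shows "(\<integral>\<^sup>+ \<omega>. ennreal ((wick S \<omega>) ^ (2 * q)) \<partial>M) \<le> ennreal (6 * fact (2 * q) * 4 ^ q * \<kappa> ^ q)"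
proof -
  define t where "t = 1 / (2 * sqrt \<kappa>)"
  have t: "0 < t" "t\<^sup>2 = 1 / (4 * \<kappa>)" using assms(3) by (auto simp: t_def power_divide power_mult_distrib)
  have small: "t / (jbracket a)\<^sup>2 \<le> 1 / 2" if "a \<in> S" for a
  proof -
    have "1 / jbracket a ^ 4 \<le> (\<Sum>a\<in>S. 1 / jbracket a ^ 4)"
      using that assms(1) by (intro member_le_sum) auto
    then have "(1 / (jbracket a)\<^sup>2)\<^sup>2 \<le> \<kappa>" using assms(2) by (simp add: power_divide)
    then have "1 / (jbracket a)\<^sup>2 \<le> sqrt \<kappa>" by (rule real_le_rsqrt)
    then show ?thesis using assms(3) by (simp add: t_def field_simps)
  qed
  have e: "(\<integral>\<^sup>+ \<omega>. ennreal (exp (c * wick S \<omega>)) \<partial>M) \<le> ennreal 3" if "c = t \<or> c = - t" for c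
  proof -
    have "c / (jbracket a)\<^sup>2 \<le> 1 / 2" if "a \<in> S" for a
      using \<open>c = t \<or> c = - t\<close>
    proof
      assume "c = - t"
      then have "c / (jbracket a)\<^sup>2 \<le> 0" using t by simp
      then show ?thesis by linarith
    qed (use small[OF that] in simp)
    then have "(\<integral>\<^sup>+ \<omega>. ennreal (exp (c * wick S \<omega>)) \<partial>M) \<le> ennreal (exp (2 * c\<^sup>2 * (\<Sum>a\<in>S. 1 / jbracket a ^ 4)))"
      by (rule nn_integral_exp_wick_le[OF assms(1)])
    also have "c\<^sup>2 = t\<^sup>2" using that by auto
    also have "2 * t\<^sup>2 * (\<Sum>a\<in>S. 1 / jbracket a ^ 4) \<le> 2 * t\<^sup>2 * \<kappa>" using assms(2) by (intro mult_left_mono) auto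
    also have "2 * t\<^sup>2 * \<kappa> \<le> 1" using assms(3) by (simp add: t)
    also have "exp (1::real) \<le> 3" by (rule exp_le)
    finally show ?thesis by (simp add: ennreal_leI)
  qed
  have "(wick S \<omega>) ^ (2 * q) \<le> (4 * \<kappa>) ^ q * fact (2 * q) * (exp (t * wick S \<omega>) + exp (- t * wick S \<omega>))" for \<omega>
  proof -
    have "(t * wick S \<omega>) ^ (2 * q) = (1 / (4 * \<kappa>)) ^ q * (wick S \<omega>) ^ (2 * q)"
      by (simp only: power_mult_distrib power_mult t(2))
    then have "(wick S \<omega>) ^ (2 * q) = (4 * \<kappa>) ^ q * (t * wick S \<omega>) ^ (2 * q)"
      using assms(3) by (simp add: power_divide)
    also have "\<dots> \<le> (4 * \<kappa>) ^ q * (fact (2 * q) * (exp (t * wick S \<omega>) + exp (- (t * wick S \<omega>))))"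
      using assms(3) by (intro mult_left_mono power_even_le_fact_exp) auto
    finally show ?thesis by simp
  qed
  then have "(\<integral>\<^sup>+ \<omega>. ennreal ((wick S \<omega>) ^ (2 * q)) \<partial>M)
      \<le> (\<integral>\<^sup>+ \<omega>. ennreal ((4 * \<kappa>) ^ q * fact (2 * q)) * (ennreal (exp (t * wick S \<omega>)) + ennreal (exp (- t * wick S \<omega>))) \<partial>M)"
    using assms(3) by (intro nn_integral_mono) (simp add: ennreal_plus[symmetric] ennreal_mult[symmetric] ennreal_leI del: ennreal_plus)
  also have "\<dots> = ennreal ((4 * \<kappa>) ^ q * fact (2 * q)) *
     ((\<integral>\<^sup>+ \<omega>. ennreal (exp (t * wick S \<omega>)) \<partial>M) + (\<integral>\<^sup>+ \<omega>. ennreal (exp (- t * wick S \<omega>)) \<partial>M))"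
    by (subst nn_integral_cmult; (subst nn_integral_add)?) auto
  also have "\<dots> \<le> ennreal ((4 * \<kappa>) ^ q * fact (2 * q)) * (ennreal 3 + ennreal 3)"
    by (intro mult_left_mono add_mono e) auto
  also have "ennreal 3 + ennreal 3 = ennreal 6" by (subst ennreal_plus[symmetric]) auto
  also have "ennreal ((4 * \<kappa>) ^ q * fact (2 * q)) * ennreal 6 = ennreal ((4 * \<kappa>) ^ q * fact (2 * q) * 6)"
    using assms(3) by (subst ennreal_mult) auto
  also have "(4 * \<kappa>) ^ q * fact (2 * q) * 6 = 6 * fact (2 * q) * 4 ^ q * \<kappa> ^ q"
    by (simp add: power_mult_distrib)
  finally show ?thesis .
qed

text \<open>By \<open>full_load_le\<close> the load is at most a nonnegative combination of the
  variables \<open>(cmod (g a \<omega>))\<^sup>2\<close>. Its coefficients, multiplied by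
  \<open>c\<close>, sum to at most \<open>c * tau s k \<le> 1 / 2\<close>; so each of them is at
  most 1/2, which is what makes the exponential moment finite.\<close>

lemma nn_integral_exp_full_load_le:
  assumes s: "0 < s" "s \<le> 1" and c: "0 \<le> c" "c * tau s k \<le> 1 / 2"
  shows "(\<integral>\<^sup>+ \<omega>. ennreal (exp (c * full_load s (min N (2 ^ k)) N (modes_at \<omega>))) \<partial>M) \<le> ennreal (exp (2 * c * tau s k))"
proof -
  define K where "K = max N k"
  have "N \<le> 2 ^ N" by (simp add: less_imp_le)
  also have "\<dots> \<le> 2 ^ K" by (intro power_increasing) (auto simp: K_def)
  finally have K: "N \<le> 2 ^ K" "k \<le> K" by (auto simp: K_def)
  define r where "r j = 1600 * (2 powr (- s)) ^ j" for j
  define P where "P j = modes_upto (min N (2 ^ Suc j))" for j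
  define d where "d a = c / (jbracket a)\<^sup>2 * (\<Sum>j\<in>{k..<K}. if a \<in> P j then r j else 0)" for a
  have r: "0 \<le> r j" for j by (simp add: r_def)
  have P: "P j \<subseteq> modes_upto N" for j unfolding P_def by (intro modes_upto_mono) simp
  have d0: "0 \<le> d a" for a using c r by (auto simp: d_def intro!: mult_nonneg_nonneg sum_nonneg divide_nonneg_nonneg)
  have swap: "(\<Sum>a\<in>modes_upto N. c / (jbracket a)\<^sup>2 * (\<Sum>j\<in>{k..<K}. if a \<in> P j then r j else 0) * y a)
      = c * (\<Sum>j\<in>{k..<K}. r j * (\<Sum>a\<in>P j. 1 / (jbracket a)\<^sup>2 * y a))" for y
  proof -
    have "(\<Sum>a\<in>modes_upto N. c / (jbracket a)\<^sup>2 * (\<Sum>j\<in>{k..<K}. if a \<in> P j then r j else 0) * y a)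
       = (\<Sum>j\<in>{k..<K}. \<Sum>a\<in>modes_upto N. if a \<in> P j then c * (r j * (1 / (jbracket a)\<^sup>2 * y a)) else 0)"
      unfolding sum_distrib_left sum_distrib_right
      by (subst sum.swap) (intro sum.cong; simp)
    also have "\<dots> = (\<Sum>j\<in>{k..<K}. \<Sum>a\<in>P j. c * (r j * (1 / (jbracket a)\<^sup>2 * y a)))"
      by (rule sum.cong[OF refl], subst sum.inter_restrict[symmetric]) (simp_all add: Int_absorb1 P)
    finally show ?thesis by (simp add: sum_distrib_left)
  qed
  have "sum d (modes_upto N) = c * (\<Sum>j\<in>{k..<K}. r j * (\<Sum>a\<in>P j. 1 / (jbracket a)\<^sup>2))"
    using swap[of "\<lambda>_. 1"] by (simp add: d_def)
  also have "\<dots> \<le> c * (\<Sum>j\<in>{k..<K}. tau_term s j)"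
  proof (intro mult_left_mono sum_mono c(1))
    fix j
    have "(\<Sum>a\<in>P j. 1 / (jbracket a)\<^sup>2) \<le> 25 * (real j + 2)"
      using sigma_N_mono[of "min N (2 ^ Suc j)" "2 ^ Suc j"] sigma_N_pow2_le[of "Suc j"] by (simp add: P_def sigma_N_def)
    then have "r j * (\<Sum>a\<in>P j. 1 / (jbracket a)\<^sup>2) \<le> r j * (25 * (real j + 2))" by (intro mult_left_mono r)
    then show "r j * (\<Sum>a\<in>P j. 1 / (jbracket a)\<^sup>2) \<le> tau_term s j" by (simp add: r_def tau_term_def mult_ac)
  qed
  also have "\<dots> \<le> c * tau s k" using c s K by (intro mult_left_mono sum_le_tau) auto
  finally have sumd: "sum d (modes_upto N) \<le> c * tau s k" .
  have d2: "d a \<le> 1 / 2" if "a \<in> modes_upto N" for a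
    using member_le_sum[OF that, of d] d0 sumd c by simp
  have "c * full_load s (min N (2 ^ k)) N (modes_at \<omega>) \<le> (\<Sum>a\<in>modes_upto N. d a * (cmod (g a \<omega>))\<^sup>2)" for \<omega>
  proof -
    have "c * full_load s (min N (2 ^ k)) N (modes_at \<omega>) \<le> c * (\<Sum>j\<in>{k..<K}. r j * mass (P j) (modes_at \<omega>))"
      unfolding r_def P_def using s c K by (intro mult_left_mono full_load_le) auto
    also have "\<dots> = (\<Sum>a\<in>modes_upto N. d a * (cmod (g a \<omega>))\<^sup>2)"
      unfolding d_def swap mass_def by (simp add: coef_def norm_divide power_divide)
    finally show ?thesis .
  qed
  then have "(\<integral>\<^sup>+ \<omega>. ennreal (exp (c * full_load s (min N (2 ^ k)) N (modes_at \<omega>))) \<partial>M)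
     \<le> (\<integral>\<^sup>+ \<omega>. ennreal (exp (\<Sum>a\<in>modes_upto N. d a * (cmod (g a \<omega>))\<^sup>2)) \<partial>M)"
    by (intro nn_integral_mono ennreal_leI) simp
  also have "\<dots> \<le> ennreal (exp (2 * sum d (modes_upto N)))"
    using d0 d2 by (intro nn_integral_exp_square_sum_le) auto
  also have "\<dots> \<le> ennreal (exp (2 * c * tau s k))" using sumd by (intro ennreal_leI) simp
  finally show ?thesis .
qed

end

section \<open>Increments of the correlations\<close>

text \<open>The weight is only required to lie below the kernel \<open><m>^(-s)\<close>. The later
  bounds are uniform over admissible \<open>\<rho>\<close> and \<open>D\<close>, and this gives
  uniformity in \<open>N\<close>, since the set of output frequencies grows with
  \<open>N\<close>.\<close>

definition admissible :: "real \<Rightarrow> (mode \<Rightarrow> real) \<Rightarrow> mode set \<Rightarrow> bool" where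
  "admissible s \<rho> D \<longleftrightarrow> finite D \<and> 0 \<notin> D \<and> (\<forall>m. 0 \<le> \<rho> m \<and> \<rho> m \<le> jbracket m powr (- s))"

abbreviation corr_N :: "nat \<Rightarrow> (mode \<Rightarrow> complex) \<Rightarrow> mode \<Rightarrow> complex" where
  "corr_N N \<equiv> corr (modes_upto N)"

lemma cmod_corr_le_mass:
  assumes "finite A"
  shows "cmod (corr A v m) \<le> mass A v"
proof -
  let ?B = "{a \<in> A. a - m \<in> A}"
  have "corr A v m = (\<Sum>a\<in>?B. v a * cnj (v (a - m)))"
    unfolding corr_def using assms by (intro sum.mono_neutral_cong_right) auto
  then have "cmod (corr A v m) \<le> (\<Sum>a\<in>?B. cmod (v a) * cmod (v (a - m)))"
    using norm_sum[of "\<lambda>a. v a * cnj (v (a - m))" ?B] by (simp add: norm_mult)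
  also have "\<dots> \<le> (\<Sum>a\<in>?B. ((cmod (v a))\<^sup>2 + (cmod (v (a - m)))\<^sup>2) / 2)"
  proof (rule sum_mono)
    fix a
    show "cmod (v a) * cmod (v (a - m)) \<le> ((cmod (v a))\<^sup>2 + (cmod (v (a - m)))\<^sup>2) / 2"
      using sum_squares_bound[of "cmod (v a)" "cmod (v (a - m))"] by simp
  qed
  also have "\<dots> = (\<Sum>a\<in>?B. (cmod (v a))\<^sup>2) / 2 + (\<Sum>a\<in>(\<lambda>a. a - m) ` ?B. (cmod (v a))\<^sup>2) / 2"
    by (subst sum.reindex) (auto simp: inj_on_def sum.distrib sum_divide_distrib add_divide_distrib)
  also have "\<dots> \<le> mass A v / 2 + mass A v / 2"
    unfolding mass_def using assms by (intro add_mono divide_right_mono sum_mono2) auto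
  finally show ?thesis by simp
qed

lemma corr_N_eq_0: "m \<notin> modes_upto (L + L) \<Longrightarrow> corr_N L v m = 0"
  unfolding corr_def
proof (rule sum.neutral, rule ballI)
  fix a assume "m \<notin> modes_upto (L + L)" "a \<in> modes_upto L"
  then show "(if a - m \<in> modes_upto L then v a * cnj (v (a - m)) else 0) = 0"
    using diff_in_modes_upto[of a L "a - m" L] by auto
qed

text \<open>Every correlation is at most the mass, and it vanishes beyond frequency
  \<open>2 * L\<close>. This deterministic bound grows like \<open>2 ^ ((2 - s) * k)\<close>, which
  the rarity of late bad scales has to beat.\<close>

lemma wnorm2_corr_N_le:
  assumes s: "0 \<le> s" "s \<le> 1" and adm: "admissible s \<rho> D" and L: "L \<le> 2 ^ k"
  shows "wnorm2 \<rho> D (corr_N L v) \<le> (mass (modes_upto L) v)\<^sup>2 * (25 * (4 * 2 powr (- s)) ^ Suc k)"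
proof -
  let ?m = "(mass (modes_upto L) v)\<^sup>2"
  have sub: "modes_upto (L + L) \<subseteq> modes_upto (2 ^ Suc k)" using L by (intro modes_upto_mono) simp
  have fin: "finite D" using adm by (simp add: admissible_def)
  have zero: "corr_N L v m = 0" if "m \<notin> modes_upto (2 ^ Suc k)" for m
    using that sub corr_N_eq_0 by blast
  have "wnorm2 \<rho> D (corr_N L v) = (\<Sum>m\<in>D \<inter> modes_upto (2 ^ Suc k). \<rho> m * (cmod (corr_N L v m))\<^sup>2)"
    unfolding wnorm2_def using fin zero by (intro sum.mono_neutral_right) auto
  also have "\<dots> \<le> (\<Sum>m\<in>D \<inter> modes_upto (2 ^ Suc k). jbracket m powr (- s) * ?m)"
    using adm by (intro sum_mono mult_mono power_mono cmod_corr_le_mass) (auto simp: admissible_def)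
  also have "\<dots> \<le> (\<Sum>m\<in>modes_upto (2 ^ Suc k). jbracket m powr (- s) * ?m)"
    by (intro sum_mono2) auto
  also have "\<dots> = (\<Sum>m\<in>modes_upto (2 ^ Suc k). jbracket m powr (- s)) * ?m"
    by (simp add: sum_distrib_right)
  also have "\<dots> \<le> 25 * (4 * 2 powr (- s)) ^ Suc k * ?m"
    using s by (intro mult_right_mono sum_jbracket_powr_le) auto
  finally show ?thesis by (simp add: mult_ac)
qed

lemma wnorm2_split:
  assumes "\<And>m. 0 \<le> \<rho> m"
  shows "wnorm2 \<rho> D F \<le> 2 * wnorm2 \<rho> D F' + 2 * wnorm2 \<rho> D (\<lambda>m. F m - F' m)"
proof -
  have "(cmod (F m))\<^sup>2 \<le> 2 * (cmod (F' m))\<^sup>2 + 2 * (cmod (F m - F' m))\<^sup>2" for m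
  proof -
    have "cmod (F m) \<le> cmod (F' m) + cmod (F m - F' m)" using norm_triangle_ineq[of "F' m" "F m - F' m"] by simp
    then have "(cmod (F m))\<^sup>2 \<le> (cmod (F' m) + cmod (F m - F' m))\<^sup>2" by (intro power_mono) auto
    then show ?thesis using sum_squares_bound[of "cmod (F' m)" "cmod (F m - F' m)"] by (simp add: power2_sum)
  qed
  then have "wnorm2 \<rho> D F \<le> (\<Sum>m\<in>D. \<rho> m * (2 * (cmod (F' m))\<^sup>2 + 2 * (cmod (F m - F' m))\<^sup>2))"
    unfolding wnorm2_def using assms by (intro sum_mono mult_left_mono) auto
  then show ?thesis by (simp add: wnorm2_def sum.distrib sum_distrib_left algebra_simps)
qed

text \<open>With \<open>w = sqrt r\<close>, the factor \<open>(k + 2)\<^sup>2 * r ^ (k + 2)\<close>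
  is the square of \<open>(k + 2) * w ^ (k + 2)\<close> and tends to 0. Eventually the positive term
  is at most half of the negative one, whence 1600, and \<open>exp (- x) \<le> 1 / x\<close> leaves
  a geometric series.\<close>

lemma summable_exp_competition:
  fixes r c :: real
  assumes "0 < r" "r < 1" "0 \<le> c"
  shows "summable (\<lambda>k. exp (c * (real k + 2)\<^sup>2 * (4 * r) ^ Suc (Suc k) - 4 ^ k / 800))"
proof -
  define w where "w = sqrt r"
  have w: "0 < w" "w < 1" "w\<^sup>2 = r" using assms by (auto simp: w_def)
  have "(\<lambda>n. real n * w ^ n) \<longlonglongrightarrow> 0" using w by (intro powser_times_n_limit_0) auto
  then have "(\<lambda>k. real (k + 2) * w ^ (k + 2)) \<longlonglongrightarrow> 0" by (rule LIMSEQ_ignore_initial_segment)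
  then have "(\<lambda>k. 16 * c * (real (k + 2) * w ^ (k + 2))\<^sup>2) \<longlonglongrightarrow> 16 * c * 0\<^sup>2"
    by (intro tendsto_intros)
  then have "\<forall>\<^sub>F k in sequentially. 16 * c * (real (k + 2) * w ^ (k + 2))\<^sup>2 < 1 / 1600"
    by (rule order_tendstoD(2)) simp
  then have "\<forall>\<^sub>F k in sequentially. norm (exp (c * (real k + 2)\<^sup>2 * (4 * r) ^ Suc (Suc k) - 4 ^ k / 800)) \<le> 1600 * (1 / 4) ^ k"
  proof eventually_elim
    case (elim k)
    have "(w ^ (k + 2))\<^sup>2 = (w\<^sup>2) ^ (k + 2)" by (simp only: power_mult[symmetric] mult.commute)
    then have "(real (k + 2) * w ^ (k + 2))\<^sup>2 = (real k + 2)\<^sup>2 * r ^ (k + 2)"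
      by (simp only: power_mult_distrib w(3)) simp
    then have "c * (real k + 2)\<^sup>2 * (4 * r) ^ Suc (Suc k) = 4 ^ k * (16 * c * (real (k + 2) * w ^ (k + 2))\<^sup>2)"
      by (simp only:) (simp add: power_mult_distrib)
    also have "\<dots> \<le> 4 ^ k * (1 / 1600)" using elim by (intro mult_left_mono) auto
    finally have "c * (real k + 2)\<^sup>2 * (4 * r) ^ Suc (Suc k) - 4 ^ k / 800 \<le> - (4 ^ k / 1600)" by linarith
    then have "exp (c * (real k + 2)\<^sup>2 * (4 * r) ^ Suc (Suc k) - 4 ^ k / 800) \<le> exp (- (4 ^ k / 1600))"
      by (simp only: exp_le_cancel_iff)
    also have "\<dots> \<le> 1 / (4 ^ k / 1600)"
    proof -
      have "4 ^ k / 1600 \<le> exp (4 ^ k / 1600 :: real)" using exp_ge_add_one_self[of "4 ^ k / 1600"] by linarith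
      then show ?thesis by (simp only: exp_minus inverse_eq_divide) (intro divide_left_mono, auto)
    qed
    finally show ?case by (simp add: power_divide)
  qed
  then show ?thesis
    by (rule summable_comparison_test_ev) (intro summable_mult summable_geometric, simp)
qed

lemma ennreal_mult_average:
  assumes "0 \<le> A" "0 \<le> x" "0 \<le> y"
  shows "ennreal A * (ennreal (1 / 2) * ennreal x + ennreal (1 / 2) * ennreal y) = ennreal (A * (x / 2 + y / 2))"
proof -
  have "ennreal (1 / 2) * ennreal x = ennreal (x / 2)" "ennreal (1 / 2) * ennreal y = ennreal (y / 2)"
    using assms ennreal_mult[of "1 / 2" x] ennreal_mult[of "1 / 2" y] by simp_all
  moreover have "ennreal (x / 2) + ennreal (y / 2) = ennreal (x / 2 + y / 2)"
    using assms by simp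
  moreover have "ennreal A * ennreal (x / 2 + y / 2) = ennreal (A * (x / 2 + y / 2))"
    using assms by (simp add: ennreal_mult)
  ultimately show ?thesis by (simp only:)
qed

section \<open>Moments of the increments of the correlations\<close>

context gaussian_modes
begin

abbreviation incr :: "(mode \<Rightarrow> real) \<Rightarrow> mode set \<Rightarrow> nat \<Rightarrow> nat \<Rightarrow> 'a \<Rightarrow> real" where
  "incr \<rho> D L N \<omega> \<equiv> wnorm2 \<rho> D (\<lambda>m. corr_N N (modes_at \<omega>) m - corr_N L (modes_at \<omega>) m)"

lemma modes_at_measurable [measurable]: "(\<lambda>\<omega>. modes_at \<omega> a) \<in> borel_measurable M"
  by (intro borel_measurable_coef g_measurable)

lemma corr_measurable [measurable]: "(\<lambda>\<omega>. corr A (modes_at \<omega>) m) \<in> borel_measurable M"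
  by (intro borel_measurable_corr modes_at_measurable)

lemma wnorm2_measurable [measurable]:
  "(\<And>m. (\<lambda>\<omega>. F \<omega> m) \<in> borel_measurable M) \<Longrightarrow> (\<lambda>\<omega>. wnorm2 \<rho> D (F \<omega>)) \<in> borel_measurable M"
  by (rule borel_measurable_wnorm2)

lemma incr_measurable [measurable]: "incr \<rho> D L N \<in> borel_measurable M"
  by (intro wnorm2_measurable borel_measurable_diff corr_measurable)

lemma full_load_measurable [measurable]: "(\<lambda>\<omega>. full_load s L N (modes_at \<omega>)) \<in> borel_measurable M"
  unfolding full_load_def by (intro borel_measurable_sum borel_measurable_load modes_at_measurable)

text \<open>The terminal value of the supermartingale with \<open>full_load\<close> in place of the
  load along a list, hence without reference to the order of the modes.\<close>

definition tilt :: "real \<Rightarrow> real \<Rightarrow> (mode \<Rightarrow> real) \<Rightarrow> mode set \<Rightarrow> nat \<Rightarrow> nat \<Rightarrow> 'a \<Rightarrow> real" where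
  "tilt \<theta> s \<rho> D L N \<omega> = exp (\<theta> * exp (- 2 * \<theta> * full_load s L N (modes_at \<omega>)) * incr \<rho> D L N \<omega>
      - 2 * \<theta> * full_load s L N (modes_at \<omega>))"

lemma tilt_measurable [measurable]: "tilt \<theta> s \<rho> D L N \<in> borel_measurable M"
  unfolding tilt_def[abs_def] by measurable

text \<open>As the squared norm is nonnegative, the energy decreases when the load increases, so the
  larger \<open>full_load\<close> preserves the bound. The list is sorted with the longest modes
  first because its head is the mode added last.\<close>

lemma nn_integral_tilt_le_1:
  assumes adm: "admissible s \<rho> D" and \<theta>: "0 \<le> \<theta>" and "L \<le> N"
  shows "(\<integral>\<^sup>+ \<omega>. ennreal (tilt \<theta> s \<rho> D L N \<omega>) \<partial>M) \<le> 1"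
proof -
  obtain ns where ns: "set ns = modes_upto N - modes_upto L" "distinct ns"
    "sorted_wrt (\<lambda>a b. norm (freq b) \<le> norm (freq a)) ns"
    using exists_sorted_list[of "modes_upto N - modes_upto L" "\<lambda>a. norm (freq a)"] by auto
  have un: "modes_upto L \<union> set ns = modes_upto N" using ns modes_upto_mono[OF \<open>L \<le> N\<close>] by auto
  have \<rho>: "\<And>m. 0 \<le> \<rho> m" "\<And>m. \<rho> m \<le> jbracket m powr (- s)" "finite D" "0 \<notin> D"
    using adm by (auto simp: admissible_def)
  have "tilt \<theta> s \<rho> D L N \<omega> \<le> exp (energy \<theta> s \<rho> D (modes_upto L) ns (\<lambda>a. g a \<omega>))" for \<omega>
  proof -
    have le: "total_load s (modes_upto L) ns (modes_at \<omega>) \<le> full_load s L N (modes_at \<omega>)"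
      using ns \<open>L \<le> N\<close> by (intro total_load_le_full_load) auto
    have "\<theta> * exp (- 2 * \<theta> * full_load s L N (modes_at \<omega>)) * incr \<rho> D L N \<omega>
       \<le> \<theta> * exp (- 2 * \<theta> * total_load s (modes_upto L) ns (modes_at \<omega>)) * incr \<rho> D L N \<omega>"
      using le \<theta> wnorm2_nonneg[of \<rho>] \<rho> by (intro mult_right_mono mult_left_mono) (auto simp: mult_left_mono)
    moreover have "2 * \<theta> * total_load s (modes_upto L) ns (modes_at \<omega>) \<le> 2 * \<theta> * full_load s L N (modes_at \<omega>)"
      using le \<theta> by (intro mult_left_mono) auto
    ultimately show ?thesis unfolding tilt_def energy_def un by simp
  qed
  then have "(\<integral>\<^sup>+ \<omega>. ennreal (tilt \<theta> s \<rho> D L N \<omega>) \<partial>M)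
      \<le> (\<integral>\<^sup>+ \<omega>. ennreal (exp (energy \<theta> s \<rho> D (modes_upto L) ns (\<lambda>a. g a \<omega>))) \<partial>M)"
    by (intro nn_integral_mono ennreal_leI)
  also have "\<dots> \<le> 1" using ns by (intro nn_integral_energy_le_1 \<theta> \<rho>) auto
  finally show ?thesis .
qed

text \<open>The coefficient \<open>\<phi>\<close> of the increment \<open>X\<close> in
  \<open>tilt\<close> is random. A power of \<open>X\<close> is bounded by
  \<open>fact q * (2 / \<phi>) ^ q * exp (\<phi> * X / 2)\<close>, and \<open>1 / \<phi>\<close> is
  an exponential of the load; the product is regrouped into an exponential of the load times the
  square root of \<open>tilt\<close>. The arithmetic-geometric mean inequality separates the two,
  and each has bounded expectation.\<close>

lemma nn_integral_incr_power_le: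
  assumes s: "0 < s" "s \<le> 1" and adm: "admissible s \<rho> D"
  shows "(\<integral>\<^sup>+ \<omega>. ennreal ((incr \<rho> D (min N (2 ^ k)) N \<omega>) ^ q) \<partial>M)
     \<le> ennreal (2 * (8 * real q + 4) ^ q * fact q * 2 ^ q * tau s k ^ q)"
proof -
  \<comment> \<open>Makes \<open>c * tau s k = 1 / 2\<close>, the largest value that
    \<open>nn_integral_exp_full_load_le\<close> allows. As \<open>1 / \<theta>\<close> is
    proportional to \<open>tau s k\<close>, the moment of order \<open>q\<close> inherits the decay
    \<open>tau s k ^ q\<close>.\<close>
  define \<theta> where "\<theta> = 1 / ((8 * real q + 4) * tau s k)"
  define L where "L = min N (2 ^ k)"
  define A where "A = (8 * real q + 4) ^ q * fact q * 2 ^ q * tau s k ^ q"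
  define c where "c = (4 * real q + 2) * \<theta>"
  have \<tau>: "0 < tau s k" by (rule tau_pos[OF s(1)])
  have \<theta>: "0 < \<theta>" using \<tau> by (simp add: \<theta>_def)
  have c: "0 \<le> c" "c * tau s k = 1 / 2" using \<tau> \<theta> by (auto simp: c_def \<theta>_def field_simps)
  have A: "0 \<le> A" using \<tau> by (simp add: A_def)
  have inv: "(1 / \<theta>) ^ q * fact q * 2 ^ q = A" by (simp add: \<theta>_def A_def power_mult_distrib)
  have X0: "0 \<le> incr \<rho> D L N \<omega>" for \<omega> using adm by (intro wnorm2_nonneg) (auto simp: admissible_def)
  have key: "(incr \<rho> D L N \<omega>) ^ q \<le> A * (exp (c * full_load s L N (modes_at \<omega>)) / 2 + tilt \<theta> s \<rho> D L N \<omega> / 2)" for \<omega>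
  proof -
    define X l where "X = incr \<rho> D L N \<omega>" and "l = full_load s L N (modes_at \<omega>)"
    define \<phi> where "\<phi> = \<theta> * exp (- 2 * \<theta> * l)"
    have \<phi>: "0 < \<phi>" using \<theta> by (simp add: \<phi>_def)
    have "(\<phi> * X / 2) ^ q \<le> fact q * exp (\<phi> * X / 2)"
      using \<phi> X0 by (intro power_le_fact_exp) (auto simp: X_def)
    then have "X ^ q \<le> (1 / \<phi>) ^ q * 2 ^ q * (fact q * exp (\<phi> * X / 2))"
      using \<phi> by (simp add: power_divide power_mult_distrib field_simps)
    also have "1 / \<phi> = 1 / \<theta> * exp (2 * \<theta> * l)" by (simp add: \<phi>_def exp_minus field_simps)
    also have "(1 / \<theta> * exp (2 * \<theta> * l)) ^ q = (1 / \<theta>) ^ q * exp (2 * real q * \<theta> * l)"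
      unfolding power_mult_distrib exp_of_nat_mult[symmetric] by (simp add: mult_ac)
    \<comment> \<open>\<open>c / 2 = (2 * q + 1) * \<theta>\<close>: the part
      \<open>2 * q * \<theta>\<close> comes from \<open>1 / \<phi>\<close>, and one more
      \<open>\<theta>\<close> compensates the load subtracted in \<open>tilt\<close>.\<close>
    also have "(1 / \<theta>) ^ q * exp (2 * real q * \<theta> * l) * 2 ^ q * (fact q * exp (\<phi> * X / 2))
        = A * (exp (c * l / 2) * exp ((\<phi> * X - 2 * \<theta> * l) / 2))"
      unfolding inv[symmetric] by (simp add: c_def exp_add[symmetric] field_simps)
    also have "exp (c * l / 2) * exp ((\<phi> * X - 2 * \<theta> * l) / 2) \<le> ((exp (c * l / 2))\<^sup>2 + (exp ((\<phi> * X - 2 * \<theta> * l) / 2))\<^sup>2) / 2"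
      using sum_squares_bound[of "exp (c * l / 2)" "exp ((\<phi> * X - 2 * \<theta> * l) / 2)"] by simp
    also have "\<dots> = exp (c * l) / 2 + exp (\<phi> * X - 2 * \<theta> * l) / 2"
      by (simp add: exp_double[symmetric] add_divide_distrib)
    finally show ?thesis using A by (simp add: X_def l_def \<phi>_def tilt_def mult_left_mono)
  qed
  have "(\<integral>\<^sup>+ \<omega>. ennreal ((incr \<rho> D L N \<omega>) ^ q) \<partial>M)
     \<le> (\<integral>\<^sup>+ \<omega>. ennreal A * (ennreal (1 / 2) * ennreal (exp (c * full_load s L N (modes_at \<omega>))) + ennreal (1 / 2) * ennreal (tilt \<theta> s \<rho> D L N \<omega>)) \<partial>M)"
  proof (rule nn_integral_mono)
    fix \<omega>
    have "0 \<le> tilt \<theta> s \<rho> D L N \<omega>" by (simp add: tilt_def)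
    then show "ennreal ((incr \<rho> D L N \<omega>) ^ q) \<le> ennreal A * (ennreal (1 / 2) * ennreal (exp (c * full_load s L N (modes_at \<omega>))) + ennreal (1 / 2) * ennreal (tilt \<theta> s \<rho> D L N \<omega>))"
      using key[of \<omega>] A by (subst ennreal_mult_average) (auto intro: ennreal_leI)
  qed
  also have "\<dots> = ennreal A * (ennreal (1 / 2) * (\<integral>\<^sup>+ \<omega>. ennreal (exp (c * full_load s L N (modes_at \<omega>))) \<partial>M)
      + ennreal (1 / 2) * (\<integral>\<^sup>+ \<omega>. ennreal (tilt \<theta> s \<rho> D L N \<omega>) \<partial>M))"
    by (simp add: nn_integral_cmult nn_integral_add)
  also have "\<dots> \<le> ennreal A * (ennreal (1 / 2) * ennreal (exp (2 * c * tau s k)) + ennreal (1 / 2) * 1)"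
    unfolding L_def using s c \<theta>
    by (intro mult_left_mono add_mono nn_integral_exp_full_load_le nn_integral_tilt_le_1 adm) auto
  also have "\<dots> = ennreal (A * (exp (2 * c * tau s k) / 2 + 1 / 2))"
    using ennreal_mult_average[OF A, of "exp (2 * c * tau s k)" 1] by simp
  also have "\<dots> \<le> ennreal (A * 2)"
  proof (intro ennreal_leI mult_left_mono A)
    have "2 * c * tau s k = 1" using c(2) by simp
    then have "exp (2 * c * tau s k) \<le> 3" using exp_le by (simp only:)
    then show "exp (2 * c * tau s k) / 2 + 1 / 2 \<le> 2" by simp
  qed
  finally show ?thesis by (simp add: A_def L_def mult_ac)
qed

end

section \<open>Exponential integrability under the mass cutoff\<close>

context gaussian_modes
begin

text \<open>If the whole Wick mass is at most \<open>K\<close> and the modes beyond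
  \<open>2 ^ j\<close> contribute at least \<open>- 1\<close>, those below contribute at most
  \<open>K + 1\<close>; the term \<open>25 * (real j + 1)\<close> bounds
  \<open>sigma_N (2 ^ j)\<close>, which turns Wick mass into mass.\<close>

definition good :: "real \<Rightarrow> nat \<Rightarrow> nat \<Rightarrow> 'a \<Rightarrow> bool" where
  "good K N k \<omega> \<longleftrightarrow> (\<forall>j\<ge>k. mass (modes_upto (min N (2 ^ j))) (modes_at \<omega>) \<le> K + 1 + 25 * (real j + 1))"

definition bad :: "nat \<Rightarrow> nat \<Rightarrow> 'a \<Rightarrow> bool" where
  "bad N k \<omega> \<longleftrightarrow> wick (modes_upto N - modes_upto (min N (2 ^ k))) \<omega> < - 1"

lemma good_if_not_bad:
  assumes "wick (modes_upto N) \<omega> \<le> K" "\<And>j. k \<le> j \<Longrightarrow> \<not> bad N j \<omega>"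
  shows "good K N k \<omega>"
  unfolding good_def
proof (intro allI impI)
  fix j assume "k \<le> j"
  let ?L = "min N (2 ^ j)"
  have "wick (modes_upto N) \<omega> - wick (modes_upto ?L) \<omega> \<ge> - 1"
    using assms(2)[OF \<open>k \<le> j\<close>] wick_diff[of "modes_upto N" "modes_upto ?L" \<omega>] modes_upto_mono[of ?L N]
    by (simp add: bad_def)
  moreover have "mass (modes_upto ?L) (modes_at \<omega>) = wick (modes_upto ?L) \<omega> + sigma_N ?L"
    by (simp add: mass_modes_at sigma_N_def)
  moreover have "sigma_N ?L \<le> 25 * (real j + 1)"
    using sigma_N_mono[of ?L "2 ^ j"] sigma_N_pow2_le[of j] by simp
  ultimately show "mass (modes_upto ?L) (modes_at \<omega>) \<le> K + 1 + 25 * (real j + 1)"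
    using assms(1) by linarith
qed

text \<open>No scale from \<open>N\<close> on is bad, since no mode remains beyond it; so if some
  scale is bad there is a last one, \<open>k\<close>, and every later scale is controlled. Goodness
  starts only at \<open>Suc k\<close>, which costs one scale in the deterministic bound.\<close>

lemma good_or_last_bad:
  assumes "wick (modes_upto N) \<omega> \<le> K"
  shows "good K N k0 \<omega> \<or> (\<exists>k\<in>{k0..<max N k0}. bad N k \<omega> \<and> good K N (Suc k) \<omega>)"
proof -
  have notbad: "\<not> bad N j \<omega>" if "N \<le> j" for j
  proof -
    have "N \<le> 2 ^ j" using that less_exp[of j] by linarith
    then show ?thesis by (simp add: bad_def wick_def)
  qed
  show ?thesis
  proof (cases "\<exists>k\<ge>k0. bad N k \<omega>")
    case True
    let ?S = "{k. k0 \<le> k \<and> bad N k \<omega>}"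
    have fin: "finite ?S" by (rule finite_subset[of _ "{..<N}"]) (use notbad in \<open>auto simp: not_le[symmetric]\<close>)
    define k where "k = Max ?S"
    have "k \<in> ?S" unfolding k_def using True fin by (intro Max_in) auto
    moreover have "\<not> bad N j \<omega>" if "Suc k \<le> j" for j
    proof
      assume "bad N j \<omega>"
      with that \<open>k \<in> ?S\<close> have "j \<in> ?S" by auto
      then have "j \<le> k" unfolding k_def by (intro Max_ge fin)
      with that show False by simp
    qed
    then have "good K N (Suc k) \<omega>" by (rule good_if_not_bad[OF assms])
    moreover have "k < N" using \<open>k \<in> ?S\<close> notbad[of k] by (auto simp: not_le[symmetric])
    ultimately show ?thesis by (intro disjI2 bexI[of _ k]) auto
  qed (use good_if_not_bad[OF assms] in auto)
qed

text \<open>From a good scale on, the mass grows at most linearly in the scale. Summed against the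
  geometric gain of the shells this is the series of \<open>tau\<close>, up to the factor
  \<open>K + 2\<close>.\<close>

lemma full_load_le_tau:
  assumes s: "0 < s" "s \<le> 1" and "0 \<le> K" and good: "good K N k \<omega>"
  shows "full_load s (min N (2 ^ k)) N (modes_at \<omega>) \<le> (K + 2) * tau s k"
proof -
  define R where "R = max N k"
  have "N \<le> 2 ^ N" by (simp add: less_imp_le)
  also have "\<dots> \<le> 2 ^ R" by (intro power_increasing) (auto simp: R_def)
  finally have R: "N \<le> 2 ^ R" "k \<le> R" by (auto simp: R_def)
  have "full_load s (min N (2 ^ k)) N (modes_at \<omega>)
     \<le> (\<Sum>j\<in>{k..<R}. 1600 * (2 powr (- s)) ^ j * mass (modes_upto (min N (2 ^ Suc j))) (modes_at \<omega>))"
    using s by (intro full_load_le R) auto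
  also have "\<dots> \<le> (\<Sum>j\<in>{k..<R}. (K + 2) * tau_term s j)"
  proof (rule sum_mono)
    fix j assume "j \<in> {k..<R}"
    then have "mass (modes_upto (min N (2 ^ Suc j))) (modes_at \<omega>) \<le> K + 1 + 25 * (real (Suc j) + 1)"
      using good unfolding good_def by (metis atLeastLessThan_iff le_Suc_eq)
    also have "\<dots> \<le> 25 * (real j + 2) * (K + 2)"
    proof -
      have "0 \<le> real j * K" using \<open>0 \<le> K\<close> by simp
      moreover have "25 * (real j + 2) * (K + 2) = 25 * (real j * K) + 50 * real j + 50 * K + 100"
        by (simp add: algebra_simps)
      moreover have "K + 1 + 25 * (real (Suc j) + 1) = K + 51 + 25 * real j" by simp
      ultimately show ?thesis using \<open>0 \<le> K\<close> by linarith
    qed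
    finally have "1600 * (2 powr (- s)) ^ j * mass (modes_upto (min N (2 ^ Suc j))) (modes_at \<omega>)
       \<le> 1600 * (2 powr (- s)) ^ j * (25 * (real j + 2) * (K + 2))" by (intro mult_left_mono) auto
    then show "1600 * (2 powr (- s)) ^ j * mass (modes_upto (min N (2 ^ Suc j))) (modes_at \<omega>) \<le> (K + 2) * tau_term s j"
      by (simp add: tau_term_def mult_ac)
  qed
  also have "\<dots> = (K + 2) * (\<Sum>j\<in>{k..<R}. tau_term s j)" by (simp add: sum_distrib_left)
  also have "\<dots> \<le> (K + 2) * tau s k" using \<open>0 \<le> K\<close> s R by (intro mult_left_mono sum_le_tau) auto
  finally show ?thesis .
qed

text \<open>The mass is at most \<open>26 * (K + 1) * (real k + 1)\<close>, and
  \<open>16900 = 25 * 26 ^ 2\<close>.\<close>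

lemma wnorm2_low_le:
  assumes s: "0 < s" "s \<le> 1" and "0 \<le> K" and adm: "admissible s \<rho> D" and good: "good K N k \<omega>"
  shows "wnorm2 \<rho> D (corr_N (min N (2 ^ k)) (modes_at \<omega>))
     \<le> 16900 * (K + 1)\<^sup>2 * (real k + 1)\<^sup>2 * (4 * 2 powr (- s)) ^ Suc k"
proof -
  let ?m = "mass (modes_upto (min N (2 ^ k))) (modes_at \<omega>)"
  have "?m \<le> K + 1 + 25 * (real k + 1)" using good by (simp add: good_def)
  also have "\<dots> \<le> 26 * (K + 1) * (real k + 1)"
  proof -
    have "0 \<le> K * real k" using \<open>0 \<le> K\<close> by simp
    moreover have "26 * (K + 1) * (real k + 1) = 26 * (K * real k) + 26 * K + 26 * real k + 26" by (simp add: algebra_simps)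
    ultimately show ?thesis using \<open>0 \<le> K\<close> by (simp add: algebra_simps)
  qed
  finally have "?m\<^sup>2 \<le> (26 * (K + 1) * (real k + 1))\<^sup>2"
    by (intro power_mono) (auto simp: mass_def sum_nonneg)
  then have a: "?m\<^sup>2 * (25 * (4 * 2 powr (- s)) ^ Suc k) \<le> (26 * (K + 1) * (real k + 1))\<^sup>2 * (25 * (4 * 2 powr (- s)) ^ Suc k)"
    by (intro mult_right_mono) auto
  have b: "wnorm2 \<rho> D (corr_N (min N (2 ^ k)) (modes_at \<omega>)) \<le> ?m\<^sup>2 * (25 * (4 * 2 powr (- s)) ^ Suc k)"
    using s by (intro wnorm2_corr_N_le[OF _ _ adm]) auto
  have c: "(26 * (K + 1) * (real k + 1))\<^sup>2 * (25 * y) = 16900 * (K + 1)\<^sup>2 * (real k + 1)\<^sup>2 * y" for y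
    by (simp only: power_mult_distrib) simp
  show ?thesis by (rule order.trans[OF b a[unfolded c]])
qed

text \<open>On the event \<open>bad N k\<close> the integrand exceeds 1, so this is a Chernoff
  bound, stated for the integrand itself because that is what enters the pointwise estimate later.
  The rate \<open>t = 4 ^ k / 200\<close> minimizes \<open>- t + 100 * t\<^sup>2 / 4 ^ k\<close>,
  the 100 being twice the 50 of \<open>sum_jbracket4_le\<close>.\<close>

lemma nn_integral_bad_le:
  "(\<integral>\<^sup>+ \<omega>. ennreal (exp (4 ^ k / 200 * (- 1 - wick (modes_upto N - modes_upto (min N (2 ^ k))) \<omega>))) \<partial>M)
     \<le> ennreal (exp (- (4 ^ k / 400)))"
proof -
  let ?S = "modes_upto N - modes_upto (min N (2 ^ k))" and ?t = "4 ^ k / 200 :: real"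
  have S: "?S \<inter> modes_upto (2 ^ k) = {}" by (auto simp: min_def)
  have "(\<integral>\<^sup>+ \<omega>. ennreal (exp (?t * (- 1 - wick ?S \<omega>))) \<partial>M)
      = (\<integral>\<^sup>+ \<omega>. ennreal (exp (- ?t)) * ennreal (exp (- ?t * wick ?S \<omega>)) \<partial>M)"
    by (intro nn_integral_cong) (simp add: ennreal_mult[symmetric] exp_add[symmetric] algebra_simps)
  also have "\<dots> = ennreal (exp (- ?t)) * (\<integral>\<^sup>+ \<omega>. ennreal (exp (- ?t * wick ?S \<omega>)) \<partial>M)"
    by (rule nn_integral_cmult) measurable
  also have "\<dots> \<le> ennreal (exp (- ?t)) * ennreal (exp (2 * (- ?t)\<^sup>2 * (\<Sum>a\<in>?S. 1 / jbracket a ^ 4)))"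
  proof (intro mult_left_mono nn_integral_exp_wick_le)
    fix a
    have "- ?t / (jbracket a)\<^sup>2 \<le> 0" by simp
    then show "- ?t / (jbracket a)\<^sup>2 \<le> 1 / 2" by linarith
  qed auto
  also have "\<dots> = ennreal (exp (- ?t + 2 * (- ?t)\<^sup>2 * (\<Sum>a\<in>?S. 1 / jbracket a ^ 4)))"
    unfolding exp_add by (rule ennreal_mult[symmetric]) auto
  also have "\<dots> \<le> ennreal (exp (- ?t + 2 * (- ?t)\<^sup>2 * (50 / 4 ^ k)))"
    using sum_jbracket4_le[OF _ S] by (intro ennreal_leI exp_le_cancel_iff[THEN iffD2] add_left_mono mult_left_mono) auto
  also have "- ?t + 2 * (- ?t)\<^sup>2 * (50 / 4 ^ k) = - (4 ^ k / 400)"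
    by (simp add: power2_eq_square field_simps)
  finally show ?thesis .
qed

text \<open>The correlations are split at \<open>2 ^ k\<close>: the low part is bounded by
  \<open>b\<close>, the increment goes into the supermartingale. On a good scale with small
  \<open>tau s k\<close> the load satisfies \<open>2 * \<theta> * l \<le> 1\<close>, so the damped
  coefficient is still at least \<open>\<theta> / e\<close>, hence at least \<open>4 * C\<close>.
  This is twice the \<open>2 * C\<close> that is needed, and the second claim is about a square in
  order to leave room for Young's inequality.\<close>

lemma exp_wnorm2_le_tilt:
  assumes s: "0 < s" "s \<le> 1" and K: "0 \<le> K" and C: "0 \<le> C" and adm: "admissible s \<rho> D"
    and good: "good K N k \<omega>"
    and \<theta>: "4 * exp 1 * C \<le> \<theta>" "2 * \<theta> * ((K + 2) * tau s k) \<le> 1"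
    and b: "b = 2 * C * (16900 * (K + 1)\<^sup>2 * (real k + 1)\<^sup>2 * (4 * 2 powr (- s)) ^ Suc k)"
  shows "exp (C * wnorm2 \<rho> D (corr_N N (modes_at \<omega>))) \<le> exp b * exp (2 * C * incr \<rho> D (min N (2 ^ k)) N \<omega>)"
    and "(exp (2 * C * incr \<rho> D (min N (2 ^ k)) N \<omega>))\<^sup>2 \<le> 3 * tilt \<theta> s \<rho> D (min N (2 ^ k)) N \<omega>"
proof -
  define L X l where "L = min N (2 ^ k)" and "X = incr \<rho> D L N \<omega>" and "l = full_load s L N (modes_at \<omega>)"
  have \<rho>: "\<And>m. 0 \<le> \<rho> m" using adm unfolding admissible_def by blast
  have "wnorm2 \<rho> D (corr_N N (modes_at \<omega>)) \<le> 2 * wnorm2 \<rho> D (corr_N L (modes_at \<omega>)) + 2 * X"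
    unfolding X_def by (rule wnorm2_split[OF \<rho>])
  also have "\<dots> \<le> 2 * (16900 * (K + 1)\<^sup>2 * (real k + 1)\<^sup>2 * (4 * 2 powr (- s)) ^ Suc k) + 2 * X"
    unfolding L_def by (intro add_right_mono mult_left_mono wnorm2_low_le s K adm good) auto
  finally have "C * wnorm2 \<rho> D (corr_N N (modes_at \<omega>)) \<le> C * (2 * (16900 * (K + 1)\<^sup>2 * (real k + 1)\<^sup>2 * (4 * 2 powr (- s)) ^ Suc k) + 2 * X)"
    using C by (intro mult_left_mono)
  also have "\<dots> = b + 2 * C * X" unfolding b by (simp only: distrib_left mult.assoc mult.left_commute)
  finally show "exp (C * wnorm2 \<rho> D (corr_N N (modes_at \<omega>))) \<le> exp b * exp (2 * C * incr \<rho> D (min N (2 ^ k)) N \<omega>)"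
    by (simp add: exp_add[symmetric] X_def L_def)
  have \<theta>0: "0 \<le> \<theta>" using C by (intro order.trans[OF _ \<theta>(1)]) simp
  have "2 * \<theta> * l \<le> 2 * \<theta> * ((K + 2) * tau s k)"
    unfolding l_def L_def using \<theta>0 full_load_le_tau[OF s K good] by (intro mult_left_mono) auto
  then have l: "2 * \<theta> * l \<le> 1" using \<theta>(2) by linarith
  have "4 * C = (4 * exp 1 * C) * exp (- 1)" by (simp add: exp_minus)
  also have "\<dots> \<le> \<theta> * exp (- 2 * \<theta> * l)" using \<theta>0 \<theta>(1) C l by (intro mult_mono) auto
  finally have "4 * C * X \<le> \<theta> * exp (- 2 * \<theta> * l) * X"
    using wnorm2_nonneg[OF \<rho>] by (intro mult_right_mono) (auto simp: X_def)
  then have "4 * C * X \<le> 1 + (\<theta> * exp (- 2 * \<theta> * l) * X - 2 * \<theta> * l)" using l by linarith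
  then have "exp (4 * C * X) \<le> exp 1 * tilt \<theta> s \<rho> D L N \<omega>"
    unfolding tilt_def X_def[symmetric] l_def[symmetric] exp_add[symmetric] exp_le_cancel_iff .
  also have "\<dots> \<le> 3 * tilt \<theta> s \<rho> D L N \<omega>" using exp_le by (intro mult_right_mono) (auto simp: tilt_def)
  also have "4 * C * X = 2 * (2 * C * X)" by simp
  finally show "(exp (2 * C * incr \<rho> D (min N (2 ^ k)) N \<omega>))\<^sup>2 \<le> 3 * tilt \<theta> s \<rho> D (min N (2 ^ k)) N \<omega>"
    unfolding exp_double X_def L_def .
qed

text \<open>
  Beyond the last scale at which the partial Wick mass drops by more than 1, the cutoff controls the
  mass at all scales. The probability \<open>exp (- c 4\<^sup>k)\<close> that this scale is \<open>2\<^sup>k\<close> beats the deterministic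
  bound \<open>exp (c k\<^sup>2 2\<^bsup>(2 - s) k\<^esup>)\<close> for the contribution of the modes up to that scale.
\<close>

lemma exp_wnorm2_cutoff_bounded:
  assumes s: "0 < s" "s \<le> 1" and K: "0 \<le> K" and C: "0 \<le> C"
  shows "\<exists>B\<ge>0. \<forall>N \<rho> D. admissible s \<rho> D \<longrightarrow>
    (\<integral>\<^sup>+ \<omega>. ennreal (indicator {\<omega>. wick (modes_upto N) \<omega> \<le> K} \<omega> * exp (C * wnorm2 \<rho> D (corr_N N (modes_at \<omega>)))) \<partial>M) \<le> ennreal B"
proof -
  \<comment> \<open>\<open>C + 1\<close> instead of \<open>C\<close> keeps \<open>\<theta>\<close>
    positive when \<open>C = 0\<close>.\<close>
  define \<theta> where "\<theta> = 4 * exp 1 * (C + 1)"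
  have \<theta>: "0 < \<theta>" "4 * exp 1 * C \<le> \<theta>" using C by (auto simp: \<theta>_def)
  have "(\<lambda>k. 2 * \<theta> * ((K + 2) * tau s k)) \<longlonglongrightarrow> 2 * \<theta> * ((K + 2) * 0)"
    by (intro tendsto_intros tau_tendsto_0 s)
  then have "\<forall>\<^sub>F k in sequentially. 2 * \<theta> * ((K + 2) * tau s k) < 1"
    by (rule order_tendstoD(2)) simp
  then obtain k0 where k0': "\<forall>k\<ge>k0. 2 * \<theta> * ((K + 2) * tau s k) < 1"
    unfolding eventually_sequentially by blast
  have k0: "2 * \<theta> * ((K + 2) * tau s k) \<le> 1" if "k0 \<le> k" for k
    using k0'[rule_format, OF that] by (rule less_imp_le)
  define b where "b k = 2 * C * (16900 * (K + 1)\<^sup>2 * (real k + 1)\<^sup>2 * (4 * 2 powr (- s)) ^ Suc k)" for k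
  \<comment> \<open>The weight in Young's inequality \<open>x \<le> z k + x\<^sup>2 / z k\<close>.
    The probability that scale \<open>k\<close> is bad is at most \<open>1 / (z k)\<^sup>2\<close>,
    while the squared exponential has bounded expectation, so both terms integrate to a multiple of
    \<open>1 / z k\<close>.\<close>
  define z :: "nat \<Rightarrow> real" where "z k = exp (4 ^ k / 800)" for k
  have "summable (\<lambda>k. exp (2 * C * 16900 * (K + 1)\<^sup>2 * (real k + 2)\<^sup>2 * (4 * 2 powr (- s)) ^ Suc (Suc k) - 4 ^ k / 800))"
    using s C by (intro summable_exp_competition) (auto simp: powr_less_one)
  moreover have "2 * C * 16900 * (K + 1)\<^sup>2 * (real k + 2)\<^sup>2 * (4 * 2 powr (- s)) ^ Suc (Suc k) = b (Suc k)" for k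
  proof -
    have "real k + 2 = real (Suc k) + 1" by simp
    then show ?thesis unfolding b_def by (simp only: mult_ac)
  qed
  ultimately have sum: "summable (\<lambda>k. exp (b (Suc k)) / z k)" by (simp only: exp_diff z_def)
  define B where "B = 4 * exp (b k0) + 4 * (\<Sum>k. exp (b (Suc k)) / z k)"
  have B: "0 \<le> B" unfolding B_def by (intro add_nonneg_nonneg mult_nonneg_nonneg suminf_nonneg sum) (auto simp: z_def)
  show ?thesis
  proof (intro exI[of _ B] conjI B allI impI)
    fix N \<rho> D assume adm: "admissible s \<rho> D"
    define Y where "Y \<omega> = exp (C * wnorm2 \<rho> D (corr_N N (modes_at \<omega>)))" for \<omega>
    define T where "T k = tilt \<theta> s \<rho> D (min N (2 ^ k)) N" for k
    \<comment> \<open>At least 1 where scale \<open>k\<close> is bad, so it replaces the indicator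
      of that event.\<close>
    define U where "U k \<omega> = exp (4 ^ k / 200 * (- 1 - wick (modes_upto N - modes_upto (min N (2 ^ k))) \<omega>))" for k \<omega>
    have T0: "0 \<le> T k \<omega>" for k \<omega> by (simp add: T_def tilt_def)
    have [measurable]: "T k \<in> borel_measurable M" for k by (simp add: T_def)
    have [measurable]: "U k \<in> borel_measurable M" for k unfolding U_def[abs_def] by measurable
    have first: "Y \<omega> \<le> exp (b k0) * (1 + 3 * T k0 \<omega>)" if "good K N k0 \<omega>" for \<omega>
    proof -
      note le = exp_wnorm2_le_tilt[OF s K C adm that \<theta>(2) k0[OF order.refl] b_def]
      let ?e = "exp (2 * C * incr \<rho> D (min N (2 ^ k0)) N \<omega>)"
      have quad: "x \<le> 1 + x\<^sup>2" if "0 \<le> x" for x :: real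
        using sum_squares_bound[of 1 x] that by (simp add: power2_eq_square)
      have "?e \<le> 1 + ?e\<^sup>2" by (rule quad) (rule exp_ge_zero)
      also have "\<dots> \<le> 1 + 3 * T k0 \<omega>" using le(2) by (simp add: T_def)
      finally have "exp (b k0) * ?e \<le> exp (b k0) * (1 + 3 * T k0 \<omega>)" by (intro mult_left_mono) auto
      then show ?thesis unfolding Y_def by (rule order.trans[OF le(1)])
    qed
    have second: "Y \<omega> \<le> exp (b (Suc k)) * (z k * U k \<omega> + 3 * T (Suc k) \<omega> / z k)"
      if "k0 \<le> k" "good K N (Suc k) \<omega>" "bad N k \<omega>" for k \<omega>
    proof -
      have k: "k0 \<le> Suc k" using that by simp
      note le = exp_wnorm2_le_tilt[OF s K C adm that(2) \<theta>(2) k0[OF k] b_def]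
      let ?e = "exp (2 * C * incr \<rho> D (min N (2 ^ Suc k)) N \<omega>)"
      have z: "0 < z k" by (simp add: z_def)
      have U: "1 \<le> U k \<omega>" using that(3) by (simp add: U_def bad_def)
      have "0 \<le> z k * ?e" using z by simp
      then have "z k * ?e \<le> (z k)\<^sup>2 + ?e\<^sup>2"
        using sum_squares_bound[of "z k" ?e] by linarith
      then have "z k * ?e / z k \<le> ((z k)\<^sup>2 + ?e\<^sup>2) / z k" using z by (intro divide_right_mono) auto
      then have "?e \<le> z k * 1 + ?e\<^sup>2 / z k" using z by (simp add: add_divide_distrib power2_eq_square)
      also have "\<dots> \<le> z k * U k \<omega> + 3 * T (Suc k) \<omega> / z k"
        using U z le(2) by (intro add_mono mult_left_mono divide_right_mono) (auto simp: T_def)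
      finally have "exp (b (Suc k)) * ?e \<le> exp (b (Suc k)) * (z k * U k \<omega> + 3 * T (Suc k) \<omega> / z k)" by (intro mult_left_mono) auto
      then show ?thesis unfolding Y_def by (rule order.trans[OF le(1)])
    qed
    \<comment> \<open>The number of scales depends on \<open>N\<close>, the final bound does not:
      the sum over \<open>Ks\<close> is at most the whole series in \<open>B\<close>.\<close>
    define Ks where "Ks = {k0..<max N k0}"
    have nonneg: "0 \<le> exp (b (Suc k)) * (z k * U k \<omega> + 3 * T (Suc k) \<omega> / z k)" for k \<omega>
      using T0[of "Suc k" \<omega>] by (intro mult_nonneg_nonneg add_nonneg_nonneg divide_nonneg_nonneg) (auto simp: z_def U_def)
    have pw: "indicator {\<omega>. wick (modes_upto N) \<omega> \<le> K} \<omega> * Y \<omega>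
       \<le> exp (b k0) * (1 + 3 * T k0 \<omega>) + (\<Sum>k\<in>Ks. exp (b (Suc k)) * (z k * U k \<omega> + 3 * T (Suc k) \<omega> / z k))" for \<omega>
    proof (cases "wick (modes_upto N) \<omega> \<le> K")
      case True
      from good_or_last_bad[OF True, of k0] show ?thesis
      proof
        assume "good K N k0 \<omega>"
        from first[OF this] show ?thesis using True by (simp add: add_increasing2 sum_nonneg nonneg)
      next
        assume "\<exists>k\<in>{k0..<max N k0}. bad N k \<omega> \<and> good K N (Suc k) \<omega>"
        then obtain k where k: "k \<in> Ks" "bad N k \<omega>" "good K N (Suc k) \<omega>" by (auto simp: Ks_def)
        have "Y \<omega> \<le> exp (b (Suc k)) * (z k * U k \<omega> + 3 * T (Suc k) \<omega> / z k)"
          using k by (intro second) (auto simp: Ks_def)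
        also have "\<dots> \<le> (\<Sum>k\<in>Ks. exp (b (Suc k)) * (z k * U k \<omega> + 3 * T (Suc k) \<omega> / z k))"
          using k(1) nonneg by (intro member_le_sum) (auto simp: Ks_def)
        finally show ?thesis using True T0[of k0 \<omega>] by (simp add: add_increasing)
      qed
    next
      case False
      then show ?thesis using T0[of k0 \<omega>] by (simp add: add_nonneg_nonneg sum_nonneg nonneg)
    qed
    have "(\<integral>\<^sup>+ \<omega>. ennreal (indicator {\<omega>. wick (modes_upto N) \<omega> \<le> K} \<omega> * Y \<omega>) \<partial>M)
       \<le> (\<integral>\<^sup>+ \<omega>. ennreal (exp (b k0)) * (1 + 3 * ennreal (T k0 \<omega>)) + (\<Sum>k\<in>Ks. ennreal (exp (b (Suc k))) * (ennreal (z k) * ennreal (U k \<omega>) + ennreal (3 / z k) * ennreal (T (Suc k) \<omega>))) \<partial>M)"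
    proof (intro nn_integral_mono)
      fix \<omega>
      have 1: "ennreal (exp (b k0)) * (1 + 3 * ennreal (T k0 \<omega>)) = ennreal (exp (b k0) * (1 + 3 * T k0 \<omega>))"
        using T0[of k0 \<omega>] by (simp add: ennreal_mult)
      have 2: "ennreal (exp (b (Suc k))) * (ennreal (z k) * ennreal (U k \<omega>) + ennreal (3 / z k) * ennreal (T (Suc k) \<omega>))
         = ennreal (exp (b (Suc k)) * (z k * U k \<omega> + 3 * T (Suc k) \<omega> / z k))" for k
      proof -
        have "0 \<le> z k" "0 \<le> U k \<omega>" by (auto simp: z_def U_def)
        then have "ennreal (z k) * ennreal (U k \<omega>) = ennreal (z k * U k \<omega>)" "ennreal (3 / z k) * ennreal (T (Suc k) \<omega>) = ennreal (3 * T (Suc k) \<omega> / z k)"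
          "ennreal (z k * U k \<omega>) + ennreal (3 * T (Suc k) \<omega> / z k) = ennreal (z k * U k \<omega> + 3 * T (Suc k) \<omega> / z k)"
          using T0[of "Suc k" \<omega>] by (auto simp: ennreal_mult[symmetric] simp del: ennreal_plus simp add: ennreal_plus[symmetric])
        moreover have "0 \<le> z k * U k \<omega> + 3 * T (Suc k) \<omega> / z k"
          using \<open>0 \<le> z k\<close> \<open>0 \<le> U k \<omega>\<close> T0[of "Suc k" \<omega>] by simp
        ultimately show ?thesis by (simp only: ennreal_mult exp_ge_zero)
      qed
      have "ennreal (indicator {\<omega>. wick (modes_upto N) \<omega> \<le> K} \<omega> * Y \<omega>)
         \<le> ennreal (exp (b k0) * (1 + 3 * T k0 \<omega>) + (\<Sum>k\<in>Ks. exp (b (Suc k)) * (z k * U k \<omega> + 3 * T (Suc k) \<omega> / z k)))"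
        by (rule ennreal_leI[OF pw])
      also have "\<dots> = ennreal (exp (b k0) * (1 + 3 * T k0 \<omega>)) + ennreal (\<Sum>k\<in>Ks. exp (b (Suc k)) * (z k * U k \<omega> + 3 * T (Suc k) \<omega> / z k))"
        using T0[of k0 \<omega>] by (intro ennreal_plus sum_nonneg nonneg) simp
      finally show "ennreal (indicator {\<omega>. wick (modes_upto N) \<omega> \<le> K} \<omega> * Y \<omega>) \<le> ennreal (exp (b k0)) * (1 + 3 * ennreal (T k0 \<omega>)) + (\<Sum>k\<in>Ks. ennreal (exp (b (Suc k))) * (ennreal (z k) * ennreal (U k \<omega>) + ennreal (3 / z k) * ennreal (T (Suc k) \<omega>)))"
        unfolding 1 2 sum_ennreal[OF nonneg] .
    qed
    also have "\<dots> = ennreal (exp (b k0)) * (1 + 3 * (\<integral>\<^sup>+ \<omega>. ennreal (T k0 \<omega>) \<partial>M))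
        + (\<Sum>k\<in>Ks. ennreal (exp (b (Suc k))) * (ennreal (z k) * (\<integral>\<^sup>+ \<omega>. ennreal (U k \<omega>) \<partial>M) + ennreal (3 / z k) * (\<integral>\<^sup>+ \<omega>. ennreal (T (Suc k) \<omega>) \<partial>M)))"
    proof -
      have lin: "(\<integral>\<^sup>+ \<omega>. c * (x * F \<omega> + y * H \<omega>) \<partial>M) = c * (x * integral\<^sup>N M F + y * integral\<^sup>N M H)"
        if [measurable]: "F \<in> borel_measurable M" "H \<in> borel_measurable M" for c x y :: ennreal and F H
      proof -
        have "(\<integral>\<^sup>+ \<omega>. c * (x * F \<omega> + y * H \<omega>) \<partial>M) = c * (\<integral>\<^sup>+ \<omega>. x * F \<omega> + y * H \<omega> \<partial>M)"
          by (rule nn_integral_cmult) measurable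
        also have "(\<integral>\<^sup>+ \<omega>. x * F \<omega> + y * H \<omega> \<partial>M) = (\<integral>\<^sup>+ \<omega>. x * F \<omega> \<partial>M) + (\<integral>\<^sup>+ \<omega>. y * H \<omega> \<partial>M)"
          by (rule nn_integral_add) measurable
        also have "(\<integral>\<^sup>+ \<omega>. x * F \<omega> \<partial>M) = x * integral\<^sup>N M F" by (rule nn_integral_cmult) measurable
        also have "(\<integral>\<^sup>+ \<omega>. y * H \<omega> \<partial>M) = y * integral\<^sup>N M H" by (rule nn_integral_cmult) measurable
        finally show ?thesis .
      qed
      have m: "(\<lambda>\<omega>. ennreal (T k \<omega>)) \<in> borel_measurable M" "(\<lambda>\<omega>. ennreal (U k \<omega>)) \<in> borel_measurable M" for k
        by measurable
      have "(\<integral>\<^sup>+ \<omega>. ennreal (exp (b k0)) * (1 + 3 * ennreal (T k0 \<omega>)) \<partial>M) = ennreal (exp (b k0)) * (1 + 3 * (\<integral>\<^sup>+ \<omega>. ennreal (T k0 \<omega>) \<partial>M))"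
        using lin[of "\<lambda>_. 1", OF _ m(1), of "ennreal (exp (b k0))" 1 3 k0] by (simp add: emeasure_space_1)
      moreover have "(\<integral>\<^sup>+ \<omega>. (\<Sum>k\<in>Ks. ennreal (exp (b (Suc k))) * (ennreal (z k) * ennreal (U k \<omega>) + ennreal (3 / z k) * ennreal (T (Suc k) \<omega>))) \<partial>M)
        = (\<Sum>k\<in>Ks. ennreal (exp (b (Suc k))) * (ennreal (z k) * (\<integral>\<^sup>+ \<omega>. ennreal (U k \<omega>) \<partial>M) + ennreal (3 / z k) * (\<integral>\<^sup>+ \<omega>. ennreal (T (Suc k) \<omega>) \<partial>M)))"
        by (rule trans[OF nn_integral_sum sum.cong[OF refl lin[OF m(2) m(1)]]]) measurable
      moreover have "(\<integral>\<^sup>+ \<omega>. ennreal (exp (b k0)) * (1 + 3 * ennreal (T k0 \<omega>)) + (\<Sum>k\<in>Ks. ennreal (exp (b (Suc k))) * (ennreal (z k) * ennreal (U k \<omega>) + ennreal (3 / z k) * ennreal (T (Suc k) \<omega>))) \<partial>M)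
        = (\<integral>\<^sup>+ \<omega>. ennreal (exp (b k0)) * (1 + 3 * ennreal (T k0 \<omega>)) \<partial>M)
        + (\<integral>\<^sup>+ \<omega>. (\<Sum>k\<in>Ks. ennreal (exp (b (Suc k))) * (ennreal (z k) * ennreal (U k \<omega>) + ennreal (3 / z k) * ennreal (T (Suc k) \<omega>))) \<partial>M)"
        by (rule nn_integral_add) measurable
      ultimately show ?thesis by (simp only:)
    qed
    also have "\<dots> \<le> ennreal (exp (b k0)) * (1 + 3 * 1) + (\<Sum>k\<in>Ks. ennreal (exp (b (Suc k))) * (ennreal (z k) * ennreal (exp (- (4 ^ k / 400))) + ennreal (3 / z k) * 1))"
    proof -
      have T1: "(\<integral>\<^sup>+ \<omega>. ennreal (T k \<omega>) \<partial>M) \<le> 1" for k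
        unfolding T_def using \<theta> by (intro nn_integral_tilt_le_1[OF adm]) auto
      have U1: "(\<integral>\<^sup>+ \<omega>. ennreal (U k \<omega>) \<partial>M) \<le> ennreal (exp (- (4 ^ k / 400)))" for k
        unfolding U_def by (rule nn_integral_bad_le)
      show ?thesis
        by (rule add_mono[OF mult_left_mono[OF add_left_mono[OF mult_left_mono[OF T1]]]
              sum_mono[OF mult_left_mono[OF add_mono[OF mult_left_mono[OF U1] mult_left_mono[OF T1]]]]]) (rule zero_le)+
    qed
    also have "\<dots> = ennreal (4 * exp (b k0) + (\<Sum>k\<in>Ks. 4 * (exp (b (Suc k)) / z k)))"
    proof -
      have four: "(1 + 3 * 1 :: ennreal) = ennreal 4" by simp
      have 1: "ennreal (exp (b k0)) * (1 + 3 * 1) = ennreal (4 * exp (b k0))"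
        unfolding four by (subst ennreal_mult[symmetric]) (simp_all add: mult.commute)
      have 2: "ennreal (exp (b (Suc k))) * (ennreal (z k) * ennreal (exp (- (4 ^ k / 400))) + ennreal (3 / z k) * 1) = ennreal (4 * (exp (b (Suc k)) / z k))" for k
      proof -
        have z: "0 < z k" by (simp add: z_def)
        have "z k * exp (- (4 ^ k / 400)) = exp (4 ^ k / 800 + - (4 ^ k / 400))" unfolding z_def exp_add ..
        also have "4 ^ k / 800 + - (4 ^ k / 400) = - (4 ^ k / 800 :: real)" by simp
        also have "exp \<dots> = 1 / z k" by (simp only: z_def exp_minus inverse_eq_divide)
        finally have "ennreal (z k) * ennreal (exp (- (4 ^ k / 400))) = ennreal (1 / z k)"
          using z by (subst ennreal_mult[symmetric]) auto
        moreover have "ennreal (1 / z k) + ennreal (3 / z k) * 1 = ennreal (4 / z k)"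
          using z by (simp add: ennreal_plus[symmetric] add_divide_distrib[symmetric] del: ennreal_plus)
        moreover have "ennreal (exp (b (Suc k))) * ennreal (4 / z k) = ennreal (4 * (exp (b (Suc k)) / z k))"
          using z by (subst ennreal_mult[symmetric]) auto
        ultimately show ?thesis by (simp only:)
      qed
      have pos: "0 \<le> 4 * (exp (b (Suc k)) / z k)" for k by (simp add: z_def)
      show ?thesis unfolding 1 2 sum_ennreal[OF pos]
        by (rule ennreal_plus[symmetric]) (simp, rule sum_nonneg, rule pos)
    qed
    also have "\<dots> \<le> ennreal B"
    proof (rule ennreal_leI)
      have "(\<Sum>k\<in>Ks. exp (b (Suc k)) / z k) \<le> (\<Sum>k. exp (b (Suc k)) / z k)"
        by (intro sum_le_suminf sum) (auto simp: Ks_def z_def)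
      then show "4 * exp (b k0) + (\<Sum>k\<in>Ks. 4 * (exp (b (Suc k)) / z k)) \<le> B"
        unfolding B_def sum_distrib_left[symmetric] by simp
    qed
    finally show "(\<integral>\<^sup>+ \<omega>. ennreal (indicator {\<omega>. wick (modes_upto N) \<omega> \<le> K} \<omega> * exp (C * wnorm2 \<rho> D (corr_N N (modes_at \<omega>)))) \<partial>M) \<le> ennreal B"
      by (simp add: Y_def)
  qed
qed

end

section \<open>Conditioning on the complex field\<close>

text \<open>Independence is assumed for one family indexed by a sum type; the subfamilies of
  \<open>g\<close> and of \<open>h\<close> are extracted from it along the injections.\<close>

lemma (in prob_space) indep_vars_reindex:
  assumes "indep_vars (\<lambda>_. N) X I" "inj_on f J" "f ` J \<subseteq> I"
  shows "indep_vars (\<lambda>_. N) (\<lambda>j. X (f j)) J"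
proof -
  have *: "indep_sets F (f ` J) \<Longrightarrow> indep_sets (\<lambda>j. F (f j)) J" for F
  proof (rule indep_setsI)
    assume F: "indep_sets F (f ` J)"
    then show "F (f j) \<subseteq> events" if "j \<in> J" for j using that by (auto simp: indep_sets_def)
    fix A J' assume J': "J' \<noteq> {}" "J' \<subseteq> J" "finite J'" "\<forall>j\<in>J'. A j \<in> F (f j)"
    then have inj: "inj_on f J'" using assms(2) inj_on_subset by blast
    define A' where "A' i = A (the_inv_into J' f i)" for i
    have A': "A' (f j) = A j" if "j \<in> J'" for j using that inj by (simp add: A'_def the_inv_into_f_f)
    have "prob (\<Inter>i\<in>f ` J'. A' i) = (\<Prod>i\<in>f ` J'. prob (A' i))"
      using J' A' by (intro indep_setsD[OF F]) auto
    then show "prob (\<Inter>j\<in>J'. A j) = (\<Prod>j\<in>J'. prob (A j))"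
      using A' inj by (simp add: prod.reindex)
  qed
  from assms(1,3) have "indep_vars (\<lambda>_. N) X (f ` J)" by (rule indep_vars_subset)
  then show ?thesis unfolding indep_vars_def using * by auto
qed

locale gaussian_setup =
  fixes M :: "'a measure" and g h l :: "mode \<Rightarrow> 'a \<Rightarrow> complex"
  assumes family: "gaussian_family M g h l"
begin

sublocale gaussian_modes M g
proof -
  interpret prob_space M using family by (simp add: gaussian_family_def)
  show "gaussian_modes M g"
  proof
    show "std_complex_gaussian M (g n)" for n
      using family by (simp only: gaussian_family_def)
    have "indep_vars (\<lambda>_. borel) (case_sum g (case_sum h l)) (UNIV <+> half_modes <+> half_modes)"
      using family by (simp only: gaussian_family_def)
    then have "indep_vars (\<lambda>_. borel) (\<lambda>n. case_sum g (case_sum h l) (Inl n)) UNIV"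
      by (rule indep_vars_reindex) (auto simp: inj_on_def)
    then show "indep_vars (\<lambda>_. borel) g UNIV" by simp
  qed
qed

abbreviation all_vars :: "mode + mode + mode \<Rightarrow> 'a \<Rightarrow> complex" where
  "all_vars \<equiv> case_sum g (case_sum h l)"

lemma indep_all_vars: "indep_vars (\<lambda>_. borel) all_vars (UNIV <+> half_modes <+> half_modes)"
  using family by (simp add: gaussian_family_def)

lemma hermitian_h: "hermitian_gaussian M h"
  using family by (simp add: gaussian_family_def)

lemma h_measurable [measurable]: "h n \<in> borel_measurable M"
  using hermitian_h unfolding hermitian_gaussian_def by blast

lemma zero_in_half_modes [simp]: "0 \<in> half_modes"
  by (simp add: half_modes_def)

lemma nn_integral_exp_h0: "(\<integral>\<^sup>+ \<omega>. ennreal (exp (a * Re (h 0 \<omega>))) \<partial>M) = ennreal (exp (a\<^sup>2 / 2))"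
proof -
  have d: "distributed M lborel (\<lambda>\<omega>. Re (h 0 \<omega>)) std_normal_density"
    using hermitian_h by (simp add: hermitian_gaussian_def)
  have eq: "std_normal_density x * exp (a * x) = exp (a\<^sup>2 / 2) * normal_density a 1 x" for x
  proof -
    have "- (x\<^sup>2 / 2) + a * x = a\<^sup>2 / 2 + - ((x - a)\<^sup>2 / 2)" by (simp add: power2_eq_square field_simps)
    then have "exp (- (x\<^sup>2 / 2)) * exp (a * x) = exp (a\<^sup>2 / 2) * exp (- ((x - a)\<^sup>2 / 2))"
      by (simp only: exp_add[symmetric])
    then show ?thesis by (simp add: normal_density_def)
  qed
  have "(\<integral>\<^sup>+ \<omega>. ennreal (exp (a * Re (h 0 \<omega>))) \<partial>M)
      = (\<integral>\<^sup>+ x. ennreal (std_normal_density x) * ennreal (exp (a * x)) \<partial>lborel)"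
    by (rule distributed_nn_integral[OF d, symmetric]) simp
  also have "\<dots> = (\<integral>\<^sup>+ x. ennreal (exp (a\<^sup>2 / 2)) * ennreal (normal_density a 1 x) \<partial>lborel)"
    by (intro nn_integral_cong) (simp only: ennreal_mult[symmetric] eq normal_density_nonneg exp_ge_zero)
  also have "\<dots> = ennreal (exp (a\<^sup>2 / 2)) * (\<integral>\<^sup>+ x. ennreal (normal_density a 1 x) \<partial>lborel)"
    by (rule nn_integral_cmult) simp
  also have "(\<integral>\<^sup>+ x. ennreal (normal_density a 1 x) \<partial>lborel) = 1"
    by (subst nn_integral_eq_integral) auto
  finally show ?thesis by simp
qed

text \<open>The interaction as a function of \<open>y = h\<close> when \<open>u\<close> is frozen: a
  real-linear form in the real zero mode and in finitely many independent complex modes.\<close>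

definition lin :: "mode set \<Rightarrow> real \<Rightarrow> (mode \<Rightarrow> complex) \<Rightarrow> (mode \<Rightarrow> complex) \<Rightarrow> real" where
  "lin E a c y = a * Re (y 0) + (\<Sum>m\<in>E. Re (c m * cnj (y m)))"

text \<open>The real zero mode has variance 1, whereas \<open>Re (c m * cnj (y m))\<close> has
  variance \<open>(cmod (c m))\<^sup>2 / 2\<close>.\<close>

definition lin_var :: "mode set \<Rightarrow> real \<Rightarrow> (mode \<Rightarrow> complex) \<Rightarrow> real" where
  "lin_var E a c = a\<^sup>2 + (\<Sum>m\<in>E. (cmod (c m))\<^sup>2) / 2"

lemma nn_integral_exp_lin:
  assumes E: "finite E" "E \<subseteq> half_modes - {0}"
  shows "(\<integral>\<^sup>+ \<omega>. ennreal (exp (lin E a c (\<lambda>m. h m \<omega>))) \<partial>M) = ennreal (exp (lin_var E a c / 2))"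
proof -
  define Y where "Y m z = (if m = 0 then a * Re z else Re (c m * cnj z))" for m z
  have Ym: "(\<lambda>z. ennreal (exp (Y m z))) \<in> borel_measurable borel" for m
    unfolding Y_def by measurable
  have indh: "indep_vars (\<lambda>_. borel) (\<lambda>m. all_vars (Inr (Inl m))) (insert 0 E)"
    using E by (intro indep_vars_reindex[OF indep_all_vars]) (auto simp: inj_on_def)
  then have indh: "indep_vars (\<lambda>_. borel) h (insert 0 E)" by simp
  have ind: "indep_vars (\<lambda>_. borel) (\<lambda>m \<omega>. ennreal (exp (Y m (h m \<omega>)))) (insert 0 E)"
    by (rule indep_vars_compose2[OF indh]) (rule Ym)
  have 0: "0 \<notin> E" using E by auto
  have "(\<Sum>m\<in>E. Y m (h m \<omega>)) = (\<Sum>m\<in>E. Re (c m * cnj (h m \<omega>)))" for \<omega>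
    using 0 by (intro sum.cong) (auto simp: Y_def)
  then have "lin E a c (\<lambda>m. h m \<omega>) = (\<Sum>m\<in>insert 0 E. Y m (h m \<omega>))" for \<omega>
    using 0 E by (simp add: lin_def Y_def)
  then have "(\<integral>\<^sup>+ \<omega>. ennreal (exp (lin E a c (\<lambda>m. h m \<omega>))) \<partial>M)
      = (\<integral>\<^sup>+ \<omega>. (\<Prod>m\<in>insert 0 E. ennreal (exp (Y m (h m \<omega>)))) \<partial>M)"
    using E by (intro nn_integral_cong) (subst prod_ennreal, auto simp: exp_sum)
  also have "\<dots> = (\<Prod>m\<in>insert 0 E. \<integral>\<^sup>+ \<omega>. ennreal (exp (Y m (h m \<omega>))) \<partial>M)"
    using E by (intro indep_vars_nn_integral ind) auto
  also have "\<dots> = (\<integral>\<^sup>+ \<omega>. ennreal (exp (Y 0 (h 0 \<omega>))) \<partial>M) * (\<Prod>m\<in>E. \<integral>\<^sup>+ \<omega>. ennreal (exp (Y m (h m \<omega>))) \<partial>M)"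
    using E 0 by simp
  also have "(\<integral>\<^sup>+ \<omega>. ennreal (exp (Y 0 (h 0 \<omega>))) \<partial>M) = ennreal (exp (a\<^sup>2 / 2))"
    by (simp add: Y_def nn_integral_exp_h0)
  also have "(\<Prod>m\<in>E. \<integral>\<^sup>+ \<omega>. ennreal (exp (Y m (h m \<omega>))) \<partial>M) = (\<Prod>m\<in>E. ennreal (exp ((cmod (c m))\<^sup>2 / 4)))"
  proof (intro prod.cong refl)
    fix m assume "m \<in> E"
    then have "m \<noteq> 0" using 0 by auto
    then have gm: "std_complex_gaussian M (h m)" using hermitian_h unfolding hermitian_gaussian_def by blast
    have "Y m (h m \<omega>) = Re (cnj (c m) * h m \<omega>) + 0 * (cmod (h m \<omega>))\<^sup>2" for \<omega>
      using \<open>m \<noteq> 0\<close> by (simp add: Y_def)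
    then show "(\<integral>\<^sup>+ \<omega>. ennreal (exp (Y m (h m \<omega>))) \<partial>M) = ennreal (exp ((cmod (c m))\<^sup>2 / 4))"
      using nn_integral_std_complex_gaussian_exp[OF gm, of 0 "cnj (c m)"] by (simp only:) simp
  qed
  also have "\<dots> = ennreal (exp ((\<Sum>m\<in>E. (cmod (c m))\<^sup>2) / 4))"
    using E by (subst prod_ennreal) (auto simp: exp_sum[symmetric] sum_divide_distrib)
  also have "ennreal (exp (a\<^sup>2 / 2)) * \<dots> = ennreal (exp (lin_var E a c / 2))"
    by (subst ennreal_mult[symmetric]) (auto simp: lin_var_def exp_add[symmetric])
  finally show ?thesis .
qed

text \<open>The whole family \<open>g\<close> is independent of the modes of \<open>h\<close> in
  \<open>insert 0 E\<close>, so these are integrated first with \<open>g\<close> frozen. Only one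
  mode of each opposite pair is independent of the others, hence
  \<open>E \<subseteq> half_modes\<close>. Writing \<open>\<Phi>\<close>, \<open>a\<close> and
  \<open>c\<close> as functions on the product space keeps the two blocks of variables
  apart.\<close>

lemma nn_integral_condition_g:
  fixes \<Phi> :: "(mode \<Rightarrow> complex) \<Rightarrow> ennreal" and a :: "(mode \<Rightarrow> complex) \<Rightarrow> real"
  assumes E: "finite E" "E \<subseteq> half_modes - {0}"
    and [measurable]: "\<Phi> \<in> borel_measurable (PiM UNIV (\<lambda>_. borel))"
      "a \<in> borel_measurable (PiM UNIV (\<lambda>_. borel))"
      "\<And>m. (\<lambda>x. c x m) \<in> borel_measurable (PiM UNIV (\<lambda>_. borel))"
  shows "(\<integral>\<^sup>+ \<omega>. \<Phi> (\<lambda>n. g n \<omega>) * ennreal (exp (lin E (a (\<lambda>n. g n \<omega>)) (c (\<lambda>n. g n \<omega>)) (\<lambda>m. h m \<omega>))) \<partial>M)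
       = (\<integral>\<^sup>+ \<omega>. \<Phi> (\<lambda>n. g n \<omega>) * ennreal (exp (lin_var E (a (\<lambda>n. g n \<omega>)) (c (\<lambda>n. g n \<omega>)) / 2)) \<partial>M)"
proof -
  define A B :: "(mode + mode + mode) set" where "A = range Inl" and "B = Inr ` Inl ` insert 0 E"
  have ind: "indep_var (PiM A (\<lambda>_. borel)) (\<lambda>\<omega>. restrict (\<lambda>i. all_vars i \<omega>) A)
      (PiM B (\<lambda>_. borel)) (\<lambda>\<omega>. restrict (\<lambda>i. all_vars i \<omega>) B)"
    using E by (intro indep_var_restrict[OF indep_all_vars]) (auto simp: A_def B_def)
  define G where "G x = (\<lambda>n. x (Inl n))" for x :: "mode + mode + mode \<Rightarrow> complex"
  define H where "H y = (\<lambda>m. y (Inr (Inl m)))" for y :: "mode + mode + mode \<Rightarrow> complex"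
  have G[measurable]: "G \<in> measurable (PiM A (\<lambda>_. borel)) (PiM UNIV (\<lambda>_. borel))"
    unfolding G_def by (rule measurable_PiM_single') (auto simp: A_def intro: measurable_component_singleton)
  let ?P = "PiM A (\<lambda>_. borel :: complex measure) \<Otimes>\<^sub>M PiM B (\<lambda>_. borel :: complex measure)"
  have H: "(\<lambda>p. H (snd p) m) \<in> borel_measurable ?P" if "m \<in> insert 0 E" for m
    unfolding H_def using that by (intro measurable_compose[OF measurable_snd measurable_component_singleton]) (auto simp: B_def)
  define f where "f p = \<Phi> (G (fst p)) * ennreal (exp (lin E (a (G (fst p))) (c (G (fst p))) (H (snd p))))" for p
  have "(\<lambda>p. lin E (a (G (fst p))) (c (G (fst p))) (H (snd p))) \<in> borel_measurable ?P"
    unfolding lin_def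
  proof (intro borel_measurable_add borel_measurable_sum borel_measurable_times)
    show "(\<lambda>p. a (G (fst p))) \<in> borel_measurable ?P" by measurable
    have [measurable]: "(\<lambda>p. H (snd p) 0) \<in> borel_measurable ?P" by (rule H) simp
    show "(\<lambda>p. Re (H (snd p) 0)) \<in> borel_measurable ?P" by measurable
    fix m assume "m \<in> E"
    then have [measurable]: "(\<lambda>p. H (snd p) m) \<in> borel_measurable ?P" by (intro H) simp
    show "(\<lambda>p. Re (c (G (fst p)) m * cnj (H (snd p) m))) \<in> borel_measurable ?P" by measurable
  qed
  then have f: "f \<in> borel_measurable ?P" unfolding f_def by measurable
  have GX: "G (restrict (\<lambda>i. all_vars i \<omega>) A) = (\<lambda>n. g n \<omega>)" for \<omega>
    by (auto simp: G_def A_def)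
  have HX: "lin E a' c' (H (restrict (\<lambda>i. all_vars i \<omega>) B)) = lin E a' c' (\<lambda>m. h m \<omega>)" for a' c' \<omega>
    unfolding lin_def by (intro arg_cong2[where f="(+)"] sum.cong) (auto simp: H_def B_def)
  have "(\<integral>\<^sup>+ \<omega>. f (restrict (\<lambda>i. all_vars i \<omega>) A, restrict (\<lambda>i. all_vars i \<omega>) B) \<partial>M)
     = (\<integral>\<^sup>+ \<omega>. \<integral>\<^sup>+ \<omega>'. f (restrict (\<lambda>i. all_vars i \<omega>) A, restrict (\<lambda>i. all_vars i \<omega>') B) \<partial>M \<partial>M)"
    by (rule nn_integral_indep_var[OF ind f])
  also have "\<dots> = (\<integral>\<^sup>+ \<omega>. \<Phi> (\<lambda>n. g n \<omega>) * ennreal (exp (lin_var E (a (\<lambda>n. g n \<omega>)) (c (\<lambda>n. g n \<omega>)) / 2)) \<partial>M)"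
  proof (rule nn_integral_cong)
    fix \<omega>
    have [measurable]: "(\<lambda>\<omega>'. lin E (a (\<lambda>n. g n \<omega>)) (c (\<lambda>n. g n \<omega>)) (\<lambda>m. h m \<omega>')) \<in> borel_measurable M"
      unfolding lin_def by measurable
    show "(\<integral>\<^sup>+ \<omega>'. f (restrict (\<lambda>i. all_vars i \<omega>) A, restrict (\<lambda>i. all_vars i \<omega>') B) \<partial>M)
       = \<Phi> (\<lambda>n. g n \<omega>) * ennreal (exp (lin_var E (a (\<lambda>n. g n \<omega>)) (c (\<lambda>n. g n \<omega>)) / 2))"
      unfolding f_def fst_conv snd_conv GX HX nn_integral_exp_lin[OF E, symmetric]
      by (rule nn_integral_cmult) measurable
  qed
  finally show ?thesis unfolding f_def fst_conv snd_conv GX HX .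
qed

text \<open>Given \<open>g\<close>, the form divided by \<open>sqrt V\<close> is Gaussian with
  variance at most 1, so its exponential moments at 1 and at -1 are at most
  \<open>exp (1 / 2) \<le> 2\<close>, and the even power is dominated by the two exponentials. The
  divisor is an upper bound \<open>V\<close> because the conditional variance itself may
  vanish.\<close>

lemma nn_integral_lin_power_le:
  fixes a V :: "(mode \<Rightarrow> complex) \<Rightarrow> real"
  assumes E: "finite E" "E \<subseteq> half_modes - {0}"
    and [measurable]: "V \<in> borel_measurable (PiM UNIV (\<lambda>_. borel))"
      "a \<in> borel_measurable (PiM UNIV (\<lambda>_. borel))"
      "\<And>m. (\<lambda>x. c x m) \<in> borel_measurable (PiM UNIV (\<lambda>_. borel))"
    and V: "\<And>x. 0 < V x" "\<And>x. lin_var E (a x) (c x) \<le> V x"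
  shows "(\<integral>\<^sup>+ \<omega>. ennreal (lin E (a (\<lambda>n. g n \<omega>)) (c (\<lambda>n. g n \<omega>)) (\<lambda>m. h m \<omega>) ^ (2 * q)) \<partial>M)
       \<le> ennreal (4 * fact (2 * q)) * (\<integral>\<^sup>+ \<omega>. ennreal (V (\<lambda>n. g n \<omega>) ^ q) \<partial>M)"
proof -
  define \<Phi> where "\<Phi> x = ennreal (fact (2 * q) * V x ^ q)" for x
  have [measurable]: "\<Phi> \<in> borel_measurable (PiM UNIV (\<lambda>_. borel))" unfolding \<Phi>_def by measurable
  let ?G = "\<lambda>\<omega> n. g n \<omega>" and ?H = "\<lambda>\<omega> m. h m \<omega>"
  have gG[measurable]: "?G \<in> measurable M (PiM UNIV (\<lambda>_. borel))"
    by (rule measurable_PiM_single') auto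
  have half: "(\<integral>\<^sup>+ \<omega>. \<Phi> (?G \<omega>) * ennreal (exp (e * (lin E (a (?G \<omega>)) (c (?G \<omega>)) (?H \<omega>) / sqrt (V (?G \<omega>))))) \<partial>M)
      \<le> ennreal (2 * fact (2 * q)) * (\<integral>\<^sup>+ \<omega>. ennreal (V (?G \<omega>) ^ q) \<partial>M)" if e: "e\<^sup>2 = 1" for e
  proof -
    define a' where "a' x = e / sqrt (V x) * a x" for x
    define c' where "c' x m = of_real (e / sqrt (V x)) * c x m" for x m
    have [measurable]: "a' \<in> borel_measurable (PiM UNIV (\<lambda>_. borel))" unfolding a'_def by measurable
    have [measurable]: "(\<lambda>x. c' x m) \<in> borel_measurable (PiM UNIV (\<lambda>_. borel))" for m unfolding c'_def by measurable
    have lin': "e * (lin E (a x) (c x) y / sqrt (V x)) = lin E (a' x) (c' x) y" for x y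
      by (simp add: lin_def a'_def c'_def sum_distrib_left sum_divide_distrib distrib_left add_divide_distrib right_diff_distrib mult.assoc diff_divide_distrib)
    have var': "lin_var E (a' x) (c' x) \<le> 1" for x
    proof -
      have "(e / sqrt (V x))\<^sup>2 = 1 / V x" using V(1)[of x] e by (simp add: power_divide)
      then have "lin_var E (a' x) (c' x) = lin_var E (a x) (c x) / V x"
        unfolding lin_var_def a'_def c'_def norm_mult power_mult_distrib norm_of_real power2_abs
        by (simp add: add_divide_distrib sum_divide_distrib mult.commute)
      then show ?thesis using V[of x] by simp
    qed
    have "(\<integral>\<^sup>+ \<omega>. \<Phi> (?G \<omega>) * ennreal (exp (e * (lin E (a (?G \<omega>)) (c (?G \<omega>)) (?H \<omega>) / sqrt (V (?G \<omega>))))) \<partial>M)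
       = (\<integral>\<^sup>+ \<omega>. \<Phi> (?G \<omega>) * ennreal (exp (lin_var E (a' (?G \<omega>)) (c' (?G \<omega>)) / 2)) \<partial>M)"
      unfolding lin' by (rule nn_integral_condition_g[OF E]) measurable
    also have "\<dots> \<le> (\<integral>\<^sup>+ \<omega>. ennreal (2 * fact (2 * q)) * ennreal (V (?G \<omega>) ^ q) \<partial>M)"
    proof (rule nn_integral_mono)
      fix \<omega>
      have "exp (lin_var E (a' (?G \<omega>)) (c' (?G \<omega>)) / 2) \<le> exp (1 / 2)" using var' by simp
      also have "exp (1 / 2 :: real) \<le> 2"
      proof (rule power2_le_imp_le)
        show "(exp (1 / 2 :: real))\<^sup>2 \<le> 2\<^sup>2" using exp_le by (simp add: exp_double[symmetric])
      qed simp
      finally have "fact (2 * q) * V (?G \<omega>) ^ q * exp (lin_var E (a' (?G \<omega>)) (c' (?G \<omega>)) / 2) \<le> fact (2 * q) * V (?G \<omega>) ^ q * 2"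
        using V(1)[of "?G \<omega>"] by (intro mult_left_mono) auto
      then show "\<Phi> (?G \<omega>) * ennreal (exp (lin_var E (a' (?G \<omega>)) (c' (?G \<omega>)) / 2)) \<le> ennreal (2 * fact (2 * q)) * ennreal (V (?G \<omega>) ^ q)"
        using V(1)[of "?G \<omega>"] unfolding \<Phi>_def by (subst (1 2) ennreal_mult[symmetric]) (auto intro!: ennreal_leI simp: mult_ac less_imp_le)
    qed
    also have "\<dots> = ennreal (2 * fact (2 * q)) * (\<integral>\<^sup>+ \<omega>. ennreal (V (?G \<omega>) ^ q) \<partial>M)"
      by (rule nn_integral_cmult) measurable
    finally show ?thesis .
  qed
  have [measurable]: "(\<lambda>\<omega>. lin E (a (?G \<omega>)) (c (?G \<omega>)) (?H \<omega>)) \<in> borel_measurable M"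
    unfolding lin_def by measurable
  have "(\<integral>\<^sup>+ \<omega>. ennreal (lin E (a (?G \<omega>)) (c (?G \<omega>)) (?H \<omega>) ^ (2 * q)) \<partial>M)
     \<le> (\<integral>\<^sup>+ \<omega>. \<Phi> (?G \<omega>) * ennreal (exp (1 * (lin E (a (?G \<omega>)) (c (?G \<omega>)) (?H \<omega>) / sqrt (V (?G \<omega>)))))
        + \<Phi> (?G \<omega>) * ennreal (exp (- 1 * (lin E (a (?G \<omega>)) (c (?G \<omega>)) (?H \<omega>) / sqrt (V (?G \<omega>))))) \<partial>M)"
  proof (rule nn_integral_mono)
    fix \<omega>
    define X W where "X = lin E (a (?G \<omega>)) (c (?G \<omega>)) (?H \<omega>)" and "W = V (?G \<omega>)"
    have W: "0 < W" using V(1) by (simp add: W_def)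
    have "X ^ (2 * q) = W ^ q * (X / sqrt W) ^ (2 * q)"
      using W by (simp add: power_mult power_divide)
    also have "\<dots> \<le> W ^ q * (fact (2 * q) * (exp (X / sqrt W) + exp (- (X / sqrt W))))"
      using W by (intro mult_left_mono power_even_le_fact_exp) auto
    also have "\<dots> = fact (2 * q) * W ^ q * exp (1 * (X / sqrt W)) + fact (2 * q) * W ^ q * exp (- 1 * (X / sqrt W))"
      by (simp add: algebra_simps)
    finally have "ennreal (X ^ (2 * q)) \<le> ennreal (fact (2 * q) * W ^ q * exp (1 * (X / sqrt W)) + fact (2 * q) * W ^ q * exp (- 1 * (X / sqrt W)))"
      by (rule ennreal_leI)
    also have "\<dots> = ennreal (fact (2 * q) * W ^ q) * ennreal (exp (1 * (X / sqrt W))) + ennreal (fact (2 * q) * W ^ q) * ennreal (exp (- 1 * (X / sqrt W)))"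
      using W by (subst ennreal_plus) (auto simp: ennreal_mult)
    finally show "ennreal (X ^ (2 * q)) \<le> \<Phi> (?G \<omega>) * ennreal (exp (1 * (X / sqrt (V (?G \<omega>)))))
        + \<Phi> (?G \<omega>) * ennreal (exp (- 1 * (X / sqrt (V (?G \<omega>)))))" by (simp only: \<Phi>_def W_def)
  qed
  also have "\<dots> = (\<integral>\<^sup>+ \<omega>. \<Phi> (?G \<omega>) * ennreal (exp (1 * (lin E (a (?G \<omega>)) (c (?G \<omega>)) (?H \<omega>) / sqrt (V (?G \<omega>))))) \<partial>M)
     + (\<integral>\<^sup>+ \<omega>. \<Phi> (?G \<omega>) * ennreal (exp (- 1 * (lin E (a (?G \<omega>)) (c (?G \<omega>)) (?H \<omega>) / sqrt (V (?G \<omega>))))) \<partial>M)"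
    by (rule nn_integral_add) measurable
  also have "\<dots> \<le> ennreal (2 * fact (2 * q)) * (\<integral>\<^sup>+ \<omega>. ennreal (V (?G \<omega>) ^ q) \<partial>M) + ennreal (2 * fact (2 * q)) * (\<integral>\<^sup>+ \<omega>. ennreal (V (?G \<omega>) ^ q) \<partial>M)"
    by (rule add_mono[OF half half]) auto
  also have "\<dots> = ennreal (4 * fact (2 * q)) * (\<integral>\<^sup>+ \<omega>. ennreal (V (?G \<omega>) ^ q) \<partial>M)"
    unfolding distrib_right[symmetric] by (subst ennreal_plus[symmetric]) auto
  finally show ?thesis .
qed

end

section \<open>Fourier series and distributions on the torus\<close>

declare split_paired_All [simp del] split_paired_Ex [simp del]

lemma freq_add: "freq (m + n) = freq m + freq n"
  and freq_minus: "freq (- n) = - freq n"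
  by (simp_all add: freq_def)

lemma character_mult: "character m x * character n x = character (m + n) x"
  by (simp add: character_def freq_add inner_add_left distrib_left exp_add)

lemma cnj_character: "cnj (character n x) = character (- n) x"
  by (simp add: character_def freq_minus exp_cnj)

lemma character_0 [simp]: "character 0 x = 1"
  by (simp add: character_def freq_def flip: zero_prod_def)

definition trig :: "mode set \<Rightarrow> (mode \<Rightarrow> complex) \<Rightarrow> plane \<Rightarrow> complex" where
  "trig S c x = (\<Sum>m\<in>S. c m * character m x)"

lemma character_has_derivative:
  "(character n has_derivative (\<lambda>h. character n x * (\<i> * complex_of_real (freq n \<bullet> h)))) (at x)"
proof -
  have 1: "((\<lambda>x. \<i> * complex_of_real (freq n \<bullet> x)) has_derivative (\<lambda>h. \<i> * complex_of_real (freq n \<bullet> h))) (at x)"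
    by (auto intro!: derivative_eq_intros)
  have 2: "(exp has_derivative (*) (exp z)) (at z)" for z :: complex
    using DERIV_exp[of z] by (simp add: has_field_derivative_def)
  show ?thesis
    using diff_chain_at[OF 1 2] by (simp add: character_def[abs_def] comp_def)
qed

lemma trig_has_derivative:
  "(trig S c has_derivative (\<lambda>h. trig S (\<lambda>m. c m * (\<i> * complex_of_real (freq m \<bullet> h))) x)) (at x)"
proof -
  have "((\<lambda>x. \<Sum>m\<in>S. c m * character m x) has_derivative
      (\<lambda>h. \<Sum>m\<in>S. c m * (character m x * (\<i> * complex_of_real (freq m \<bullet> h))))) (at x)"
    by (intro has_derivative_sum has_derivative_mult_right character_has_derivative)
  then show ?thesis by (simp add: trig_def[abs_def] mult_ac)
qed

lemma partial_trig: "partial b (trig S c) = trig S (\<lambda>m. c m * (\<i> * complex_of_real (freq m \<bullet> b)))"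
  unfolding partial_def using frechet_derivative_at[OF trig_has_derivative[of S c], symmetric] by (simp add: fun_eq_iff)

text \<open>Differentiation only multiplies the coefficients and keeps the frequencies, so
  smoothness of trigonometric polynomials follows from one computation of the first
  derivative.\<close>

lemma partials_trig: "\<exists>c'. partials bs (trig S c) = trig S c'"
proof (induction bs)
  case (Cons b bs)
  then obtain c' where "partials bs (trig S c) = trig S c'" by blast
  then have "partials (b # bs) (trig S c) = trig S (\<lambda>m. c' m * (\<i> * complex_of_real (freq m \<bullet> b)))"
    by (simp add: partials_def partial_trig)
  then show ?case by blast
qed (auto simp: partials_def)

lemma character_periodic: "character n (x + (2 * pi, 0)) = character n x" "character n (x + (0, 2 * pi)) = character n x"
proof -
  have "exp (\<i> * complex_of_real (freq n \<bullet> y + real_of_int k * (2 * pi))) = exp (\<i> * complex_of_real (freq n \<bullet> y))" for k y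
  proof -
    have "\<i> * complex_of_real (freq n \<bullet> y + real_of_int k * (2 * pi)) = \<i> * complex_of_real (freq n \<bullet> y) + of_int k * (2 * of_real pi * \<i>)"
      by (simp add: algebra_simps)
    then show ?thesis using exp_plus_2pin[of "\<i> * complex_of_real (freq n \<bullet> y)" k] by (simp add: mult_ac)
  qed
  then show "character n (x + (2 * pi, 0)) = character n x" "character n (x + (0, 2 * pi)) = character n x"
    by (simp_all add: character_def freq_def inner_add_right)
qed

lemma trig_test_function: "trig S c \<in> test_functions"
proof -
  have "partials bs (trig S c) differentiable (at x)" for bs x
  proof -
    obtain c' where "partials bs (trig S c) = trig S c'" using partials_trig by blast
    then show ?thesis by (simp add: differentiableI[OF trig_has_derivative])
  qed
  then show ?thesis
    by (simp add: test_functions_def smooth_def trig_def character_periodic)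
qed

lemma character_eq_trig: "character n = trig {n} (\<lambda>_. 1)"
  by (simp add: trig_def fun_eq_iff)

lemma character_test_function: "character n \<in> test_functions"
  unfolding character_eq_trig by (rule trig_test_function)

lemma distribution_trig:
  assumes T: "T \<in> distributions" and "finite S"
  shows "T (trig S c) = (\<Sum>m\<in>S. c m * T (character m))"
  using \<open>finite S\<close>
proof induction
  have lin: "T (\<lambda>x. a * \<phi> x + b * \<psi> x) = a * T \<phi> + b * T \<psi>" if "\<phi> \<in> test_functions" "\<psi> \<in> test_functions" for \<phi> \<psi> a b
    using T that by (simp add: distributions_def)
  {
    case empty
    \<comment> \<open>Linearity is available only for combinations of two test functions, so the
      zero function is written as one with zero coefficients.\<close>
    have "T (\<lambda>x. 0 * character 0 x + 0 * character 0 x) = 0"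
      using lin[OF character_test_function character_test_function, of 0 0 0 0] by simp
    then show ?case by (simp add: trig_def[abs_def])
  next
    case (insert m S)
    have "trig (insert m S) c = (\<lambda>x. c m * character m x + 1 * trig S c x)"
      using insert by (simp add: trig_def fun_eq_iff)
    then have "T (trig (insert m S) c) = c m * T (character m) + 1 * T (trig S c)"
      by (simp only: lin[OF character_test_function trig_test_function])
    then show ?case using insert by simp
  }
qed

section \<open>Orthogonality of the characters\<close>

lemma integral_circle_exp:
  "has_bochner_integral lborel (\<lambda>x. indicator {0..2 * pi} x *\<^sub>R exp (\<i> * complex_of_real (real_of_int k * x)))
     (if k = 0 then complex_of_real (2 * pi) else 0)"
proof (cases "k = 0")
  case True
  have "has_bochner_integral lborel (\<lambda>x. indicator {0..2 * pi} x *\<^sub>R (1::complex)) (complex_of_real (2 * pi) - complex_of_real 0)"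
    by (rule has_bochner_integral_FTC_Icc) (auto intro!: derivative_eq_intros has_vector_derivative_of_real continuous_intros)
  then show ?thesis using True by simp
next
  case False
  have ii: "\<i> * (z * \<i>) = - z" for z by (simp add: mult.left_commute[of \<i> z])
  define F where "F x = exp (\<i> * complex_of_real (real_of_int k * x)) / (\<i> * of_int k)" for x
  have "(F has_vector_derivative exp (\<i> * complex_of_real (real_of_int k * x))) (at x within {0..2 * pi})" for x
  proof -
    have "((\<lambda>z. exp (\<i> * (of_int k * z)) / (\<i> * of_int k)) has_field_derivative
        exp (\<i> * (of_int k * complex_of_real x)) * (\<i> * of_int k) / (\<i> * of_int k)) (at (complex_of_real x))"
      by (auto intro!: derivative_eq_intros simp: ii)
    also have "exp (\<i> * (of_int k * complex_of_real x)) * (\<i> * of_int k) / (\<i> * of_int k) = exp (\<i> * (of_int k * complex_of_real x))"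
      using False by simp
    finally have "((\<lambda>z. exp (\<i> * (of_int k * z)) / (\<i> * of_int k)) has_field_derivative
        exp (\<i> * (of_int k * complex_of_real x))) (at (complex_of_real x))" .
    from has_vector_derivative_real_field[OF this] show ?thesis
      by (simp add: F_def[abs_def])
  qed
  then have "has_bochner_integral lborel (\<lambda>x. indicator {0..2 * pi} x *\<^sub>R exp (\<i> * complex_of_real (real_of_int k * x))) (F (2 * pi) - F 0)"
    by (intro has_bochner_integral_FTC_Icc) (auto intro!: continuous_intros)
  moreover have "exp (\<i> * complex_of_real (real_of_int k * (2 * pi))) = 1"
    using exp_plus_2pin[of 0 k] by (simp add: mult_ac)
  then have "F (2 * pi) = F 0" by (simp add: F_def)
  ultimately show ?thesis using False by simp
qed

lemma emeasure_fundamental_domain: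
  "emeasure (lborel :: plane measure) ({0..2 * pi} \<times> {0..2 * pi}) = ennreal ((2 * pi)\<^sup>2)"
proof -
  have "emeasure (lborel :: plane measure) ({0..2 * pi} \<times> {0..2 * pi}) = emeasure lborel {0..2 * pi} * emeasure lborel {0..2 * pi}"
    unfolding lborel_prod[symmetric] by (rule lborel.emeasure_pair_measure_Times) auto
  also have "\<dots> = ennreal ((2 * pi)\<^sup>2)" by (simp add: power2_eq_square ennreal_mult[symmetric])
  finally show ?thesis .
qed

lemma torus_eq: "torus = density lborel (\<lambda>x. ennreal (indicator ({0..2 * pi} \<times> {0..2 * pi}) x / (2 * pi)\<^sup>2))"
  unfolding torus_def uniform_measure_def emeasure_fundamental_domain
  by (intro arg_cong[where f="density lborel"] ext) (auto simp: divide_ennreal[symmetric] split: split_indicator)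

interpretation torus: prob_space torus
  unfolding torus_def by (rule prob_space_uniform_measure) (simp_all add: emeasure_fundamental_domain)

lemma sets_torus [measurable_cong, simp]: "sets torus = sets borel"
  by (simp add: torus_def)

lemma character_measurable [measurable]: "character n \<in> borel_measurable borel"
  unfolding character_def by (intro borel_measurable_continuous_onI continuous_intros)

lemma character_integrable: "integrable torus (character n)"
  by (rule torus.integrable_const_bound[where B=1]) (auto simp: character_def cong: measurable_cong_sets)

lemma integral_character: "(\<integral>x. character n x \<partial>torus) = (if n = 0 then 1 else 0)"
proof -
  let ?B = "{0..2 * pi} \<times> {0..2 * pi}"
  define G where "G k x = indicator {0..2 * pi} x *\<^sub>R exp (\<i> * complex_of_real (real_of_int k * x))" for k x
  have GI: "(\<integral>x. G k x \<partial>lborel) = (if k = 0 then complex_of_real (2 * pi) else 0)" for k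
    unfolding G_def using integral_circle_exp by (rule has_bochner_integral_integral_eq)
  have split: "indicator ?B (x, y) *\<^sub>R character n (x, y) = G (fst n) x * G (snd n) y" for x y
  proof -
    have "character n (x, y) = exp (\<i> * complex_of_real (real_of_int (fst n) * x)) * exp (\<i> * complex_of_real (real_of_int (snd n) * y))"
      by (simp add: character_def freq_def exp_add distrib_left)
    then show ?thesis by (simp only: G_def indicator_times fst_conv snd_conv mult_scaleR_left mult_scaleR_right scaleR_scaleR mult.commute)
  qed
  have "integrable lborel (\<lambda>z. indicator ?B z *\<^sub>R character n z)"
    by (rule borel_integrable_compact) (auto intro!: compact_Times continuous_intros simp: character_def)
  then have int: "integrable (lborel \<Otimes>\<^sub>M lborel) (\<lambda>(x, y). G (fst n) x * G (snd n) y)"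
    unfolding lborel_prod by (simp add: split[symmetric] case_prod_beta')
  have [measurable]: "?B \<in> sets (borel :: plane measure)" by (intro borel_closed closed_Times closed_atLeastAtMost)
  have "(\<integral>x. character n x \<partial>torus) = (\<integral>z. (indicator ?B z / (2 * pi)\<^sup>2) *\<^sub>R character n z \<partial>lborel)"
    unfolding torus_eq by (rule integral_density) auto
  also have "\<dots> = (\<integral>z. (1 / (2 * pi)\<^sup>2) *\<^sub>R (indicator ?B z *\<^sub>R character n z) \<partial>lborel)"
    by (intro Bochner_Integration.integral_cong refl) simp
  also have "\<dots> = (1 / (2 * pi)\<^sup>2) *\<^sub>R (\<integral>z. indicator ?B z *\<^sub>R character n z \<partial>lborel)"
    by (rule integral_scaleR_right)
  also have "(\<integral>z. indicator ?B z *\<^sub>R character n z \<partial>lborel) = (\<integral>z. (case z of (x, y) \<Rightarrow> G (fst n) x * G (snd n) y) \<partial>(lborel \<Otimes>\<^sub>M lborel))"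
    unfolding lborel_prod by (intro Bochner_Integration.integral_cong refl) (simp add: split[symmetric] case_prod_beta')
  also have "\<dots> = (\<integral>x. \<integral>y. G (fst n) x * G (snd n) y \<partial>lborel \<partial>lborel)"
    using lborel_pair.integral_fst'[OF int] by simp
  also have "\<dots> = (if fst n = 0 then complex_of_real (2 * pi) else 0) * (if snd n = 0 then complex_of_real (2 * pi) else 0)"
    by (simp add: GI)
  finally show ?thesis
    by (auto simp: prod_eq_iff power2_eq_square scaleR_conv_of_real)
qed

lemma integral_trig: "finite S \<Longrightarrow> (\<integral>x. trig S c x \<partial>torus) = (if 0 \<in> S then c 0 else 0)"
proof -
  assume "finite S"
  have "(\<integral>x. trig S c x \<partial>torus) = (\<Sum>m\<in>S. c m * (\<integral>x. character m x \<partial>torus))"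
    unfolding trig_def by (subst Bochner_Integration.integral_sum) (auto intro: character_integrable)
  also have "\<dots> = (\<Sum>m\<in>S. if m = 0 then c m else 0)"
    by (intro sum.cong) (auto simp: integral_character)
  finally show ?thesis using \<open>finite S\<close> by (simp add: sum.delta)
qed

text \<open>Tested against \<open>character (- n)\<close>, the partial sums are constant as soon as
  the frequency ball contains \<open>n\<close>, by orthogonality.\<close>

lemma fourier_coeff_of_series:
  assumes "is_fourier_series c T"
  shows "fourier_coeff T n = c n"
proof -
  have "(\<lambda>N. \<Sum>k\<in>modes_upto N. c k * (\<integral>x. character k x * character (- n) x \<partial>torus)) \<longlonglongrightarrow> T (character (- n))"
    using assms character_test_function by (auto simp: is_fourier_series_def)
  also have "(\<lambda>N. \<Sum>k\<in>modes_upto N. c k * (\<integral>x. character k x * character (- n) x \<partial>torus)) = (\<lambda>N. if n \<in> modes_upto N then c n else 0)"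
  proof
    fix N
    have "c k * (\<integral>x. character k x * character (- n) x \<partial>torus) = (if k = n then c k else 0)" for k
      by (simp add: character_mult integral_character)
    then show "(\<Sum>k\<in>modes_upto N. c k * (\<integral>x. character k x * character (- n) x \<partial>torus)) = (if n \<in> modes_upto N then c n else 0)"
      by (simp add: sum.delta)
  qed
  finally have lim: "(\<lambda>N. if n \<in> modes_upto N then c n else 0) \<longlonglongrightarrow> T (character (- n))" .
  obtain N0 where "norm (freq n) \<le> real N0" using real_arch_simple by blast
  then have "\<forall>N\<ge>N0. n \<in> modes_upto N" by (auto simp: modes_upto_def)
  then have "eventually (\<lambda>N. (if n \<in> modes_upto N then c n else 0) = c n) sequentially"
    unfolding eventually_sequentially by auto
  then have "(\<lambda>N. if n \<in> modes_upto N then c n else 0) \<longlonglongrightarrow> c n" by (rule tendsto_eventually)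
  with lim show ?thesis unfolding fourier_coeff_def by (rule LIMSEQ_unique)
qed

text \<open>Substitution of \<open>m = a - b\<close> in the double sum. The differences lie in the
  ball of radius \<open>2 * N\<close>, over which the outer sum can therefore be taken for every
  \<open>a\<close>.\<close>

lemma cmod_trig_sq:
  "complex_of_real ((cmod (trig (modes_upto N) v x))\<^sup>2) = trig (modes_upto (N + N)) (corr_N N v) x"
proof -
  let ?A = "modes_upto N" and ?D = "modes_upto (N + N)"
  have "complex_of_real ((cmod (trig ?A v x))\<^sup>2) = trig ?A v x * cnj (trig ?A v x)"
    by (rule complex_norm_square)
  also have "\<dots> = (\<Sum>a\<in>?A. \<Sum>b\<in>?A. v a * cnj (v b) * character (a - b) x)"
  proof -
    have "v a * character a x * (cnj (v b) * character (- b) x) = v a * cnj (v b) * character (a - b) x" for a b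
      using character_mult[of a x "- b"] by (simp add: mult_ac)
    then show ?thesis by (simp only: trig_def cnj_sum complex_cnj_mult cnj_character sum_product)
  qed
  also have "\<dots> = (\<Sum>a\<in>?A. \<Sum>m\<in>?D. if a - m \<in> ?A then v a * cnj (v (a - m)) * character m x else 0)"
  proof (rule sum.cong[OF refl])
    fix a assume a: "a \<in> ?A"
    have "(\<Sum>b\<in>?A. v a * cnj (v b) * character (a - b) x) = (\<Sum>m\<in>(\<lambda>b. a - b) ` ?A. v a * cnj (v (a - m)) * character m x)"
      by (subst sum.reindex) (auto simp: inj_on_def)
    also have "(\<lambda>b. a - b) ` ?A = {m \<in> ?D. a - m \<in> ?A}"
    proof (intro equalityI subsetI)
      fix m assume "m \<in> {m \<in> ?D. a - m \<in> ?A}"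
      then show "m \<in> (\<lambda>b. a - b) ` ?A" by (intro image_eqI[of _ _ "a - m"]) auto
    next
      fix m assume "m \<in> (\<lambda>b. a - b) ` ?A"
      then obtain b where "b \<in> ?A" "m = a - b" by blast
      then show "m \<in> {m \<in> ?D. a - m \<in> ?A}" using diff_in_modes_upto[OF a, of b N] by simp
    qed
    finally show "(\<Sum>b\<in>?A. v a * cnj (v b) * character (a - b) x) = (\<Sum>m\<in>?D. if a - m \<in> ?A then v a * cnj (v (a - m)) * character m x else 0)"
      by (simp add: sum.inter_filter)
  qed
  also have "\<dots> = (\<Sum>m\<in>?D. \<Sum>a\<in>?A. if a - m \<in> ?A then v a * cnj (v (a - m)) * character m x else 0)"
    by (rule sum.swap)
  also have "\<dots> = trig ?D (corr_N N v) x"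
    unfolding trig_def corr_def sum_distrib_right by (intro sum.cong refl) auto
  finally show ?thesis .
qed

section \<open>The Wick mass and the interaction in Fourier coefficients\<close>

lemma corr_0: "corr A v 0 = of_real (mass A v)"
  unfolding corr_def mass_def of_real_sum complex_norm_square by simp

lemma corr_uminus:
  assumes "finite A"
  shows "corr A v (- m) = cnj (corr A v m)"
proof -
  have "corr A v (- m) = (\<Sum>a\<in>{a\<in>A. a + m \<in> A}. v a * cnj (v (a + m)))"
    unfolding corr_def using assms by (simp add: sum.inter_filter cong: if_cong)
  also have "\<dots> = (\<Sum>a\<in>(\<lambda>a. a + m) ` {a\<in>A. a + m \<in> A}. v (a - m) * cnj (v a))"
    by (subst sum.reindex) (auto simp: inj_on_def)
  also have "(\<lambda>a. a + m) ` {a\<in>A. a + m \<in> A} = {a\<in>A. a - m \<in> A}"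
  proof (intro equalityI subsetI)
    fix a assume "a \<in> {a\<in>A. a - m \<in> A}"
    then show "a \<in> (\<lambda>a. a + m) ` {a\<in>A. a + m \<in> A}" by (intro image_eqI[of _ _ "a - m"]) auto
  qed auto
  also have "(\<Sum>a\<in>{a\<in>A. a - m \<in> A}. v (a - m) * cnj (v a)) = cnj (corr A v m)"
    unfolding corr_def using assms by (auto simp: sum.inter_filter mult.commute intro!: sum.cong)
  finally show ?thesis .
qed

lemma trunc_eq_trig: "trunc N u = trig (modes_upto N) (fourier_coeff u)"
  by (simp add: trunc_def trig_def fun_eq_iff)

lemma wick_square_eq_trig:
  "complex_of_real (wick_square N u x)
     = trig (modes_upto (N + N)) (\<lambda>m. corr_N N (fourier_coeff u) m - (if m = 0 then of_real (sigma_N N) else 0)) x"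
proof -
  have "trig (modes_upto (N + N)) (\<lambda>m. corr_N N (fourier_coeff u) m - (if m = 0 then of_real (sigma_N N) else 0)) x
      = trig (modes_upto (N + N)) (corr_N N (fourier_coeff u)) x - of_real (sigma_N N)"
  proof -
    have "(\<Sum>m\<in>modes_upto (N + N). (if m = 0 then of_real (sigma_N N) else 0) * character m x)
        = (\<Sum>m\<in>modes_upto (N + N). if m = 0 then complex_of_real (sigma_N N) else 0)"
      by (intro sum.cong) auto
    then show ?thesis by (simp add: trig_def left_diff_distrib sum_subtractf sum.delta)
  qed
  then show ?thesis
    unfolding wick_square_def trunc_eq_trig of_real_diff cmod_trig_sq by simp
qed

lemma wick_mass_eq: "wick_mass N u = mass (modes_upto N) (fourier_coeff u) - sigma_N N"
proof -
  have "complex_of_real (wick_mass N u) = (\<integral>x. complex_of_real (wick_square N u x) \<partial>torus)"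
    by (simp add: wick_mass_def)
  also have "\<dots> = of_real (mass (modes_upto N) (fourier_coeff u) - sigma_N N)"
    unfolding wick_square_eq_trig by (subst integral_trig) (simp_all add: corr_0)
  finally show ?thesis by (simp only: of_real_eq_iff)
qed

definition half_upto :: "nat \<Rightarrow> mode set" where
  "half_upto N = half_modes \<inter> modes_upto (N + N) - {0}"

lemma finite_half_upto [simp]: "finite (half_upto N)"
  by (simp add: half_upto_def)

lemma modes_upto_uminus: "m \<in> modes_upto N \<Longrightarrow> - m \<in> modes_upto N"
  by (simp add: modes_upto_def freq_minus)

lemma modes_upto_half: "modes_upto (N + N) = insert 0 (half_upto N \<union> uminus ` half_upto N)"
proof (intro equalityI subsetI)
  fix m assume m: "m \<in> modes_upto (N + N)"
  have "m \<in> half_modes \<or> - m \<in> half_modes" by (auto simp: half_modes_def)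
  then show "m \<in> insert 0 (half_upto N \<union> uminus ` half_upto N)"
    using m modes_upto_uminus[OF m] by (auto simp: half_upto_def intro!: image_eqI[of _ _ "- m"])
next
  fix m assume "m \<in> insert 0 (half_upto N \<union> uminus ` half_upto N)"
  then consider "m = 0" | "m \<in> half_upto N" | m' where "m' \<in> half_upto N" "m = - m'" by blast
  then show "m \<in> modes_upto (N + N)"
    by cases (simp_all add: half_upto_def modes_upto_uminus)
qed

lemma half_upto_disjoint: "half_upto N \<inter> uminus ` half_upto N = {}"
  by (auto simp: half_upto_def half_modes_def zero_prod_def)

text \<open>The modes \<open>m\<close> and \<open>- m\<close> have equal real contributions, which
  cancels the factor 1/2 everywhere except at the zero mode. What remains is a form in the modes of
  \<open>half_modes\<close>, that is, in independent variables.\<close>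

lemma Q_N_eq:
  assumes w: "w \<in> real_distributions"
  shows "Q_N N u w = 1 / 2 * wick_mass N u * Re (fourier_coeff w 0)
     + (\<Sum>m\<in>half_upto N. Re (corr_N N (fourier_coeff u) m * cnj (fourier_coeff w m)))"
proof -
  let ?v = "fourier_coeff u" and ?E = "half_upto N"
  have T: "w \<in> distributions" using w by (simp add: real_distributions_def)
  have conj: "w (character (- m)) = cnj (w (character m))" for m
  proof -
    have "character (- m) = (\<lambda>x. cnj (character m x))" by (simp add: cnj_character)
    then show ?thesis using w character_test_function[of m] by (simp add: real_distributions_def)
  qed
  define t where "t m = Re ((corr_N N ?v m - (if m = 0 then of_real (sigma_N N) else 0)) * w (character m))" for m
  have "Re (w (\<lambda>x. complex_of_real (wick_square N u x))) = (\<Sum>m\<in>modes_upto (N + N). t m)"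
    unfolding wick_square_eq_trig t_def distribution_trig[OF T finite_modes_upto] Re_sum ..
  also have "\<dots> = t 0 + (\<Sum>m\<in>?E \<union> uminus ` ?E. t m)"
    unfolding modes_upto_half by (subst sum.insert) (auto simp: half_upto_def zero_prod_def)
  also have "(\<Sum>m\<in>?E \<union> uminus ` ?E. t m) = (\<Sum>m\<in>?E. t m) + (\<Sum>m\<in>uminus ` ?E. t m)"
    by (rule sum.union_disjoint) (auto simp: half_upto_disjoint)
  also have "(\<Sum>m\<in>uminus ` ?E. t m) = (\<Sum>m\<in>?E. t (- m))"
    by (subst sum.reindex) (auto simp: inj_on_def)
  also have "\<dots> = (\<Sum>m\<in>?E. t m)"
  proof (rule sum.cong[OF refl])
    fix m
    show "t (- m) = t m" by (simp add: t_def conj corr_uminus)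
  qed
  also have "(\<Sum>m\<in>?E. t m) = (\<Sum>m\<in>?E. Re (corr_N N ?v m * cnj (fourier_coeff w m)))"
  proof (rule sum.cong[OF refl])
    fix m assume "m \<in> ?E"
    then have "m \<noteq> 0" by (simp add: half_upto_def)
    then show "t m = Re (corr_N N ?v m * cnj (fourier_coeff w m))" by (simp add: t_def fourier_coeff_def conj)
  qed
  also have "t 0 = wick_mass N u * Re (fourier_coeff w 0)"
    by (simp add: t_def corr_0 wick_mass_eq fourier_coeff_def flip: of_real_diff)
  finally show ?thesis by (simp add: Q_N_def)
qed

lemma fourier_coeff_measurable [measurable]:
  "(\<lambda>u. fourier_coeff u n) \<in> borel_measurable dist_space"
  "(\<lambda>u. fourier_coeff u n) \<in> borel_measurable real_dist_space"
  unfolding fourier_coeff_def dist_space_def real_dist_space_def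
  by (intro measurable_restrict_space1 measurable_component_singleton character_test_function)+

lemma space_real_dist_space: "space real_dist_space \<subseteq> real_distributions"
  by (auto simp: real_dist_space_def space_restrict_space)

lemma wick_mass_measurable [measurable]: "wick_mass N \<in> borel_measurable dist_space"
  unfolding wick_mass_eq[abs_def] mass_def by measurable

text \<open>\<open>Q_N\<close> evaluates \<open>w\<close> at a test function that depends on
  \<open>u\<close>, so measurability is not immediate from the evaluations that generate the
  \<sigma>-algebra. By \<open>Q_N_eq\<close> it is a polynomial in finitely many Fourier
  coefficients; that formula holds for real \<open>w\<close>, hence the congruence on the
  space.\<close>

lemma Q_N_measurable [measurable]:
  "(\<lambda>(u, w, w'). Q_N N u w) \<in> borel_measurable (dist_space \<Otimes>\<^sub>M real_dist_space \<Otimes>\<^sub>M real_dist_space)" (is "_ \<in> borel_measurable ?S")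
proof -
  have c[measurable]: "(\<lambda>z. fourier_coeff (fst z) n) \<in> borel_measurable ?S" "(\<lambda>z. fourier_coeff (fst (snd z)) n) \<in> borel_measurable ?S" for n
    by measurable
  have [measurable]: "(\<lambda>z. corr_N N (fourier_coeff (fst z)) m) \<in> borel_measurable ?S" for m
    by (rule borel_measurable_corr) (rule c)
  have [measurable]: "(\<lambda>z. wick_mass N (fst z)) \<in> borel_measurable ?S" by measurable
  have "(\<lambda>z. 1 / 2 * wick_mass N (fst z) * Re (fourier_coeff (fst (snd z)) 0)
     + (\<Sum>m\<in>half_upto N. Re (corr_N N (fourier_coeff (fst z)) m * cnj (fourier_coeff (fst (snd z)) m)))) \<in> borel_measurable ?S"
    by measurable
  then show ?thesis
  proof (rule measurable_cong[THEN iffD2, rotated])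
    fix z assume "z \<in> space ?S"
    then have "fst (snd z) \<in> real_distributions" using space_real_dist_space by (auto simp: space_pair_measure)
    then show "(case z of (u, w, w') \<Rightarrow> Q_N N u w) = 1 / 2 * wick_mass N (fst z) * Re (fourier_coeff (fst (snd z)) 0)
     + (\<Sum>m\<in>half_upto N. Re (corr_N N (fourier_coeff (fst z)) m * cnj (fourier_coeff (fst (snd z)) m)))"
      by (simp add: Q_N_eq case_prod_beta')
  qed
qed

section \<open>Convergence in Lp\<close>

lemma powr_add_le:
  fixes x y p :: real
  assumes "0 \<le> p"
  shows "\<bar>x + y\<bar> powr p \<le> 2 powr p * (\<bar>x\<bar> powr p + \<bar>y\<bar> powr p)"
proof -
  have "\<bar>x + y\<bar> powr p \<le> (2 * max \<bar>x\<bar> \<bar>y\<bar>) powr p" using assms by (intro powr_mono2) auto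
  also have "\<dots> = 2 powr p * (max \<bar>x\<bar> \<bar>y\<bar>) powr p" by (rule powr_mult)
  also have "(max \<bar>x\<bar> \<bar>y\<bar>) powr p \<le> \<bar>x\<bar> powr p + \<bar>y\<bar> powr p" by (auto simp: max_def)
  finally show ?thesis by simp
qed

text \<open>Two cases, according to whether the modulus of \<open>x\<close> exceeds
  \<open>e\<close>. With \<open>e\<close> small, a small even moment yields a small moment of any
  lower real order \<open>p\<close>.\<close>

lemma powr_le_even_power:
  fixes x p :: real
  assumes "0 \<le> p" "p \<le> 2 * real q" "0 < e"
  shows "\<bar>x\<bar> powr p \<le> e powr p + e powr (p - 2 * real q) * x ^ (2 * q)"
proof (cases "\<bar>x\<bar> \<le> e")
  case True
  then have "\<bar>x\<bar> powr p \<le> e powr p" using assms by (intro powr_mono2) auto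
  moreover have "0 \<le> e powr (p - 2 * real q) * x ^ (2 * q)" by (simp add: power_mult)
  ultimately show ?thesis by linarith
next
  case False
  then have pos: "0 < \<bar>x\<bar>" using assms by linarith
  have "\<bar>x\<bar> powr p = \<bar>x\<bar> powr (p - 2 * real q) * \<bar>x\<bar> powr (2 * real q)" by (simp flip: powr_add)
  also have "\<bar>x\<bar> powr (2 * real q) = x ^ (2 * q)"
    using powr_realpow[OF pos, of "2 * q"] by (simp add: power_mult)
  also have "\<bar>x\<bar> powr (p - 2 * real q) * x ^ (2 * q) \<le> e powr (p - 2 * real q) * x ^ (2 * q)"
    using False assms by (intro mult_right_mono powr_mono2') (auto simp: power_mult)
  finally show ?thesis using powr_ge_zero[of e p] by linarith
qed

lemma ennreal_le_mult_add:
  assumes "0 \<le> c" "0 \<le> a" "0 \<le> b" "x \<le> c * (a + b)"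
  shows "ennreal x \<le> ennreal c * (ennreal a + ennreal b)"
proof -
  have "ennreal a + ennreal b = ennreal (a + b)" using assms by simp
  moreover have "ennreal c * ennreal (a + b) = ennreal (c * (a + b))" using assms by (simp add: ennreal_mult)
  ultimately show ?thesis using ennreal_leI[OF assms(4)] by (simp only:)
qed

lemma in_Lp_iff: "in_Lp M p f \<longleftrightarrow> f \<in> borel_measurable M \<and> (\<integral>\<^sup>+ x. ennreal (\<bar>f x\<bar> powr p) \<partial>M) < \<infinity>"
  unfolding in_Lp_def by (auto simp: integrable_iff_bounded)

text \<open>Convergence is expressed by extended integrals, which make sense before the limit is
  known to be integrable; that \<open>f\<close> belongs to the space is then a consequence.\<close>

lemma Lp_tendstoI:
  assumes p: "1 \<le> p" and F: "\<And>N. in_Lp M p (F N)" and [measurable]: "f \<in> borel_measurable M"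
    and conv: "\<And>e. 0 < e \<Longrightarrow> eventually (\<lambda>N. (\<integral>\<^sup>+ x. ennreal (\<bar>F N x - f x\<bar> powr p) \<partial>M) \<le> ennreal e) sequentially"
  shows "Lp_tendsto M p F f"
proof -
  have [measurable]: "F N \<in> borel_measurable M" for N using F by (simp add: in_Lp_def)
  obtain N where N: "(\<integral>\<^sup>+ x. ennreal (\<bar>F N x - f x\<bar> powr p) \<partial>M) \<le> ennreal 1"
    using conv[of 1] by (auto simp: eventually_sequentially)
  have "(\<integral>\<^sup>+ x. ennreal (\<bar>f x\<bar> powr p) \<partial>M)
     \<le> (\<integral>\<^sup>+ x. ennreal (2 powr p) * (ennreal (\<bar>F N x\<bar> powr p) + ennreal (\<bar>F N x - f x\<bar> powr p)) \<partial>M)"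
  proof (rule nn_integral_mono)
    fix x
    have "\<bar>f x\<bar> powr p \<le> 2 powr p * (\<bar>F N x\<bar> powr p + \<bar>F N x - f x\<bar> powr p)"
      using powr_add_le[of p "F N x" "f x - F N x"] p by (simp add: abs_minus_commute)
    then show "ennreal (\<bar>f x\<bar> powr p) \<le> ennreal (2 powr p) * (ennreal (\<bar>F N x\<bar> powr p) + ennreal (\<bar>F N x - f x\<bar> powr p))"
      by (intro ennreal_le_mult_add) auto
  qed
  also have "\<dots> = ennreal (2 powr p) * ((\<integral>\<^sup>+ x. ennreal (\<bar>F N x\<bar> powr p) \<partial>M) + (\<integral>\<^sup>+ x. ennreal (\<bar>F N x - f x\<bar> powr p) \<partial>M))"
    by (simp add: nn_integral_cmult nn_integral_add)
  also have "\<dots> < \<infinity>"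
  proof -
    have "(\<integral>\<^sup>+ x. ennreal (\<bar>F N x - f x\<bar> powr p) \<partial>M) < \<infinity>" using N by (rule le_less_trans) simp
    moreover have "(\<integral>\<^sup>+ x. ennreal (\<bar>F N x\<bar> powr p) \<partial>M) < \<infinity>" using F[of N] by (simp add: in_Lp_iff)
    ultimately show ?thesis by (simp add: ennreal_mult_less_top)
  qed
  finally have f: "in_Lp M p f" by (simp add: in_Lp_iff)
  have "(\<lambda>N. \<integral>x. \<bar>F N x - f x\<bar> powr p \<partial>M) \<longlonglongrightarrow> 0"
  proof (rule order_tendstoI)
    fix a :: real assume "0 < a"
    from conv[of "a / 2"] have "eventually (\<lambda>N. (\<integral>\<^sup>+ x. ennreal (\<bar>F N x - f x\<bar> powr p) \<partial>M) \<le> ennreal (a / 2)) sequentially"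
      using \<open>0 < a\<close> by simp
    then show "eventually (\<lambda>N. (\<integral>x. \<bar>F N x - f x\<bar> powr p \<partial>M) < a) sequentially"
    proof eventually_elim
      case (elim N)
      have "(\<integral>x. \<bar>F N x - f x\<bar> powr p \<partial>M) = enn2real (\<integral>\<^sup>+ x. ennreal (\<bar>F N x - f x\<bar> powr p) \<partial>M)"
        by (rule integral_eq_nn_integral) auto
      also have "\<dots> \<le> a / 2" using elim \<open>0 < a\<close> by (intro enn2real_leI) auto
      finally show ?case using \<open>0 < a\<close> by simp
    qed
  next
    fix a :: real assume "a < 0"
    have "0 \<le> (\<integral>x. \<bar>F N x - f x\<bar> powr p \<partial>M)" for N by simp
    then show "eventually (\<lambda>N. a < (\<integral>x. \<bar>F N x - f x\<bar> powr p \<partial>M)) sequentially"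
      using \<open>a < 0\<close> by (intro always_eventually allI) (rule less_le_trans)
  qed
  then have "(\<lambda>N. Lp_norm M p (\<lambda>x. F N x - f x)) \<longlonglongrightarrow> 0"
    unfolding Lp_norm_def using p by (intro tendsto_zero_powrI[where b="1 / p"]) auto
  then show ?thesis using F f by (simp add: Lp_tendsto_def)
qed

lemma Lp_tendsto_nn_integral:
  assumes p: "1 \<le> p" and L: "Lp_tendsto M p F f" and e: "0 < e"
  shows "eventually (\<lambda>N. (\<integral>\<^sup>+ x. ennreal (\<bar>F N x - f x\<bar> powr p) \<partial>M) \<le> ennreal e) sequentially"
proof -
  have F: "in_Lp M p (F N)" and f: "in_Lp M p f" for N using L by (auto simp: Lp_tendsto_def)
  have [measurable]: "F N \<in> borel_measurable M" "f \<in> borel_measurable M" for N using F f by (auto simp: in_Lp_def)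
  have int: "integrable M (\<lambda>x. \<bar>F N x - f x\<bar> powr p)" for N
  proof (rule Bochner_Integration.integrable_bound)
    show "integrable M (\<lambda>x. 2 powr p * (\<bar>F N x\<bar> powr p + \<bar>f x\<bar> powr p))"
      using F[of N] f by (auto simp: in_Lp_def)
    show "AE x in M. norm (\<bar>F N x - f x\<bar> powr p) \<le> norm (2 powr p * (\<bar>F N x\<bar> powr p + \<bar>f x\<bar> powr p))"
      using powr_add_le[of p "F N _" "- f _"] p by (intro AE_I2) simp
  qed measurable
  have "(\<lambda>N. Lp_norm M p (\<lambda>x. F N x - f x) powr p) \<longlonglongrightarrow> 0"
    using L p by (intro tendsto_zero_powrI[where b=p]) (auto simp: Lp_tendsto_def Lp_norm_def)
  moreover have "Lp_norm M p (\<lambda>x. F N x - f x) powr p = (\<integral>x. \<bar>F N x - f x\<bar> powr p \<partial>M)" for N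
    using p by (simp add: Lp_norm_def powr_powr)
  ultimately have "eventually (\<lambda>N. (\<integral>x. \<bar>F N x - f x\<bar> powr p \<partial>M) < e) sequentially"
    using e by (auto intro: order_tendstoD)
  then show ?thesis
  proof eventually_elim
    case (elim N)
    then show ?case using int by (subst nn_integral_eq_integral) (auto intro: ennreal_leI)
  qed
qed

section \<open>Limits of sequences with decaying even moments\<close>

context prob_space
begin

lemma in_Lp_of_even_moments:
  assumes [measurable]: "f \<in> borel_measurable M" and mom: "\<And>q::nat. (\<integral>\<^sup>+ x. ennreal (f x ^ (2 * q)) \<partial>M) < \<infinity>"
    and p: "1 \<le> p"
  shows "in_Lp M p f"
proof -
  obtain q :: nat where q: "p \<le> real q" using real_arch_simple by blast
  have "(\<integral>\<^sup>+ x. ennreal (\<bar>f x\<bar> powr p) \<partial>M) \<le> (\<integral>\<^sup>+ x. 1 + ennreal (f x ^ (2 * q)) \<partial>M)"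
  proof (rule nn_integral_mono)
    fix x
    have "\<bar>f x\<bar> powr p \<le> 1 + f x ^ (2 * q)" using powr_le_even_power[of p q 1 "f x"] p q by simp
    then have "ennreal (\<bar>f x\<bar> powr p) \<le> ennreal (1 + f x ^ (2 * q))" by (rule ennreal_leI)
    then show "ennreal (\<bar>f x\<bar> powr p) \<le> 1 + ennreal (f x ^ (2 * q))" by (simp add: power_mult)
  qed
  also have "\<dots> = 1 + (\<integral>\<^sup>+ x. ennreal (f x ^ (2 * q)) \<partial>M)"
    by (simp add: nn_integral_add emeasure_space_1)
  also have "\<dots> < \<infinity>" using mom[of q] by simp
  finally show ?thesis by (simp add: in_Lp_iff)
qed

text \<open>The increments are controlled only against the dyadic truncations, so two indices are
  compared through \<open>X (2 ^ k)\<close>. The limit is one explicit function for all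
  \<open>p\<close>, the pointwise limit along a fixed subsequence; this later allows the limits to
  be defined on distributions instead of sample points.\<close>

lemma Lp_limit_of_even_moments:
  assumes X[measurable]: "\<And>N. X N \<in> borel_measurable M"
    and mom: "\<And>N q::nat. (\<integral>\<^sup>+ x. ennreal (X N x ^ (2 * q)) \<partial>M) < \<infinity>"
    and inc: "\<And>N k q::nat. 1 \<le> q \<Longrightarrow> (\<integral>\<^sup>+ x. ennreal ((X N x - X (min N (2 ^ k)) x) ^ (2 * q)) \<partial>M) \<le> ennreal (b q k)"
    and b: "\<And>q. 1 \<le> q \<Longrightarrow> b q \<longlonglongrightarrow> 0"
  obtains r where "strict_mono r" "AE x in M. convergent (\<lambda>i. X (r i) x)"
    "\<And>p. 1 \<le> p \<Longrightarrow> Lp_tendsto M p X (\<lambda>x. lim (\<lambda>i. X (r i) x))"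
proof -
  have Lp: "in_Lp M p (X N)" if "1 \<le> p" for p N using mom that by (intro in_Lp_of_even_moments) auto
  have cauchy: "\<exists>n. \<forall>i\<ge>n. \<forall>j\<ge>n. (\<integral>\<^sup>+ x. ennreal (\<bar>X i x - X j x\<bar> powr p) \<partial>M) \<le> ennreal e" if p: "1 \<le> p" and e: "0 < e" for p e
  proof -
    obtain q :: nat where q: "p \<le> real q" using real_arch_simple by blast
    then have q1: "1 \<le> q" using p by linarith
    \<comment> \<open>Each comparison with \<open>X (2 ^ k)\<close> makes two errors of size
      \<open>e / (4 * 2 powr p)\<close>; two comparisons and the factor \<open>2 powr p\<close> of
      \<open>powr_add_le\<close> add up to \<open>e\<close>.\<close>
    define d where "d = (e / (4 * 2 powr p)) powr (1 / p)"
    have d: "0 < d" "d powr p = e / (4 * 2 powr p)" using e p by (auto simp: d_def powr_powr)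
    define c where "c = d powr (p - 2 * real q)"
    have c: "0 < c" using d by (simp add: c_def)
    have "(\<lambda>k. c * b q k) \<longlonglongrightarrow> c * 0" by (intro tendsto_intros b q1)
    then have "eventually (\<lambda>k. c * b q k < e / (4 * 2 powr p)) sequentially"
      using e by (intro order_tendstoD(2)) auto
    then obtain k where k: "c * b q k < e / (4 * 2 powr p)" by (auto simp: eventually_sequentially)
    let ?Y = "X (2 ^ k)"
    have near: "(\<integral>\<^sup>+ x. ennreal (\<bar>X N x - ?Y x\<bar> powr p) \<partial>M) \<le> ennreal (e / (2 * 2 powr p))" if "2 ^ k \<le> N" for N
    proof -
      have "(\<integral>\<^sup>+ x. ennreal (\<bar>X N x - ?Y x\<bar> powr p) \<partial>M)
        \<le> (\<integral>\<^sup>+ x. ennreal (d powr p) + ennreal c * ennreal ((X N x - ?Y x) ^ (2 * q)) \<partial>M)"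
      proof (rule nn_integral_mono)
        fix x
        have "\<bar>X N x - ?Y x\<bar> powr p \<le> d powr p + c * (X N x - ?Y x) ^ (2 * q)"
          unfolding c_def using p q d by (intro powr_le_even_power) auto
        moreover have "0 \<le> (X N x - ?Y x) ^ (2 * q)" by (simp add: power_mult)
        ultimately show "ennreal (\<bar>X N x - ?Y x\<bar> powr p) \<le> ennreal (d powr p) + ennreal c * ennreal ((X N x - ?Y x) ^ (2 * q))"
          using c by (simp add: ennreal_mult[symmetric] ennreal_plus[symmetric] ennreal_leI del: ennreal_plus)
      qed
      also have "\<dots> = ennreal (d powr p) + ennreal c * (\<integral>\<^sup>+ x. ennreal ((X N x - ?Y x) ^ (2 * q)) \<partial>M)"
        by (simp add: nn_integral_add nn_integral_cmult emeasure_space_1)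
      also have "\<dots> \<le> ennreal (d powr p) + ennreal c * ennreal (b q k)"
        using inc[OF q1, of N k] that by (intro add_left_mono mult_left_mono) (auto simp: min_absorb2)
      also have "\<dots> \<le> ennreal (e / (4 * 2 powr p)) + ennreal (e / (4 * 2 powr p))"
        using k c d(2) by (intro add_mono) (auto simp: ennreal_mult'[symmetric] ennreal_leI)
      also have "\<dots> = ennreal (e / (2 * 2 powr p))"
        using e by (simp add: ennreal_plus[symmetric] del: ennreal_plus)
      finally show ?thesis .
    qed
    show ?thesis
    proof (intro exI[of _ "2 ^ k"] allI impI)
      fix i j :: nat assume ij: "2 ^ k \<le> i" "2 ^ k \<le> j"
      have "(\<integral>\<^sup>+ x. ennreal (\<bar>X i x - X j x\<bar> powr p) \<partial>M)
         \<le> (\<integral>\<^sup>+ x. ennreal (2 powr p) * (ennreal (\<bar>X i x - ?Y x\<bar> powr p) + ennreal (\<bar>X j x - ?Y x\<bar> powr p)) \<partial>M)"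
      proof (rule nn_integral_mono)
        fix x
        have "\<bar>X i x - X j x\<bar> powr p \<le> 2 powr p * (\<bar>X i x - ?Y x\<bar> powr p + \<bar>X j x - ?Y x\<bar> powr p)"
          using powr_add_le[of p "X i x - ?Y x" "?Y x - X j x"] p by (simp add: abs_minus_commute)
        then show "ennreal (\<bar>X i x - X j x\<bar> powr p) \<le> ennreal (2 powr p) * (ennreal (\<bar>X i x - ?Y x\<bar> powr p) + ennreal (\<bar>X j x - ?Y x\<bar> powr p))"
          by (intro ennreal_le_mult_add) auto
      qed
      also have "\<dots> = ennreal (2 powr p) * ((\<integral>\<^sup>+ x. ennreal (\<bar>X i x - ?Y x\<bar> powr p) \<partial>M) + (\<integral>\<^sup>+ x. ennreal (\<bar>X j x - ?Y x\<bar> powr p) \<partial>M))"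
        by (simp add: nn_integral_cmult nn_integral_add)
      also have "\<dots> \<le> ennreal (2 powr p) * (ennreal (e / (2 * 2 powr p)) + ennreal (e / (2 * 2 powr p)))"
        by (intro mult_left_mono add_mono near ij) auto
      also have "\<dots> = ennreal e"
        using e by (simp add: ennreal_mult[symmetric] ennreal_plus[symmetric] del: ennreal_plus)
      finally show "(\<integral>\<^sup>+ x. ennreal (\<bar>X i x - X j x\<bar> powr p) \<partial>M) \<le> ennreal e" .
    qed
  qed
  have int1: "integrable M (X N)" for N
    using Lp[of 1 N] by (simp add: in_Lp_iff integrable_iff_bounded)
  have cauchy1: "\<exists>n. \<forall>i\<ge>n. \<forall>j\<ge>n. (\<integral>x. norm (X i x - X j x) \<partial>M) < e" if e: "0 < e" for e
  proof -
    obtain n where n: "\<And>i j. n \<le> i \<Longrightarrow> n \<le> j \<Longrightarrow> (\<integral>\<^sup>+ x. ennreal (\<bar>X i x - X j x\<bar> powr 1) \<partial>M) \<le> ennreal (e / 2)"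
      using cauchy[of 1 "e / 2"] e by auto
    have "(\<integral>x. norm (X i x - X j x) \<partial>M) < e" if "n \<le> i" "n \<le> j" for i j
    proof -
      have "(\<integral>x. norm (X i x - X j x) \<partial>M) = enn2real (\<integral>\<^sup>+ x. ennreal (norm (X i x - X j x)) \<partial>M)"
        by (rule integral_eq_nn_integral) auto
      also have "\<dots> \<le> e / 2" using n[OF that] e by (intro enn2real_leI) auto
      finally show ?thesis using e by simp
    qed
    then show ?thesis by blast
  qed
  obtain r where r: "strict_mono r" "AE x in M. Cauchy (\<lambda>i. X (r i) x)"
    by (rule cauchy_L1_AE_cauchy_subseq[of M X, OF int1 cauchy1])
  let ?f = "\<lambda>x. lim (\<lambda>i. X (r i) x)"
  have AE: "AE x in M. convergent (\<lambda>i. X (r i) x)"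
    using r(2) by eventually_elim (rule Cauchy_convergent)
  have "Lp_tendsto M p X ?f" if p: "1 \<le> p" for p
  proof (rule Lp_tendstoI[OF p Lp[OF p]])
    fix e :: real assume "0 < e"
    then obtain n where n: "\<And>i j. n \<le> i \<Longrightarrow> n \<le> j \<Longrightarrow> (\<integral>\<^sup>+ x. ennreal (\<bar>X i x - X j x\<bar> powr p) \<partial>M) \<le> ennreal e"
      using cauchy[OF p] by blast
    have "(\<integral>\<^sup>+ x. ennreal (\<bar>X N x - ?f x\<bar> powr p) \<partial>M) \<le> ennreal e" if "n \<le> N" for N
    proof -
      have "(\<integral>\<^sup>+ x. ennreal (\<bar>X N x - ?f x\<bar> powr p) \<partial>M) = (\<integral>\<^sup>+ x. liminf (\<lambda>i. ennreal (\<bar>X N x - X (r i) x\<bar> powr p)) \<partial>M)"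
      proof (rule nn_integral_cong_AE)
        show "AE x in M. ennreal (\<bar>X N x - ?f x\<bar> powr p) = liminf (\<lambda>i. ennreal (\<bar>X N x - X (r i) x\<bar> powr p))"
          using AE
        proof eventually_elim
          case (elim x)
          then have "(\<lambda>i. X (r i) x) \<longlonglongrightarrow> ?f x" by (simp add: convergent_LIMSEQ_iff)
          then have "(\<lambda>i. ennreal (\<bar>X N x - X (r i) x\<bar> powr p)) \<longlonglongrightarrow> ennreal (\<bar>X N x - ?f x\<bar> powr p)"
            using p by (intro tendsto_ennrealI tendsto_powr' tendsto_intros) auto
          then show ?case by (rule lim_imp_Liminf[OF sequentially_bot, symmetric])
        qed
      qed
      also have "\<dots> \<le> liminf (\<lambda>i. \<integral>\<^sup>+ x. ennreal (\<bar>X N x - X (r i) x\<bar> powr p) \<partial>M)"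
        by (rule nn_integral_liminf) measurable
      also have "\<dots> \<le> ennreal e"
      proof (rule Liminf_le)
        have "(\<integral>\<^sup>+ x. ennreal (\<bar>X N x - X (r i) x\<bar> powr p) \<partial>M) \<le> ennreal e" if "n \<le> i" for i
          using seq_suble[OF r(1), of i] that by (intro n \<open>n \<le> N\<close>) simp
        then show "eventually (\<lambda>i. (\<integral>\<^sup>+ x. ennreal (\<bar>X N x - X (r i) x\<bar> powr p) \<partial>M) \<le> ennreal e) sequentially"
          by (auto simp: eventually_sequentially)
      qed simp
      finally show ?thesis .
    qed
    then show "eventually (\<lambda>N. (\<integral>\<^sup>+ x. ennreal (\<bar>X N x - ?f x\<bar> powr p) \<partial>M) \<le> ennreal e) sequentially"
      by (auto simp: eventually_sequentially)
  qed measurable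
  with r(1) AE show thesis by (rule that)
qed

end

section \<open>Convergence of the weights and of the Gibbs densities\<close>

context prob_space
begin

text \<open>Bounded second moments give uniform integrability: dominated convergence handles the
  truncation at \<open>R\<close>, and where \<open>f\<close> exceeds \<open>R\<close> it is at most
  \<open>f\<^sup>2 / R\<close>.\<close>

lemma nn_integral_small_of_bounded_square:
  fixes f :: "nat \<Rightarrow> 'a \<Rightarrow> real"
  assumes [measurable]: "\<And>n. f n \<in> borel_measurable M" and f0: "\<And>n x. 0 \<le> f n x"
    and AE: "AE x in M. (\<lambda>n. f n x) \<longlonglongrightarrow> 0"
    and sq: "\<And>n. (\<integral>\<^sup>+ x. ennreal ((f n x)\<^sup>2) \<partial>M) \<le> ennreal B" and e: "0 < e"
  shows "eventually (\<lambda>n. (\<integral>\<^sup>+ x. ennreal (f n x) \<partial>M) \<le> ennreal e) sequentially"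
proof -
  define R where "R = 2 * \<bar>B\<bar> / e + 1"
  have R: "0 < R" "\<bar>B\<bar> / R \<le> e / 2" using e by (auto simp: R_def field_simps add_pos_nonneg)
  have "(\<lambda>n. \<integral>\<^sup>+ x. norm (0 - min (f n x) R) \<partial>M) \<longlonglongrightarrow> 0"
  proof (rule nn_integral_dominated_convergence_norm[where w="\<lambda>_. R"])
    show "AE x in M. norm (min (f j x) R) \<le> R" for j using f0 R by (intro AE_I2) auto
    show "(\<integral>\<^sup>+ x. ennreal R \<partial>M) < \<infinity>" by (simp add: emeasure_space_1)
    show "AE x in M. (\<lambda>i. min (f i x) R) \<longlonglongrightarrow> 0"
      using AE
    proof eventually_elim
      case (elim x)
      then have "(\<lambda>i. min (f i x) R) \<longlonglongrightarrow> min 0 R" by (intro tendsto_min tendsto_const)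
      then show ?case using R by simp
    qed
  qed measurable
  then have "eventually (\<lambda>n. (\<integral>\<^sup>+ x. norm (0 - min (f n x) R) \<partial>M) < ennreal (e / 2)) sequentially"
    using e by (intro order_tendstoD(2)) auto
  then show ?thesis
  proof eventually_elim
    case (elim n)
    have "(\<integral>\<^sup>+ x. ennreal (f n x) \<partial>M) \<le> (\<integral>\<^sup>+ x. ennreal (norm (0 - min (f n x) R)) + ennreal (1 / R) * ennreal ((f n x)\<^sup>2) \<partial>M)"
    proof (rule nn_integral_mono)
      fix x
      have "f n x \<le> norm (0 - min (f n x) R) + 1 / R * (f n x)\<^sup>2"
      proof (cases "f n x \<le> R")
        case True then show ?thesis using f0[of n x] R by (simp add: min_absorb1)
      next
        case False
        then have "f n x * R \<le> f n x * f n x" using f0[of n x] by (intro mult_left_mono) auto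
        then have "f n x \<le> 1 / R * (f n x)\<^sup>2" using R by (simp add: power2_eq_square field_simps)
        then show ?thesis by (simp add: add_increasing)
      qed
      then have "ennreal (f n x) \<le> ennreal (norm (0 - min (f n x) R) + 1 / R * (f n x)\<^sup>2)" by (rule ennreal_leI)
      also have "\<dots> = ennreal (norm (0 - min (f n x) R)) + ennreal (1 / R * (f n x)\<^sup>2)"
        using R by (intro ennreal_plus) auto
      also have "ennreal (1 / R * (f n x)\<^sup>2) = ennreal (1 / R) * ennreal ((f n x)\<^sup>2)"
        using R by (intro ennreal_mult) auto
      finally show "ennreal (f n x) \<le> ennreal (norm (0 - min (f n x) R)) + ennreal (1 / R) * ennreal ((f n x)\<^sup>2)" .
    qed
    also have "\<dots> = (\<integral>\<^sup>+ x. ennreal (norm (0 - min (f n x) R)) \<partial>M) + (\<integral>\<^sup>+ x. ennreal (1 / R) * ennreal ((f n x)\<^sup>2) \<partial>M)"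
      by (rule nn_integral_add) measurable
    also have "(\<integral>\<^sup>+ x. ennreal (1 / R) * ennreal ((f n x)\<^sup>2) \<partial>M) = ennreal (1 / R) * (\<integral>\<^sup>+ x. ennreal ((f n x)\<^sup>2) \<partial>M)"
      by (rule nn_integral_cmult) measurable
    also have "(\<integral>\<^sup>+ x. ennreal (norm (0 - min (f n x) R)) \<partial>M) + ennreal (1 / R) * (\<integral>\<^sup>+ x. ennreal ((f n x)\<^sup>2) \<partial>M)
        \<le> ennreal (e / 2) + ennreal (1 / R) * ennreal \<bar>B\<bar>"
    proof (rule add_mono)
      show "(\<integral>\<^sup>+ x. ennreal (norm (0 - min (f n x) R)) \<partial>M) \<le> ennreal (e / 2)" using elim by simp
      have "ennreal B \<le> ennreal \<bar>B\<bar>" by (intro ennreal_leI) simp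
      with sq[of n] have "(\<integral>\<^sup>+ x. ennreal ((f n x)\<^sup>2) \<partial>M) \<le> ennreal \<bar>B\<bar>" by (rule order.trans)
      then show "ennreal (1 / R) * (\<integral>\<^sup>+ x. ennreal ((f n x)\<^sup>2) \<partial>M) \<le> ennreal (1 / R) * ennreal \<bar>B\<bar>"
        by (rule mult_left_mono) simp
    qed
    also have "ennreal (1 / R) * ennreal \<bar>B\<bar> = ennreal (\<bar>B\<bar> / R)"
      using R by (subst ennreal_mult[symmetric]) auto
    also have "ennreal (e / 2) + ennreal (\<bar>B\<bar> / R) = ennreal (e / 2 + \<bar>B\<bar> / R)"
      using e R by (intro ennreal_plus[symmetric]) auto
    also have "\<dots> \<le> ennreal e" using R(2) by (intro ennreal_leI) linarith
    finally show ?case .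
  qed
qed

lemma Lp_tendsto_AE_subseq:
  assumes L: "Lp_tendsto M 1 F f" and s: "strict_mono (s :: nat \<Rightarrow> nat)"
  obtains r where "strict_mono r" "AE x in M. (\<lambda>i. F (s (r i)) x) \<longlonglongrightarrow> f x"
proof -
  have F: "in_Lp M 1 (F N)" and f: "in_Lp M 1 f" for N using L by (auto simp: Lp_tendsto_def)
  have m[measurable]: "F N \<in> borel_measurable M" "f \<in> borel_measurable M" for N using F f by (auto simp: in_Lp_def)
  have iF: "integrable M (F N)" and int_f: "integrable M f" for N
    using F[of N] f by (simp_all add: in_Lp_iff integrable_iff_bounded)
  have "(\<lambda>N. \<integral>x. norm (F N x - f x) \<partial>M) \<longlonglongrightarrow> 0"
    using L by (simp add: Lp_tendsto_def Lp_norm_def)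
  then have lim: "(\<lambda>n. \<integral>x. norm (F (s n) x - f x) \<partial>M) \<longlonglongrightarrow> 0"
    using LIMSEQ_subseq_LIMSEQ[OF _ s] by (simp add: comp_def)
  have int: "integrable M (\<lambda>x. F (s n) x - f x)" for n using iF int_f by simp
  obtain r where r: "strict_mono r" "AE x in M. (\<lambda>n. F (s (r n)) x - f x) \<longlonglongrightarrow> 0"
    using tendsto_L1_AE_subseq[OF int lim] by blast
  have "AE x in M. (\<lambda>i. F (s (r i)) x) \<longlonglongrightarrow> f x"
    using r(2) by eventually_elim (simp add: LIM_zero_iff)
  with r(1) show thesis by (rule that)
qed

text \<open>The weight \<open>cutoff_weight\<close>, pulled back to the probability space.\<close>

definition cut_exp :: "real \<Rightarrow> ('a \<Rightarrow> real) \<Rightarrow> ('a \<Rightarrow> real) \<Rightarrow> 'a \<Rightarrow> real" where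
  "cut_exp K X Y x = indicator {x. \<bar>X x\<bar> \<le> K} x * exp (- Y x)"

lemma cut_exp_measurable [measurable]:
  "X \<in> borel_measurable M \<Longrightarrow> Y \<in> borel_measurable M \<Longrightarrow> cut_exp K X Y \<in> borel_measurable M"
proof -
  assume [measurable]: "X \<in> borel_measurable M" "Y \<in> borel_measurable M"
  have "(\<lambda>x. (if \<bar>X x\<bar> \<le> K then 1 else 0) * exp (- Y x)) \<in> borel_measurable M" by measurable
  then show ?thesis by (simp add: cut_exp_def[abs_def] indicator_def of_bool_def)
qed

text \<open>The cutoff jumps only where the modulus of the limit equals \<open>K\<close>; elsewhere
  the indicator is eventually constant.\<close>

lemma tendsto_cut_exp:
  assumes X: "(\<lambda>i. X i x) \<longlonglongrightarrow> X' x" and Y: "(\<lambda>i. Y i x) \<longlonglongrightarrow> Y' x" and ne: "\<bar>X' x\<bar> \<noteq> K"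
  shows "(\<lambda>i. cut_exp K (X i) (Y i) x) \<longlonglongrightarrow> cut_exp K X' Y' x"
proof -
  have aX: "(\<lambda>i. \<bar>X i x\<bar>) \<longlonglongrightarrow> \<bar>X' x\<bar>" by (intro tendsto_intros X)
  have "eventually (\<lambda>i. (\<bar>X i x\<bar> \<le> K) = (\<bar>X' x\<bar> \<le> K)) sequentially"
  proof (cases "\<bar>X' x\<bar> < K")
    case True
    then show ?thesis using order_tendstoD(2)[OF aX True] by (auto elim!: eventually_mono)
  next
    case False
    then have "K < \<bar>X' x\<bar>" using ne by simp
    then show ?thesis using order_tendstoD(1)[OF aX \<open>K < \<bar>X' x\<bar>\<close>] by (auto elim!: eventually_mono)
  qed
  then have "eventually (\<lambda>i. cut_exp K (X i) (Y i) x = indicator {x. \<bar>X' x\<bar> \<le> K} x * exp (- Y i x)) sequentially"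
    by eventually_elim (simp add: cut_exp_def indicator_def)
  moreover have "(\<lambda>i. indicator {x. \<bar>X' x\<bar> \<le> K} x * exp (- Y i x)) \<longlonglongrightarrow> cut_exp K X' Y' x"
    unfolding cut_exp_def by (intro tendsto_intros Y)
  ultimately show ?thesis by (simp add: tendsto_cong)
qed

text \<open>Moments of order \<open>2 * p\<close> are bounded, so almost sure convergence improves
  to convergence of order \<open>p\<close>. Almost sure convergence is available only along
  subsequences, hence the indirect argument: a subsequence staying away from the limit would have a
  further one that converges to it.\<close>

lemma Lp_tendsto_cut_exp:
  assumes LX: "Lp_tendsto M 1 X X'" and LY: "Lp_tendsto M 1 Y Y'"
    and null: "AE x in M. \<bar>X' x\<bar> \<noteq> K"
    and bound: "\<And>p. 1 \<le> p \<Longrightarrow> \<exists>B. \<forall>N. (\<integral>\<^sup>+ x. ennreal (\<bar>cut_exp K (X N) (Y N) x\<bar> powr p) \<partial>M) \<le> ennreal B"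
    and p: "1 \<le> p"
  shows "Lp_tendsto M p (\<lambda>N. cut_exp K (X N) (Y N)) (cut_exp K X' Y')"
proof -
  let ?W = "\<lambda>N. cut_exp K (X N) (Y N)" and ?W' = "cut_exp K X' Y'"
  have [measurable]: "X N \<in> borel_measurable M" "X' \<in> borel_measurable M" "Y N \<in> borel_measurable M" "Y' \<in> borel_measurable M" for N
    using LX LY by (auto simp: Lp_tendsto_def in_Lp_def)
  have p2: "1 \<le> 2 * p" using p by simp
  obtain B where B: "\<And>N. (\<integral>\<^sup>+ x. ennreal (\<bar>?W N x\<bar> powr (2 * p)) \<partial>M) \<le> ennreal B"
    using bound[OF p2] by blast
  have sub: "\<exists>r. strict_mono r \<and> (AE x in M. (\<lambda>i. ?W (s (r i)) x) \<longlonglongrightarrow> ?W' x)" if s: "strict_mono s" for s :: "nat \<Rightarrow> nat"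
  proof -
    obtain r1 where r1: "strict_mono r1" "AE x in M. (\<lambda>i. X (s (r1 i)) x) \<longlonglongrightarrow> X' x"
      by (rule Lp_tendsto_AE_subseq[OF LX s])
    have s1: "strict_mono (s \<circ> r1)" by (intro strict_mono_o s r1)
    obtain r2 where r2: "strict_mono r2" "AE x in M. (\<lambda>i. Y ((s \<circ> r1) (r2 i)) x) \<longlonglongrightarrow> Y' x"
      by (rule Lp_tendsto_AE_subseq[OF LY s1])
    have "AE x in M. (\<lambda>i. ?W (s (r1 (r2 i))) x) \<longlonglongrightarrow> ?W' x"
      using r1(2) r2(2) null
    proof eventually_elim
      case (elim x)
      have "(\<lambda>i. X (s (r1 (r2 i))) x) \<longlonglongrightarrow> X' x"
        using LIMSEQ_subseq_LIMSEQ[OF elim(1) r2(1)] by (simp add: comp_def)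
      with elim show ?case by (intro tendsto_cut_exp) (auto simp: comp_def)
    qed
    then show ?thesis using strict_mono_o[OF r1(1) r2(1)] by (intro exI[of _ "r1 \<circ> r2"]) (simp add: comp_def)
  qed
  have W'B: "(\<integral>\<^sup>+ x. ennreal (\<bar>?W' x\<bar> powr (2 * p)) \<partial>M) \<le> ennreal B"
  proof -
    obtain r where r: "AE x in M. (\<lambda>i. ?W (r i) x) \<longlonglongrightarrow> ?W' x"
      using sub[of id] by (auto simp: strict_mono_id)
    have "(\<integral>\<^sup>+ x. ennreal (\<bar>?W' x\<bar> powr (2 * p)) \<partial>M) = (\<integral>\<^sup>+ x. liminf (\<lambda>i. ennreal (\<bar>?W (r i) x\<bar> powr (2 * p))) \<partial>M)"
    proof (rule nn_integral_cong_AE)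
      show "AE x in M. ennreal (\<bar>?W' x\<bar> powr (2 * p)) = liminf (\<lambda>i. ennreal (\<bar>?W (r i) x\<bar> powr (2 * p)))"
        using r
      proof eventually_elim
        case (elim x)
        then have "(\<lambda>i. ennreal (\<bar>?W (r i) x\<bar> powr (2 * p))) \<longlonglongrightarrow> ennreal (\<bar>?W' x\<bar> powr (2 * p))"
          using p by (intro tendsto_ennrealI tendsto_powr' tendsto_intros) auto
        then show ?case by (rule lim_imp_Liminf[OF sequentially_bot, symmetric])
      qed
    qed
    also have "\<dots> \<le> liminf (\<lambda>i. \<integral>\<^sup>+ x. ennreal (\<bar>?W (r i) x\<bar> powr (2 * p)) \<partial>M)"
      by (rule nn_integral_liminf) measurable
    also have "\<dots> \<le> ennreal B" by (rule Liminf_le[OF sequentially_bot]) (intro always_eventually allI B)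
    finally show ?thesis .
  qed
  have sq: "(\<integral>\<^sup>+ x. ennreal ((\<bar>?W N x - ?W' x\<bar> powr p)\<^sup>2) \<partial>M) \<le> ennreal (2 powr (2 * p) * (\<bar>B\<bar> + \<bar>B\<bar>))" for N
  proof -
    have Ba: "ennreal B \<le> ennreal \<bar>B\<bar>" by (intro ennreal_leI) simp
    have "(\<integral>\<^sup>+ x. ennreal ((\<bar>?W N x - ?W' x\<bar> powr p)\<^sup>2) \<partial>M)
      \<le> (\<integral>\<^sup>+ x. ennreal (2 powr (2 * p)) * (ennreal (\<bar>?W N x\<bar> powr (2 * p)) + ennreal (\<bar>?W' x\<bar> powr (2 * p))) \<partial>M)"
    proof (rule nn_integral_mono)
      fix x
      have "(\<bar>?W N x - ?W' x\<bar> powr p)\<^sup>2 = \<bar>?W N x - ?W' x\<bar> powr (2 * p)"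
        by (simp add: power2_eq_square powr_add[symmetric])
      also have "\<dots> \<le> 2 powr (2 * p) * (\<bar>?W N x\<bar> powr (2 * p) + \<bar>?W' x\<bar> powr (2 * p))"
        using powr_add_le[of "2 * p" "?W N x" "- ?W' x"] p by simp
      finally show "ennreal ((\<bar>?W N x - ?W' x\<bar> powr p)\<^sup>2) \<le> ennreal (2 powr (2 * p)) * (ennreal (\<bar>?W N x\<bar> powr (2 * p)) + ennreal (\<bar>?W' x\<bar> powr (2 * p)))"
        by (intro ennreal_le_mult_add) auto
    qed
    also have "\<dots> = ennreal (2 powr (2 * p)) * (\<integral>\<^sup>+ x. ennreal (\<bar>?W N x\<bar> powr (2 * p)) + ennreal (\<bar>?W' x\<bar> powr (2 * p)) \<partial>M)"
      by (rule nn_integral_cmult) measurable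
    also have "(\<integral>\<^sup>+ x. ennreal (\<bar>?W N x\<bar> powr (2 * p)) + ennreal (\<bar>?W' x\<bar> powr (2 * p)) \<partial>M)
      = (\<integral>\<^sup>+ x. ennreal (\<bar>?W N x\<bar> powr (2 * p)) \<partial>M) + (\<integral>\<^sup>+ x. ennreal (\<bar>?W' x\<bar> powr (2 * p)) \<partial>M)"
      by (rule nn_integral_add) measurable
    also have "\<dots> \<le> ennreal \<bar>B\<bar> + ennreal \<bar>B\<bar>"
      by (rule add_mono[OF order.trans[OF B Ba] order.trans[OF W'B Ba]])
    also have "ennreal (2 powr (2 * p)) * (ennreal \<bar>B\<bar> + ennreal \<bar>B\<bar>) = ennreal (2 powr (2 * p) * (\<bar>B\<bar> + \<bar>B\<bar>))"
    proof -
      have "ennreal \<bar>B\<bar> + ennreal \<bar>B\<bar> = ennreal (\<bar>B\<bar> + \<bar>B\<bar>)" by (rule ennreal_plus[symmetric]) auto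
      then show ?thesis by (simp only: ennreal_mult powr_ge_zero add_nonneg_nonneg abs_ge_zero)
    qed
    finally show ?thesis by (simp add: mult_left_mono)
  qed
  have Wp: "in_Lp M p (?W N)" for N
  proof -
    obtain B' where "\<And>N. (\<integral>\<^sup>+ x. ennreal (\<bar>?W N x\<bar> powr p) \<partial>M) \<le> ennreal B'" using bound[OF p] by blast
    from le_less_trans[OF this ennreal_less_top] show ?thesis by (simp add: in_Lp_iff)
  qed
  show ?thesis
  proof (rule Lp_tendstoI[OF p Wp], measurable)
    fix e :: real assume e: "0 < e"
    let ?P = "\<lambda>N. (\<integral>\<^sup>+ x. ennreal (\<bar>?W N x - ?W' x\<bar> powr p) \<partial>M) \<le> ennreal e"
    show "eventually ?P sequentially"
    proof (rule ccontr)
      assume "\<not> eventually ?P sequentially"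
      then have "\<exists>\<^sub>F N in sequentially. \<not> ?P N" by (simp add: frequently_def)
      then have "infinite {N. \<not> ?P N}" by (simp add: cofinite_eq_sequentially[symmetric] frequently_cofinite)
      then obtain s :: "nat \<Rightarrow> nat" where s: "strict_mono s" "\<And>n. s n \<in> {N. \<not> ?P N}"
        by (rule infinite_enumerate[THEN exE]) auto
      obtain r where r: "strict_mono r" "AE x in M. (\<lambda>i. ?W (s (r i)) x) \<longlonglongrightarrow> ?W' x" using sub[OF s(1)] by blast
      have "AE x in M. (\<lambda>i. \<bar>?W (s (r i)) x - ?W' x\<bar> powr p) \<longlonglongrightarrow> 0"
        using r(2)
      proof eventually_elim
        case (elim x)
        then have "(\<lambda>i. \<bar>?W (s (r i)) x - ?W' x\<bar>) \<longlonglongrightarrow> 0" by (simp add: LIM_zero_iff tendsto_rabs_zero_iff)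
        then show ?case using p by (intro tendsto_zero_powrI[where b=p]) auto
      qed
      then have "eventually (\<lambda>i. ?P (s (r i))) sequentially"
        by (intro nn_integral_small_of_bounded_square[OF _ _ _ sq e]) auto
      then obtain i where "?P (s (r i))" by (auto simp: eventually_sequentially)
      with s(2)[of "r i"] show False by simp
    qed
  qed
qed

lemma gibbs_measure_props:
  assumes f: "in_Lp M 1 f" and f0: "\<And>x. 0 \<le> f x" and pos: "0 < (\<integral>x. f x \<partial>M)"
  shows "prob_space (gibbs_measure M f)" "absolutely_continuous M (gibbs_measure M f)"
proof -
  have [measurable]: "f \<in> borel_measurable M" using f by (simp add: in_Lp_def)
  have int: "integrable M f" using f by (simp add: in_Lp_iff integrable_iff_bounded)
  define Z where "Z = (\<integral>x. f x \<partial>M)"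
  have Z: "0 < Z" using pos by (simp add: Z_def)
  have eq: "gibbs_measure M f = density M (\<lambda>x. ennreal (f x / Z))"
    by (simp add: gibbs_measure_def gibbs_density_def Z_def Let_def)
  have m: "(\<lambda>x. ennreal (f x / Z)) \<in> borel_measurable M" by measurable
  show "prob_space (gibbs_measure M f)"
  proof
    have "emeasure (gibbs_measure M f) (space (gibbs_measure M f)) = (\<integral>\<^sup>+ x. ennreal (f x / Z) \<partial>M)"
      unfolding eq by (subst emeasure_density) (auto intro!: nn_integral_cong)
    also have "\<dots> = ennreal (\<integral>x. f x / Z \<partial>M)"
      using int f0 Z by (intro nn_integral_eq_integral) auto
    also have "\<dots> = 1" using Z by (simp add: Z_def[symmetric])
    finally show "emeasure (gibbs_measure M f) (space (gibbs_measure M f)) = 1" .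
  qed
  show "absolutely_continuous M (gibbs_measure M f)"
    unfolding eq by (rule absolutely_continuousI_density[OF m])
qed

text \<open>Convergence for \<open>p = 1\<close> gives that of the normalization constants, whose
  limit is positive. The difference of the densities splits into \<open>(F N - f) / Z N\<close> and
  \<open>f * (1 / Z N - 1 / Z')\<close>.\<close>

lemma Lp_tendsto_gibbs_density:
  assumes L: "\<And>p. 1 \<le> p \<Longrightarrow> Lp_tendsto M p F f" and pos: "0 < (\<integral>x. f x \<partial>M)" and p: "1 \<le> p"
  shows "Lp_tendsto M p (\<lambda>N. gibbs_density M (F N)) (gibbs_density M f)"
proof -
  have F: "in_Lp M p (F N)" and f: "in_Lp M p f" if "1 \<le> p" for N p using L[OF that] by (auto simp: Lp_tendsto_def)
  have [measurable]: "F N \<in> borel_measurable M" "f \<in> borel_measurable M" for N using F[OF p] f[OF p] by (auto simp: in_Lp_def)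
  have int: "integrable M (F N)" "integrable M f" for N
    using F[of 1 N] f[of 1] by (simp_all add: in_Lp_iff integrable_iff_bounded)
  define Z where "Z N = (\<integral>x. F N x \<partial>M)" for N
  define Z' where "Z' = (\<integral>x. f x \<partial>M)"
  have Z': "0 < Z'" using pos by (simp add: Z'_def)
  have "(\<lambda>N. \<integral>x. norm (F N x - f x) \<partial>M) \<longlonglongrightarrow> 0"
    using L[of 1] by (simp add: Lp_tendsto_def Lp_norm_def)
  then have "(\<lambda>N. Z N - Z') \<longlonglongrightarrow> 0"
  proof (rule Lim_null_comparison[rotated])
    show "eventually (\<lambda>N. norm (Z N - Z') \<le> (\<integral>x. norm (F N x - f x) \<partial>M)) sequentially"
    proof (intro always_eventually allI)
      fix N
      have "Z N - Z' = (\<integral>x. F N x - f x \<partial>M)" using int by (simp add: Z_def Z'_def)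
      then show "norm (Z N - Z') \<le> (\<integral>x. norm (F N x - f x) \<partial>M)" by (simp only: integral_norm_bound)
    qed
  qed
  then have Zlim: "Z \<longlonglongrightarrow> Z'" by (simp add: LIM_zero_iff)
  then have inv: "(\<lambda>N. 1 / Z N) \<longlonglongrightarrow> 1 / Z'" using Z' by (intro tendsto_intros) auto
  have dens: "gibbs_density M (F N) x = F N x / Z N" "gibbs_density M f x = f x / Z'" for N x
    by (simp_all add: gibbs_density_def Z_def Z'_def Let_def)
  show ?thesis
  proof (rule Lp_tendstoI[OF p])
    show "in_Lp M p (gibbs_density M (F N))" for N
    proof -
      have "integrable M (\<lambda>x. \<bar>F N x\<bar> powr p / \<bar>Z N\<bar> powr p)" using F[OF p, of N] by (simp add: in_Lp_def)
      then show ?thesis unfolding in_Lp_def dens[abs_def] abs_divide by (simp add: powr_divide)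
    qed
    show "gibbs_density M f \<in> borel_measurable M" unfolding dens[abs_def] by measurable
    fix e :: real assume e: "0 < e"
    define I where "I = (\<integral>x. \<bar>f x\<bar> powr p \<partial>M)"
    have fI: "(\<integral>\<^sup>+ x. ennreal (\<bar>f x\<bar> powr p) \<partial>M) = ennreal I"
      unfolding I_def using f[OF p] by (intro nn_integral_eq_integral) (auto simp: in_Lp_def)
    have I0: "0 \<le> I" by (simp add: I_def)
    have "(\<lambda>N. \<bar>1 / Z N - 1 / Z'\<bar> powr p) \<longlonglongrightarrow> 0"
      using inv p by (intro tendsto_zero_powrI[where b=p]) (auto simp: LIM_zero_iff tendsto_rabs_zero_iff)
    then have "(\<lambda>N. 2 powr p * (\<bar>1 / Z N - 1 / Z'\<bar> powr p * I)) \<longlonglongrightarrow> 2 powr p * (0 * I)" by (intro tendsto_intros)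
    then have ev1: "eventually (\<lambda>N. 2 powr p * (\<bar>1 / Z N - 1 / Z'\<bar> powr p * I) < e / 2) sequentially"
      by (rule order_tendstoD(2)) (use e in simp)
    have ev2: "eventually (\<lambda>N. 1 / Z N < 2 / Z') sequentially" "eventually (\<lambda>N. 0 < 1 / Z N) sequentially"
      using Z' by (intro order_tendstoD[OF inv]; simp add: divide_strict_right_mono)+
    \<comment> \<open>\<open>1 / Z N\<close> is eventually below \<open>2 / Z'\<close>, so this
      choice makes the first part at most \<open>e / 2\<close>.\<close>
    define d where "d = e / (2 * 2 powr p * (2 / Z') powr p)"
    have d: "0 < d" using e Z' by (simp add: d_def)
    from ev1 ev2 Lp_tendsto_nn_integral[OF p L[OF p] d]
    show "eventually (\<lambda>N. (\<integral>\<^sup>+ x. ennreal (\<bar>gibbs_density M (F N) x - gibbs_density M f x\<bar> powr p) \<partial>M) \<le> ennreal e) sequentially"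
    proof eventually_elim
      case (elim N)
      define a where "a = 2 powr p * (1 / Z N) powr p"
      define b where "b = 2 powr p * \<bar>1 / Z N - 1 / Z'\<bar> powr p"
      have ab: "0 \<le> a" "0 \<le> b" by (auto simp: a_def b_def)
      have "(\<integral>\<^sup>+ x. ennreal (\<bar>gibbs_density M (F N) x - gibbs_density M f x\<bar> powr p) \<partial>M)
        \<le> (\<integral>\<^sup>+ x. ennreal a * ennreal (\<bar>F N x - f x\<bar> powr p) + ennreal b * ennreal (\<bar>f x\<bar> powr p) \<partial>M)"
      proof (rule nn_integral_mono)
        fix x
        have "gibbs_density M (F N) x - gibbs_density M f x = (F N x - f x) * (1 / Z N) + f x * (1 / Z N - 1 / Z')"
          by (simp add: dens algebra_simps)
        then have "\<bar>gibbs_density M (F N) x - gibbs_density M f x\<bar> powr p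
           \<le> 2 powr p * (\<bar>(F N x - f x) * (1 / Z N)\<bar> powr p + \<bar>f x * (1 / Z N - 1 / Z')\<bar> powr p)"
          using p by (simp only:) (rule powr_add_le, simp)
        also have "\<dots> = a * \<bar>F N x - f x\<bar> powr p + b * \<bar>f x\<bar> powr p"
        proof -
          have "\<bar>1 / Z N\<bar> = 1 / Z N" using elim(3) by (intro abs_of_nonneg less_imp_le)
          then show ?thesis unfolding a_def b_def abs_mult powr_mult by (simp only: distrib_left mult_ac)
        qed
        finally have "ennreal (\<bar>gibbs_density M (F N) x - gibbs_density M f x\<bar> powr p) \<le> ennreal (a * \<bar>F N x - f x\<bar> powr p + b * \<bar>f x\<bar> powr p)"
          by (rule ennreal_leI)
        also have "\<dots> = ennreal a * ennreal (\<bar>F N x - f x\<bar> powr p) + ennreal b * ennreal (\<bar>f x\<bar> powr p)"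
          using ab by (subst ennreal_plus) (auto simp: ennreal_mult)
        finally show "ennreal (\<bar>gibbs_density M (F N) x - gibbs_density M f x\<bar> powr p) \<le> ennreal a * ennreal (\<bar>F N x - f x\<bar> powr p) + ennreal b * ennreal (\<bar>f x\<bar> powr p)" .
      qed
      also have "\<dots> = ennreal a * (\<integral>\<^sup>+ x. ennreal (\<bar>F N x - f x\<bar> powr p) \<partial>M) + ennreal b * (\<integral>\<^sup>+ x. ennreal (\<bar>f x\<bar> powr p) \<partial>M)"
        by (simp add: nn_integral_add nn_integral_cmult)
      also have "\<dots> \<le> ennreal a * ennreal d + ennreal b * ennreal I"
        unfolding fI using elim(4) by (intro add_right_mono mult_left_mono) auto
      also have "\<dots> = ennreal (a * d + b * I)"
        using ab d I0 by (simp add: ennreal_mult)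
      also have "\<dots> \<le> ennreal e"
      proof (rule ennreal_leI)
        have "a * d \<le> 2 powr p * (2 / Z') powr p * d"
          unfolding a_def using elim(2,3) d p by (intro mult_right_mono mult_left_mono powr_mono2) auto
        also have "\<dots> = e / 2" using Z' by (simp add: d_def)
        finally show "a * d + b * I \<le> e" using elim(1) by (simp add: b_def mult_ac)
      qed
      finally show ?case .
    qed
  qed
qed

end

section \<open>The cutoff event\<close>

lemma Lp_tendsto_distr:
  assumes T[measurable]: "T \<in> measurable M N"
    and [measurable]: "\<And>n. F n \<in> borel_measurable N" "f \<in> borel_measurable N"
  shows "Lp_tendsto (distr M N T) p F f \<longleftrightarrow> Lp_tendsto M p (\<lambda>n x. F n (T x)) (\<lambda>x. f (T x))"
proof -
  have "in_Lp (distr M N T) p h \<longleftrightarrow> in_Lp M p (\<lambda>x. h (T x))" if [measurable]: "h \<in> borel_measurable N" for h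
    by (simp add: in_Lp_def integrable_distr_eq)
  moreover have "Lp_norm (distr M N T) p h = Lp_norm M p (\<lambda>x. h (T x))" if [measurable]: "h \<in> borel_measurable N" for h
    by (simp add: Lp_norm_def integral_distr)
  ultimately show ?thesis by (simp add: Lp_tendsto_def)
qed

context gaussian_modes
begin

text \<open>For each value of the real part, the imaginary part has to avoid at most two
  points.\<close>

lemma AE_g0_sq_neq: "AE \<omega> in M. (cmod (g 0 \<omega>))\<^sup>2 \<noteq> c"
proof -
  have d: "distributed M lborel (\<lambda>\<omega>. Im (g 0 \<omega>)) (normal_density 0 (sqrt (1 / 2)))"
    and ind: "indep_var borel (\<lambda>\<omega>. Re (g 0 \<omega>)) borel (\<lambda>\<omega>. Im (g 0 \<omega>))"
    using gauss[of 0] by (auto simp: std_complex_gaussian_def)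
  have null: "AE \<omega> in M. (Im (g 0 \<omega>))\<^sup>2 \<noteq> d" for d
  proof -
    have "AE y in lborel. y \<noteq> sqrt d \<and> y \<noteq> - sqrt d"
      using AE_lborel_singleton[of "sqrt d"] AE_lborel_singleton[of "- sqrt d"] by eventually_elim auto
    then have "AE y in lborel. y\<^sup>2 \<noteq> d"
    proof eventually_elim
      case (elim y)
      then have "\<bar>y\<bar> \<noteq> sqrt d" by (auto simp: abs_if)
      then show ?case by auto
    qed
    then have "AE y in lborel. 0 < ennreal (normal_density 0 (sqrt (1 / 2)) y) \<longrightarrow> y\<^sup>2 \<noteq> d" by eventually_elim auto
    then show ?thesis by (subst distributed_AE2[OF d, of "\<lambda>y. y\<^sup>2 \<noteq> d"]) measurable
  qed
  let ?f = "\<lambda>(x, y). indicator {z. fst z ^ 2 + snd z ^ 2 = c} (x, y) :: ennreal"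
  have f: "?f \<in> borel_measurable (borel \<Otimes>\<^sub>M borel)" by measurable
  have "(\<integral>\<^sup>+ \<omega>. ?f (Re (g 0 \<omega>), Im (g 0 \<omega>)) \<partial>M) = (\<integral>\<^sup>+ \<omega>. \<integral>\<^sup>+ \<omega>'. ?f (Re (g 0 \<omega>), Im (g 0 \<omega>')) \<partial>M \<partial>M)"
    by (rule nn_integral_indep_var[OF ind f])
  also have "\<dots> = (\<integral>\<^sup>+ \<omega>. 0 \<partial>M)"
  proof (intro nn_integral_cong)
    fix \<omega>
    have "(\<integral>\<^sup>+ \<omega>'. ?f (Re (g 0 \<omega>), Im (g 0 \<omega>')) \<partial>M) = (\<integral>\<^sup>+ \<omega>'. 0 \<partial>M)"
    proof (rule nn_integral_cong_AE)
      show "AE \<omega>' in M. ?f (Re (g 0 \<omega>), Im (g 0 \<omega>')) = 0"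
        using null[of "c - (Re (g 0 \<omega>))\<^sup>2"] by eventually_elim (auto simp: indicator_def)
    qed
    then show "(\<integral>\<^sup>+ \<omega>'. ?f (Re (g 0 \<omega>), Im (g 0 \<omega>')) \<partial>M) = 0" by simp
  qed
  finally have "(\<integral>\<^sup>+ \<omega>. ?f (Re (g 0 \<omega>), Im (g 0 \<omega>)) \<partial>M) = 0" by simp
  then have "AE \<omega> in M. ?f (Re (g 0 \<omega>), Im (g 0 \<omega>)) = 0"
    by (subst (asm) nn_integral_0_iff_AE) measurable
  then show ?thesis by eventually_elim (auto simp: indicator_def cmod_power2 split: if_splits)
qed

lemma normal_interval_pos:
  assumes d: "distributed M lborel X (normal_density 0 \<sigma>)" and "0 < \<sigma>" and ab: "a < b"
  shows "0 < prob (X -` {a..b} \<inter> space M)"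
proof (rule ccontr)
  assume "\<not> 0 < prob (X -` {a..b} \<inter> space M)"
  then have z: "prob (X -` {a..b} \<inter> space M) = 0" using measure_nonneg[of M] by (simp add: not_less order.antisym)
  have [measurable]: "X \<in> borel_measurable M" using d by (simp add: distributed_def)
  have "AE \<omega> in M. \<not> (X \<omega> \<in> {a..b})"
    by (rule AE_I[of _ _ "X -` {a..b} \<inter> space M"]) (use z in \<open>auto simp: emeasure_eq_measure\<close>)
  then have "AE y in lborel. 0 < ennreal (normal_density 0 \<sigma> y) \<longrightarrow> y \<notin> {a..b}"
    by (subst (asm) distributed_AE2[OF d, of "\<lambda>y. y \<notin> {a..b}"]) measurable
  then have "AE y in lborel. y \<notin> {a..b}"
    by eventually_elim (simp add: normal_density_pos[OF \<open>0 < \<sigma>\<close>])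
  then have "emeasure lborel {a..b} = 0" by (subst (asm) AE_iff_measurable[of "{a..b}"]) auto
  then show False using ab by simp
qed

text \<open>The rectangle \<open>I \<times> J\<close> lies in the annulus, as the squares of its
  sides add up to at most \<open>b\<close>, and it has positive probability by independence of the
  real and imaginary parts.\<close>

lemma g0_sq_interval_pos:
  assumes "0 \<le> a" "a < b"
  shows "\<not> (AE \<omega> in M. \<not> ((cmod (g 0 \<omega>))\<^sup>2 \<in> {a..b}))"
proof
  assume AE: "AE \<omega> in M. \<not> ((cmod (g 0 \<omega>))\<^sup>2 \<in> {a..b})"
  have d: "distributed M lborel (\<lambda>\<omega>. Re (g 0 \<omega>)) (normal_density 0 (sqrt (1 / 2)))"
    "distributed M lborel (\<lambda>\<omega>. Im (g 0 \<omega>)) (normal_density 0 (sqrt (1 / 2)))"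
    and ind: "indep_var borel (\<lambda>\<omega>. Re (g 0 \<omega>)) borel (\<lambda>\<omega>. Im (g 0 \<omega>))"
    using gauss[of 0] by (auto simp: std_complex_gaussian_def)
  define I J where "I = {sqrt a..sqrt ((a + b) / 2)}" and "J = {0..sqrt ((b - a) / 2)}"
  have pos: "0 < prob ((\<lambda>\<omega>. Re (g 0 \<omega>)) -` I \<inter> space M)" "0 < prob ((\<lambda>\<omega>. Im (g 0 \<omega>)) -` J \<inter> space M)"
    unfolding I_def J_def using assms by (auto intro!: normal_interval_pos[OF d(1)] normal_interval_pos[OF d(2)])
  have sub: "x\<^sup>2 + y\<^sup>2 \<in> {a..b}" if "x \<in> I" "y \<in> J" for x y
  proof -
    have x: "0 \<le> sqrt a" "sqrt a \<le> x" "x \<le> sqrt ((a + b) / 2)" and y: "0 \<le> y" "y \<le> sqrt ((b - a) / 2)"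
      using that assms by (auto simp: I_def J_def)
    have "(sqrt a)\<^sup>2 \<le> x\<^sup>2" "x\<^sup>2 \<le> (sqrt ((a + b) / 2))\<^sup>2" "y\<^sup>2 \<le> (sqrt ((b - a) / 2))\<^sup>2"
      using x y by (intro power_mono; linarith)+
    moreover have "0 \<le> y\<^sup>2" by simp
    ultimately show ?thesis using assms by (simp add: add_increasing2)
  qed
  have "prob ((\<lambda>\<omega>. (Re (g 0 \<omega>), Im (g 0 \<omega>))) -` (I \<times> J) \<inter> space M)
     = prob ((\<lambda>\<omega>. Re (g 0 \<omega>)) -` I \<inter> space M) * prob ((\<lambda>\<omega>. Im (g 0 \<omega>)) -` J \<inter> space M)"
    by (rule indep_varD[OF ind]) (auto simp: I_def J_def)
  then have "0 < prob ((\<lambda>\<omega>. (Re (g 0 \<omega>), Im (g 0 \<omega>))) -` (I \<times> J) \<inter> space M)"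
    using pos by simp
  moreover have "AE \<omega> in M. \<omega> \<notin> (\<lambda>\<omega>. (Re (g 0 \<omega>), Im (g 0 \<omega>))) -` (I \<times> J) \<inter> space M"
    using AE by eventually_elim (use sub in \<open>auto simp: cmod_power2\<close>)
  then have "prob ((\<lambda>\<omega>. (Re (g 0 \<omega>), Im (g 0 \<omega>))) -` (I \<times> J) \<inter> space M) = 0"
  proof (rule prob_eq_0[THEN iffD2, rotated])
    have "(\<lambda>\<omega>. (Re (g 0 \<omega>), Im (g 0 \<omega>))) -` (I \<times> J) \<inter> space M = {\<omega> \<in> space M. Re (g 0 \<omega>) \<in> I \<and> Im (g 0 \<omega>) \<in> J}" by auto
    also have "\<dots> \<in> events" unfolding I_def J_def by measurable
    finally show "(\<lambda>\<omega>. (Re (g 0 \<omega>), Im (g 0 \<omega>))) -` (I \<times> J) \<inter> space M \<in> events" .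
  qed
  ultimately show False by simp
qed

section \<open>Isolating the zero mode\<close>

abbreviation other_modes :: "'a \<Rightarrow> mode \<Rightarrow> complex" where
  "other_modes \<omega> \<equiv> restrict (\<lambda>a. g a \<omega>) (- {0})"

lemma nn_integral_freeze_g0:
  assumes [measurable]: "\<psi> \<in> borel_measurable (PiM (- {0}) (\<lambda>_. borel))" "S \<in> sets (borel :: real measure)"
  shows "(\<integral>\<^sup>+ \<omega>. indicator S ((cmod (g 0 \<omega>))\<^sup>2 + \<psi> (other_modes \<omega>)) \<partial>M)
     = (\<integral>\<^sup>+ \<omega>. (\<integral>\<^sup>+ \<omega>'. indicator S ((cmod (g 0 \<omega>'))\<^sup>2 + \<psi> (other_modes \<omega>)) \<partial>M) \<partial>M)"
proof -
  let ?P = "PiM (- {0 :: mode}) (\<lambda>_. borel :: complex measure) \<Otimes>\<^sub>M PiM {0 :: mode} (\<lambda>_. borel :: complex measure)"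
  let ?f = "\<lambda>p. indicator S ((cmod (snd p 0))\<^sup>2 + \<psi> (fst p)) :: ennreal"
  have [measurable]: "(\<lambda>p. snd p 0) \<in> borel_measurable ?P"
    by (rule measurable_compose[OF measurable_snd measurable_component_singleton]) simp
  have [measurable]: "(\<lambda>p. \<psi> (fst p)) \<in> borel_measurable ?P" by (rule measurable_compose[OF measurable_fst]) measurable
  have f: "?f \<in> borel_measurable ?P" by measurable
  have ind: "indep_var (PiM (- {0}) (\<lambda>_. borel)) other_modes
       (PiM {0} (\<lambda>_. borel)) (\<lambda>\<omega>. restrict (\<lambda>a. g a \<omega>) {0})"
    by (rule indep_var_restrict_modes) auto
  from nn_integral_indep_var[OF ind f] show ?thesis by simp
qed

lemma other_modes_measurable [measurable]: "other_modes \<in> measurable M (PiM (- {0}) (\<lambda>_. borel))"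
  by (rule measurable_restrict) simp

lemma AE_shifted_neq:
  assumes [measurable]: "\<psi> \<in> borel_measurable (PiM (- {0}) (\<lambda>_. borel))"
  shows "AE \<omega> in M. (cmod (g 0 \<omega>))\<^sup>2 + \<psi> (other_modes \<omega>) \<noteq> c"
proof -
  have inner: "(\<integral>\<^sup>+ \<omega>'. indicator {c} ((cmod (g 0 \<omega>'))\<^sup>2 + t) \<partial>M) = 0" for t :: real
  proof -
    have "(\<integral>\<^sup>+ \<omega>'. indicator {c} ((cmod (g 0 \<omega>'))\<^sup>2 + t) \<partial>M) = (\<integral>\<^sup>+ \<omega>'. 0 \<partial>M)"
    proof (rule nn_integral_cong_AE)
      show "AE \<omega>' in M. indicator {c} ((cmod (g 0 \<omega>'))\<^sup>2 + t) = (0 :: ennreal)"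
        using AE_g0_sq_neq[of "c - t"] by eventually_elim (auto simp: indicator_def)
    qed
    then show ?thesis by simp
  qed
  have "(\<integral>\<^sup>+ \<omega>. indicator {c} ((cmod (g 0 \<omega>))\<^sup>2 + \<psi> (other_modes \<omega>)) \<partial>M) = 0"
    by (subst nn_integral_freeze_g0) (simp_all add: inner)
  then have "AE \<omega> in M. indicator {c} ((cmod (g 0 \<omega>))\<^sup>2 + \<psi> (other_modes \<omega>)) = (0 :: ennreal)"
    by (subst (asm) nn_integral_0_iff_AE) measurable
  then show ?thesis by eventually_elim (auto simp: indicator_def split: if_splits)
qed

text \<open>If the remaining part takes a value \<open>t < K\<close>, the interval from
  \<open>max 0 (- K - t)\<close> to \<open>K - t\<close> is nondegenerate however negative
  \<open>t\<close> is, and the squared modulus of the zero mode falls into it with positive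
  probability.\<close>

lemma not_AE_shifted_outside:
  assumes [measurable]: "\<psi> \<in> borel_measurable (PiM (- {0}) (\<lambda>_. borel))"
    and K: "0 < K" and \<psi>: "\<not> (AE \<omega> in M. K \<le> \<psi> (other_modes \<omega>))"
  shows "\<not> (AE \<omega> in M. \<not> \<bar>(cmod (g 0 \<omega>))\<^sup>2 + \<psi> (other_modes \<omega>)\<bar> \<le> K)"
proof
  assume "AE \<omega> in M. \<not> \<bar>(cmod (g 0 \<omega>))\<^sup>2 + \<psi> (other_modes \<omega>)\<bar> \<le> K"
  then have "AE \<omega> in M. indicator {- K..K} ((cmod (g 0 \<omega>))\<^sup>2 + \<psi> (other_modes \<omega>)) = (0 :: ennreal)"
    by eventually_elim (auto simp: indicator_def)
  then have "(\<integral>\<^sup>+ \<omega>. indicator {- K..K} ((cmod (g 0 \<omega>))\<^sup>2 + \<psi> (other_modes \<omega>)) \<partial>M) = 0"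
    by (subst nn_integral_0_iff_AE) measurable
  then have "(\<integral>\<^sup>+ \<omega>. (\<integral>\<^sup>+ \<omega>'. indicator {- K..K} ((cmod (g 0 \<omega>'))\<^sup>2 + \<psi> (other_modes \<omega>)) \<partial>M) \<partial>M) = 0"
    by (subst (asm) nn_integral_freeze_g0) auto
  then have "AE \<omega> in M. (\<integral>\<^sup>+ \<omega>'. indicator {- K..K} ((cmod (g 0 \<omega>'))\<^sup>2 + \<psi> (other_modes \<omega>)) \<partial>M) = 0"
    by (subst (asm) nn_integral_0_iff_AE) measurable
  then have "AE \<omega> in M. K \<le> \<psi> (other_modes \<omega>)"
  proof eventually_elim
    case (elim \<omega>)
    define t where "t = \<psi> (other_modes \<omega>)"
    show ?case
    proof (rule ccontr)
      assume "\<not> ?case"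
      then have t: "t < K" by (simp add: t_def)
      from elim have "AE \<omega>' in M. indicator {- K..K} ((cmod (g 0 \<omega>'))\<^sup>2 + t) = (0 :: ennreal)"
        unfolding t_def[symmetric] by (subst (asm) nn_integral_0_iff_AE) measurable
      then have "AE \<omega>' in M. \<not> ((cmod (g 0 \<omega>'))\<^sup>2 \<in> {max 0 (- K - t)..K - t})"
        by eventually_elim (auto simp: indicator_def split: if_splits)
      moreover have "\<not> (AE \<omega>' in M. \<not> ((cmod (g 0 \<omega>'))\<^sup>2 \<in> {max 0 (- K - t)..K - t}))"
        using t K by (intro g0_sq_interval_pos) auto
      ultimately show False by contradiction
    qed
  qed
  with \<psi> show False by contradiction
qed

text \<open>In the application \<open>Y + 1\<close> is centred with variance at most 75, so its
  exponential moment at \<open>t\<close> is at most \<open>exp (150 * t\<^sup>2)\<close>. For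
  \<open>t = 1 / 200\<close>, below \<open>1 / 150\<close>, this is smaller than
  \<open>exp t\<close>, whereas \<open>K \<le> Y\<close> would force at least
  \<open>exp (t * (K + 1))\<close>. An exponential moment is used because Fatou's lemma carries its
  bound to the limit.\<close>

lemma not_AE_ge_of_exp_bound:
  assumes "0 < K"
    and bound: "(\<integral>\<^sup>+ \<omega>. ennreal (exp (1 / 200 * (Y \<omega> + 1))) \<partial>M) \<le> ennreal (exp (150 * (1 / 200)\<^sup>2))"
  shows "\<not> (AE \<omega> in M. K \<le> Y \<omega>)"
proof
  assume AE: "AE \<omega> in M. K \<le> Y \<omega>"
  have "ennreal (exp (1 / 200 * (K + 1))) = (\<integral>\<^sup>+ \<omega>. ennreal (exp (1 / 200 * (K + 1))) \<partial>M)" by (simp add: emeasure_space_1)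
  also have "\<dots> \<le> (\<integral>\<^sup>+ \<omega>. ennreal (exp (1 / 200 * (Y \<omega> + 1))) \<partial>M)"
  proof (rule nn_integral_mono_AE)
    show "AE \<omega> in M. ennreal (exp (1 / 200 * (K + 1))) \<le> ennreal (exp (1 / 200 * (Y \<omega> + 1)))"
      using AE by eventually_elim (auto intro: ennreal_leI)
  qed
  also note bound
  finally have "exp (1 / 200 * (K + 1)) \<le> exp (150 * (1 / 200 :: real)\<^sup>2)" by simp
  then have "1 / 200 * (K + 1) \<le> 150 * (1 / 200 :: real)\<^sup>2" by (simp only: exp_le_cancel_iff)
  then show False using \<open>0 < K\<close> by (simp add: power2_eq_square)
qed

lemma sum_jbracket4_total_le: "(\<Sum>a\<in>modes_upto N. 1 / jbracket a ^ 4) \<le> 75"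
proof -
  have 1: "1 / jbracket a ^ 4 \<le> 1" for a using power_mono[OF jbracket_ge_1, of 4 a] by (simp add: divide_le_eq)
  have "(\<Sum>a\<in>modes_upto N. 1 / jbracket a ^ 4) \<le> (\<Sum>a\<in>modes_upto 1 \<union> (modes_upto N - modes_upto 1). 1 / jbracket a ^ 4)"
    by (intro sum_mono2) auto
  also have "\<dots> = (\<Sum>a\<in>modes_upto 1. 1 / jbracket a ^ 4) + (\<Sum>a\<in>modes_upto N - modes_upto 1. 1 / jbracket a ^ 4)"
    by (rule sum.union_disjoint) auto
  also have "\<dots> \<le> 25 + 50"
    using sum_modes_upto_1_le[OF 1] sum_jbracket4_le[of "modes_upto N - modes_upto 1" 0] by (intro add_mono) auto
  finally show ?thesis by simp
qed

text \<open>The Wick mass without the squared modulus of the zero mode, as a function of the other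
  modes. The \<open>- 1\<close> is the renormalization of that mode and gives \<open>rest\<close>
  the mean \<open>- 1\<close>, strictly below \<open>K\<close>.\<close>

definition rest :: "nat \<Rightarrow> (mode \<Rightarrow> complex) \<Rightarrow> real" where
  "rest N x = (\<Sum>a\<in>modes_upto N - {0}. ((cmod (x a))\<^sup>2 - 1) / (jbracket a)\<^sup>2) - 1"

lemma rest_measurable [measurable]: "rest N \<in> borel_measurable (PiM (- {0}) (\<lambda>_. borel))"
proof -
  have [measurable]: "(\<lambda>x. x a) \<in> borel_measurable (PiM (- {0}) (\<lambda>_. borel :: complex measure))" if "a \<in> modes_upto N - {0}" for a :: mode
    using that by (intro measurable_component_singleton) auto
  show ?thesis unfolding rest_def by measurable
qed

lemma rest_other_modes: "rest N (other_modes \<omega>) = wick (modes_upto N - {0}) \<omega> - 1"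
  unfolding rest_def wick_def by simp

lemma wick_eq_g0_rest: "wick (modes_upto N) \<omega> = (cmod (g 0 \<omega>))\<^sup>2 + rest N (other_modes \<omega>)"
proof -
  have "jbracket 0 = 1" by (simp add: jbracket_def freq_def flip: zero_prod_def)
  then have "wick (modes_upto N) \<omega> = ((cmod (g 0 \<omega>))\<^sup>2 - 1) + wick (modes_upto N - {0}) \<omega>"
    unfolding wick_def by (subst sum.remove[of _ 0]) auto
  then show ?thesis by (simp add: rest_other_modes)
qed

lemma nn_integral_exp_rest_le:
  "(\<integral>\<^sup>+ \<omega>. ennreal (exp (1 / 200 * (rest N (other_modes \<omega>) + 1))) \<partial>M) \<le> ennreal (exp (150 * (1 / 200)\<^sup>2))"
proof -
  have "(\<integral>\<^sup>+ \<omega>. ennreal (exp (1 / 200 * (rest N (other_modes \<omega>) + 1))) \<partial>M)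
     = (\<integral>\<^sup>+ \<omega>. ennreal (exp (1 / 200 * wick (modes_upto N - {0}) \<omega>)) \<partial>M)"
    by (simp add: rest_other_modes)
  also have "\<dots> \<le> ennreal (exp (2 * (1 / 200)\<^sup>2 * (\<Sum>a\<in>modes_upto N - {0}. 1 / jbracket a ^ 4)))"
  proof (rule nn_integral_exp_wick_le)
    fix a
    have "1 \<le> (jbracket a)\<^sup>2" using power_mono[OF jbracket_ge_1, of 2 a] by simp
    then have "1 / 200 / (jbracket a)\<^sup>2 \<le> 1 / 200 / 1" by (rule divide_left_mono) auto
    then show "1 / 200 / (jbracket a)\<^sup>2 \<le> 1 / 2" by linarith
  qed simp
  also have "\<dots> \<le> ennreal (exp (150 * (1 / 200)\<^sup>2))"
  proof -
    have "(\<Sum>a\<in>modes_upto N - {0}. 1 / jbracket a ^ 4) \<le> (\<Sum>a\<in>modes_upto N. 1 / jbracket a ^ 4)"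
      by (intro sum_mono2) auto
    also note sum_jbracket4_total_le
    finally have "(\<Sum>a\<in>modes_upto N - {0}. 1 / jbracket a ^ 4) \<le> 75" .
    from mult_left_mono[OF this, of "2 * (1 / 200)\<^sup>2"] show ?thesis by (intro ennreal_leI) simp
  qed
  finally show ?thesis .
qed

lemma wick_cutoff_pos:
  assumes "0 < K"
  shows "\<not> (AE \<omega> in M. \<not> \<bar>wick (modes_upto N) \<omega>\<bar> \<le> K)"
  unfolding wick_eq_g0_rest
  by (intro not_AE_shifted_outside assms not_AE_ge_of_exp_bound nn_integral_exp_rest_le rest_measurable)

text \<open>The zero mode is the same in all truncations, so the limit is again its squared modulus
  plus a measurable function \<open>\<psi>\<close> of the other modes, and the arguments for fixed
  \<open>N\<close> apply to it.\<close>

lemma wick_limit_cutoff: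
  assumes K: "0 < K" and conv: "AE \<omega> in M. (\<lambda>i. wick (modes_upto (r i)) \<omega>) \<longlonglongrightarrow> Y \<omega>"
  shows "\<not> (AE \<omega> in M. \<not> \<bar>Y \<omega>\<bar> \<le> K)" and "AE \<omega> in M. \<bar>Y \<omega>\<bar> \<noteq> K"
proof -
  define \<psi> where "\<psi> x = lim (\<lambda>i. rest (r i) x)" for x
  have \<psi>[measurable]: "\<psi> \<in> borel_measurable (PiM (- {0}) (\<lambda>_. borel))" unfolding \<psi>_def by measurable
  have lim: "AE \<omega> in M. (\<lambda>i. rest (r i) (other_modes \<omega>)) \<longlonglongrightarrow> \<psi> (other_modes \<omega>) \<and> Y \<omega> = (cmod (g 0 \<omega>))\<^sup>2 + \<psi> (other_modes \<omega>)"
    using conv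
  proof eventually_elim
    case (elim \<omega>)
    have "(\<lambda>i. wick (modes_upto (r i)) \<omega> - (cmod (g 0 \<omega>))\<^sup>2) \<longlonglongrightarrow> Y \<omega> - (cmod (g 0 \<omega>))\<^sup>2"
      by (intro tendsto_intros elim)
    then have l: "(\<lambda>i. rest (r i) (other_modes \<omega>)) \<longlonglongrightarrow> Y \<omega> - (cmod (g 0 \<omega>))\<^sup>2" by (simp add: wick_eq_g0_rest)
    moreover from limI[OF l] have "\<psi> (other_modes \<omega>) = Y \<omega> - (cmod (g 0 \<omega>))\<^sup>2" by (simp add: \<psi>_def)
    ultimately show ?case by simp
  qed
  have "AE \<omega> in M. (cmod (g 0 \<omega>))\<^sup>2 + \<psi> (other_modes \<omega>) \<noteq> K"
    "AE \<omega> in M. (cmod (g 0 \<omega>))\<^sup>2 + \<psi> (other_modes \<omega>) \<noteq> - K"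
    by (intro AE_shifted_neq \<psi>)+
  with lim show "AE \<omega> in M. \<bar>Y \<omega>\<bar> \<noteq> K" by eventually_elim (auto simp: abs_if split: if_splits)
  have bound: "(\<integral>\<^sup>+ \<omega>. ennreal (exp (1 / 200 * (\<psi> (other_modes \<omega>) + 1))) \<partial>M) \<le> ennreal (exp (150 * (1 / 200)\<^sup>2))"
  proof -
    have "(\<integral>\<^sup>+ \<omega>. ennreal (exp (1 / 200 * (\<psi> (other_modes \<omega>) + 1))) \<partial>M)
      = (\<integral>\<^sup>+ \<omega>. liminf (\<lambda>i. ennreal (exp (1 / 200 * (rest (r i) (other_modes \<omega>) + 1)))) \<partial>M)"
    proof (rule nn_integral_cong_AE)
      show "AE \<omega> in M. ennreal (exp (1 / 200 * (\<psi> (other_modes \<omega>) + 1))) = liminf (\<lambda>i. ennreal (exp (1 / 200 * (rest (r i) (other_modes \<omega>) + 1))))"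
        using lim
      proof eventually_elim
        case (elim \<omega>)
        then have "(\<lambda>i. rest (r i) (other_modes \<omega>)) \<longlonglongrightarrow> \<psi> (other_modes \<omega>)" by simp
        then have "(\<lambda>i. ennreal (exp (1 / 200 * (rest (r i) (other_modes \<omega>) + 1)))) \<longlonglongrightarrow> ennreal (exp (1 / 200 * (\<psi> (other_modes \<omega>) + 1)))"
          by (intro tendsto_ennrealI tendsto_intros)
        then show ?case by (rule lim_imp_Liminf[OF sequentially_bot, symmetric])
      qed
    qed
    also have "\<dots> \<le> liminf (\<lambda>i. \<integral>\<^sup>+ \<omega>. ennreal (exp (1 / 200 * (rest (r i) (other_modes \<omega>) + 1))) \<partial>M)"
      by (rule nn_integral_liminf) measurable
    also have "\<dots> \<le> ennreal (exp (150 * (1 / 200)\<^sup>2))"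
      by (rule Liminf_le[OF sequentially_bot]) (intro always_eventually allI nn_integral_exp_rest_le)
    finally show ?thesis .
  qed
  have "\<not> (AE \<omega> in M. \<not> \<bar>(cmod (g 0 \<omega>))\<^sup>2 + \<psi> (other_modes \<omega>)\<bar> \<le> K)"
    by (intro not_AE_shifted_outside K not_AE_ge_of_exp_bound bound \<psi>)
  moreover have "AE \<omega> in M. \<not> \<bar>(cmod (g 0 \<omega>))\<^sup>2 + \<psi> (other_modes \<omega>)\<bar> \<le> K" if "AE \<omega> in M. \<not> \<bar>Y \<omega>\<bar> \<le> K"
    using that lim by eventually_elim auto
  ultimately show "\<not> (AE \<omega> in M. \<not> \<bar>Y \<omega>\<bar> \<le> K)" by blast
qed

end

section \<open>The interaction\<close>

lemma power_add3_le:
  fixes x y z :: real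
  assumes "0 \<le> x" "0 \<le> y" "0 \<le> z"
  shows "(x + y + z) ^ q \<le> 3 ^ q * (x ^ q + y ^ q + z ^ q)"
proof -
  define m where "m = max x (max y z)"
  have "(x + y + z) ^ q \<le> (3 * m) ^ q" using assms by (intro power_mono) (auto simp: m_def)
  also have "\<dots> = 3 ^ q * m ^ q" by (rule power_mult_distrib)
  also have "m ^ q \<le> x ^ q + y ^ q + z ^ q" using assms by (auto simp: m_def max_def)
  finally show ?thesis by simp
qed

lemma half_upto_mono: "L \<le> N \<Longrightarrow> half_upto L \<subseteq> half_upto N"
  using modes_upto_mono[of "L + L" "N + N"] by (auto simp: half_upto_def)

locale gaussian_interaction = gaussian_setup +
  fixes s :: real
  assumes s: "0 < s" "s \<le> 1"
begin

definition weight :: "mode \<Rightarrow> real" where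
  "weight m = (jbracket m powr (- s))\<^sup>2"

lemma admissible_weight: "admissible s weight (half_upto N)"
proof -
  have le1: "jbracket m powr (- s) \<le> 1" for m using s powr_mono[of "- s" 0 "jbracket m"] by simp
  have "weight m \<le> jbracket m powr (- s)" for m
    unfolding weight_def power2_eq_square using le1[of m] by (intro mult_left_le) auto
  then show ?thesis by (auto simp: admissible_def weight_def half_upto_def)
qed

text \<open>The Wick mass as a function on the product space, as the conditioning on
  \<open>g\<close> demands.\<close>

definition quad :: "nat \<Rightarrow> (mode \<Rightarrow> complex) \<Rightarrow> real" where
  "quad N x = (\<Sum>a\<in>modes_upto N. ((cmod (x a))\<^sup>2 - 1) / (jbracket a)\<^sup>2)"

text \<open>The decay of the Fourier coefficients of \<open>w\<close> is moved onto the correlation,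
  which leaves the standard Gaussian \<open>h m\<close> as the variable.\<close>

definition hcoef :: "nat \<Rightarrow> (mode \<Rightarrow> complex) \<Rightarrow> mode \<Rightarrow> complex" where
  "hcoef N x m = of_real (jbracket m powr (- s)) * corr_N N (coef x) m"

definition interaction :: "nat \<Rightarrow> 'a \<Rightarrow> real" where
  "interaction N \<omega> = lin (half_upto N) (1 / 2 * quad N (\<lambda>n. g n \<omega>)) (hcoef N (\<lambda>n. g n \<omega>)) (\<lambda>m. h m \<omega>)"

lemma quad_g: "quad N (\<lambda>n. g n \<omega>) = wick (modes_upto N) \<omega>"
  by (simp add: quad_def wick_def)

lemma quad_measurable [measurable]: "quad N \<in> borel_measurable (PiM UNIV (\<lambda>_. borel))"
  unfolding quad_def by measurable

lemma hcoef_measurable [measurable]: "(\<lambda>x. hcoef N x m) \<in> borel_measurable (PiM UNIV (\<lambda>_. borel))"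
proof -
  have "(\<lambda>x. corr_N N (coef x) m) \<in> borel_measurable (PiM UNIV (\<lambda>_. borel))"
    by (intro borel_measurable_corr borel_measurable_coef measurable_component_singleton) simp
  then show ?thesis unfolding hcoef_def by measurable
qed

lemma g_family_measurable [measurable]: "(\<lambda>\<omega> n. g n \<omega>) \<in> measurable M (PiM UNIV (\<lambda>_. borel))"
  by (rule measurable_PiM_single') auto

lemma sum_hcoef_diff:
  "(\<Sum>m\<in>E. (cmod (hcoef N x m - hcoef L x m))\<^sup>2) = wnorm2 weight E (\<lambda>m. corr_N N (coef x) m - corr_N L (coef x) m)"
  unfolding wnorm2_def weight_def hcoef_def right_diff_distrib[symmetric] norm_mult norm_of_real power_mult_distrib power2_abs ..

lemma sum_hcoef:
  "(\<Sum>m\<in>E. (cmod (hcoef N x m))\<^sup>2) = wnorm2 weight E (corr_N N (coef x))"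
  unfolding wnorm2_def weight_def hcoef_def norm_mult norm_of_real power_mult_distrib power2_abs ..

lemma weight_nonneg: "0 \<le> weight m"
  by (simp add: weight_def)

text \<open>The coefficients at level \<open>L\<close> vanish on the additional modes of
  \<open>half_upto N\<close>, so the difference is a single linear form in \<open>h\<close> and the
  conditional moment bound applies to it.\<close>

lemma interaction_diff:
  assumes "L \<le> N"
  shows "interaction N \<omega> - interaction L \<omega> = lin (half_upto N) (1 / 2 * (quad N (\<lambda>n. g n \<omega>) - quad L (\<lambda>n. g n \<omega>)))
     (\<lambda>m. hcoef N (\<lambda>n. g n \<omega>) m - hcoef L (\<lambda>n. g n \<omega>) m) (\<lambda>m. h m \<omega>)"
proof -
  let ?c = "hcoef L (\<lambda>n. g n \<omega>)"
  have "(\<Sum>m\<in>half_upto N. Re (?c m * cnj (h m \<omega>))) = (\<Sum>m\<in>half_upto L. Re (?c m * cnj (h m \<omega>)))"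
  proof (rule sum.mono_neutral_right)
    show "half_upto L \<subseteq> half_upto N" by (rule half_upto_mono[OF assms])
    show "\<forall>m\<in>half_upto N - half_upto L. Re (?c m * cnj (h m \<omega>)) = 0"
    proof
      fix m assume "m \<in> half_upto N - half_upto L"
      then have "m \<notin> modes_upto (L + L)" by (auto simp: half_upto_def)
      then have "?c m = 0" unfolding hcoef_def by (simp add: corr_N_eq_0)
      then show "Re (?c m * cnj (h m \<omega>)) = 0" by simp
    qed
  qed simp
  then show ?thesis
    unfolding interaction_def lin_def left_diff_distrib minus_complex.sel sum_subtractf right_diff_distrib by simp
qed

lemma nn_integral_wick_power_finite: "(\<integral>\<^sup>+ \<omega>. ennreal (wick (modes_upto N) \<omega> ^ (2 * q)) \<partial>M) < \<infinity>"
  using nn_integral_wick_power_le[of "modes_upto N" 75 q] sum_jbracket4_total_le[of N]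
  by (auto intro: le_less_trans)

lemma nn_integral_wick_increment_le:
  "(\<integral>\<^sup>+ \<omega>. ennreal ((wick (modes_upto N) \<omega> - wick (modes_upto (min N (2 ^ k))) \<omega>) ^ (2 * q)) \<partial>M)
     \<le> ennreal (6 * fact (2 * q) * 4 ^ q * (50 / 4 ^ k) ^ q)"
proof -
  have "modes_upto (min N (2 ^ k)) \<subseteq> modes_upto N" by (intro modes_upto_mono) simp
  then have "wick (modes_upto N) \<omega> - wick (modes_upto (min N (2 ^ k))) \<omega> = wick (modes_upto N - modes_upto (min N (2 ^ k))) \<omega>" for \<omega>
    by (intro wick_diff) simp_all
  moreover have "(\<Sum>a\<in>modes_upto N - modes_upto (min N (2 ^ k)). 1 / jbracket a ^ 4) \<le> 50 / 4 ^ k"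
    by (intro sum_jbracket4_le) (auto simp: min_def)
  ultimately show ?thesis using nn_integral_wick_power_le[of "modes_upto N - modes_upto (min N (2 ^ k))" "50 / 4 ^ k" q] by simp
qed

text \<open>Only finiteness for each \<open>N\<close> is claimed, so the deterministic bound of the
  correlations by the mass suffices, with constants depending on \<open>N\<close>.\<close>

lemma nn_integral_interaction_power_finite: "(\<integral>\<^sup>+ \<omega>. ennreal (interaction N \<omega> ^ (2 * q)) \<partial>M) < \<infinity>"
proof -
  define C where "C = 25 * (4 * 2 powr (- s)) ^ Suc N"
  \<comment> \<open>The summand 1 makes \<open>V\<close> positive; the rest dominates the
    conditional variance.\<close>
  define V where "V x = 1 + (quad N x)\<^sup>2 + wnorm2 weight (half_upto N) (corr_N N (coef x))" for x
  have C: "0 \<le> C" by (simp add: C_def)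
  have m1: "(\<lambda>x. corr_N N (coef x) m) \<in> borel_measurable (PiM UNIV (\<lambda>_. borel))" for m
    by (intro borel_measurable_corr borel_measurable_coef measurable_component_singleton) simp
  have [measurable]: "V \<in> borel_measurable (PiM UNIV (\<lambda>_. borel))"
    unfolding V_def by (intro borel_measurable_add borel_measurable_const borel_measurable_power quad_measurable borel_measurable_wnorm2 m1)
  have W0: "0 \<le> wnorm2 weight (half_upto N) (corr_N N (coef x))" for x by (intro wnorm2_nonneg weight_nonneg)
  have "(\<integral>\<^sup>+ \<omega>. ennreal (interaction N \<omega> ^ (2 * q)) \<partial>M) \<le> ennreal (4 * fact (2 * q)) * (\<integral>\<^sup>+ \<omega>. ennreal (V (\<lambda>n. g n \<omega>) ^ q) \<partial>M)"
    unfolding interaction_def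
  proof (rule nn_integral_lin_power_le)
    show "half_upto N \<subseteq> half_modes - {0}" by (auto simp: half_upto_def)
    show "0 < V x" for x using W0[of x] by (simp add: V_def add_pos_nonneg)
    show "lin_var (half_upto N) (1 / 2 * quad N x) (hcoef N x) \<le> V x" for x
    proof -
      have "lin_var (half_upto N) (1 / 2 * quad N x) (hcoef N x) = (quad N x)\<^sup>2 / 4 + wnorm2 weight (half_upto N) (corr_N N (coef x)) / 2"
        unfolding lin_var_def sum_hcoef power_mult_distrib by (simp add: power_divide)
      then show ?thesis using W0[of x] zero_le_power2[of "quad N x"] unfolding V_def by linarith
    qed
  qed measurable
  also have "\<dots> < \<infinity>"
  proof -
    have bound: "V (\<lambda>n. g n \<omega>) ^ q \<le> 3 ^ q * (1 + 2 * C) ^ q * (1 + sigma_N N) ^ (2 * q) * (1 + wick (modes_upto N) \<omega> ^ (2 * q) + 1)" for \<omega>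
    proof -
      let ?w = "wick (modes_upto N) \<omega>"
      have sg: "0 \<le> sigma_N N" by (simp add: sigma_N_def sum_nonneg)
      have "wnorm2 weight (half_upto N) (corr_N N (modes_at \<omega>)) \<le> (mass (modes_upto N) (modes_at \<omega>))\<^sup>2 * C"
        unfolding C_def using s by (intro wnorm2_corr_N_le[OF _ _ admissible_weight]) (auto simp: less_imp_le)
      also have "mass (modes_upto N) (modes_at \<omega>) = ?w + sigma_N N" by (simp add: mass_modes_at sigma_N_def)
      also have "(?w + sigma_N N)\<^sup>2 \<le> 2 * ?w\<^sup>2 + 2 * (sigma_N N)\<^sup>2"
        using sum_squares_bound[of ?w "sigma_N N"] by (simp add: power2_sum)
      finally have wn: "wnorm2 weight (half_upto N) (corr_N N (modes_at \<omega>)) \<le> (2 * ?w\<^sup>2 + 2 * (sigma_N N)\<^sup>2) * C"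
        using C by (simp add: mult_right_mono)
      have "V (\<lambda>n. g n \<omega>) \<le> 1 + ?w\<^sup>2 + (2 * ?w\<^sup>2 + 2 * (sigma_N N)\<^sup>2) * C" using wn by (simp add: V_def quad_g)
      also have "\<dots> \<le> (1 + 2 * C) * (1 + sigma_N N)\<^sup>2 * (1 + ?w\<^sup>2 + 0)"
      proof -
        have S: "1 \<le> (1 + sigma_N N)\<^sup>2" "(sigma_N N)\<^sup>2 \<le> (1 + sigma_N N)\<^sup>2" using sg by (auto intro!: power_mono one_le_power)
        have "1 + ?w\<^sup>2 + (2 * ?w\<^sup>2 + 2 * (sigma_N N)\<^sup>2) * C = 1 + (sigma_N N)\<^sup>2 * (2 * C) + (1 + 2 * C) * ?w\<^sup>2" by (simp add: algebra_simps)
        also have "\<dots> \<le> (1 + sigma_N N)\<^sup>2 + (1 + sigma_N N)\<^sup>2 * (2 * C) + (1 + 2 * C) * (1 + sigma_N N)\<^sup>2 * ?w\<^sup>2"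
        proof (intro add_mono S mult_right_mono)
          show "1 + 2 * C \<le> (1 + 2 * C) * (1 + sigma_N N)\<^sup>2" using C mult_left_mono[OF S(1), of "1 + 2 * C"] by simp
        qed (use C in auto)
        finally show ?thesis by (simp add: algebra_simps)
      qed
      finally have "V (\<lambda>n. g n \<omega>) ^ q \<le> ((1 + 2 * C) * (1 + sigma_N N)\<^sup>2 * (1 + ?w\<^sup>2 + 0)) ^ q"
        using W0[of "\<lambda>n. g n \<omega>"] by (intro power_mono) (auto simp: V_def)
      also have "\<dots> = (1 + 2 * C) ^ q * (1 + sigma_N N) ^ (2 * q) * (1 + ?w\<^sup>2 + 0) ^ q"
        by (simp add: power_mult_distrib power_mult)
      also have "\<dots> \<le> (1 + 2 * C) ^ q * (1 + sigma_N N) ^ (2 * q) * (3 ^ q * (1 ^ q + (?w\<^sup>2) ^ q + 0 ^ q))"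
        using C sg by (intro mult_left_mono power_add3_le) auto
      also have "\<dots> \<le> (1 + 2 * C) ^ q * (1 + sigma_N N) ^ (2 * q) * (3 ^ q * (1 + ?w ^ (2 * q) + 1))"
        using C sg by (intro mult_left_mono add_mono) (auto simp: power_mult power_0_left)
      finally show ?thesis by (simp add: mult_ac)
    qed
    define R where "R = 3 ^ q * (1 + 2 * C) ^ q * (1 + sigma_N N) ^ (2 * q)"
    have R: "0 \<le> R" using C by (auto simp: R_def sigma_N_def sum_nonneg intro!: mult_nonneg_nonneg)
    have "(\<integral>\<^sup>+ \<omega>. ennreal (V (\<lambda>n. g n \<omega>) ^ q) \<partial>M) \<le> (\<integral>\<^sup>+ \<omega>. ennreal R * (ennreal (wick (modes_upto N) \<omega> ^ (2 * q)) + ennreal 2) \<partial>M)"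
    proof (intro nn_integral_mono ennreal_le_mult_add R)
      fix \<omega>
      show "V (\<lambda>n. g n \<omega>) ^ q \<le> R * (wick (modes_upto N) \<omega> ^ (2 * q) + 2)"
        using bound[of \<omega>] by (simp add: R_def algebra_simps)
    qed (auto simp: power_mult)
    also have "\<dots> = ennreal R * (\<integral>\<^sup>+ \<omega>. ennreal (wick (modes_upto N) \<omega> ^ (2 * q)) + ennreal 2 \<partial>M)"
      by (rule nn_integral_cmult) measurable
    also have "(\<integral>\<^sup>+ \<omega>. ennreal (wick (modes_upto N) \<omega> ^ (2 * q)) + ennreal 2 \<partial>M)
       = (\<integral>\<^sup>+ \<omega>. ennreal (wick (modes_upto N) \<omega> ^ (2 * q)) \<partial>M) + (\<integral>\<^sup>+ \<omega>. ennreal 2 \<partial>M)"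
      by (rule nn_integral_add) measurable
    also have "ennreal R * \<dots> < \<infinity>"
      using nn_integral_wick_power_finite[of N q] by (simp add: ennreal_mult_less_top emeasure_space_1)
    finally show ?thesis by (simp add: ennreal_mult_less_top)
  qed
  finally show ?thesis .
qed

text \<open>The three terms in the bracket belong to the Wick increment, the correlation increment
  and a constant in the variance bound; \<open>3 ^ q\<close> comes from the power of their sum and
  \<open>4 * fact (2 * q)\<close> from the conditional Gaussian moment.\<close>

definition rate :: "nat \<Rightarrow> nat \<Rightarrow> real" where
  "rate q k = 4 * fact (2 * q) * 3 ^ q * (6 * fact (2 * q) * 4 ^ q + 2 * (8 * real q + 4) ^ q * fact q * 2 ^ q + 1)
     * (tau s k + 50 / 4 ^ k) ^ q"

lemma rate_tendsto_0: "1 \<le> q \<Longrightarrow> rate q \<longlonglongrightarrow> 0"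
proof -
  assume "1 \<le> q"
  have "(\<lambda>k. 50 * (1 / 4) ^ k :: real) \<longlonglongrightarrow> 50 * 0" by (intro tendsto_intros LIMSEQ_power_zero) simp
  then have "(\<lambda>k. 50 / 4 ^ k :: real) \<longlonglongrightarrow> 0" by (simp add: power_divide)
  then have "(\<lambda>k. tau s k + 50 / 4 ^ k) \<longlonglongrightarrow> 0 + 0" by (intro tendsto_add tau_tendsto_0 s)
  then have "rate q \<longlonglongrightarrow> 4 * fact (2 * q) * 3 ^ q * (6 * fact (2 * q) * 4 ^ q + 2 * (8 * real q + 4) ^ q * fact q * 2 ^ q + 1) * (0 + 0) ^ q"
    unfolding rate_def by (rule tendsto_mult[OF tendsto_const tendsto_power])
  then show ?thesis using \<open>1 \<le> q\<close> by (simp add: power_0_left)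
qed

text \<open>The conditional variance of the increment consists of the squared increment of the Wick
  mass and the squared norm of the increment of the correlations; the moments of both decay in
  \<open>k\<close> uniformly in \<open>N\<close>.\<close>

lemma nn_integral_interaction_increment_le:
  "(\<integral>\<^sup>+ \<omega>. ennreal ((interaction N \<omega> - interaction (min N (2 ^ k)) \<omega>) ^ (2 * q)) \<partial>M) \<le> ennreal (rate q k)"
proof -
  define L where "L = min N (2 ^ k)"
  \<comment> \<open>Dominates both rates and, added to the variance bound \<open>V\<close>, keeps it
    positive.\<close>
  define \<delta> where "\<delta> = tau s k + 50 / 4 ^ k"
  have \<delta>: "0 < \<delta>" "50 / 4 ^ k \<le> \<delta>" "tau s k \<le> \<delta>" "0 < tau s k"
    using tau_pos[OF s(1), of k] by (auto simp: \<delta>_def add_pos_pos)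
  define D where "D x = wnorm2 weight (half_upto N) (\<lambda>m. corr_N N (coef x) m - corr_N L (coef x) m)" for x
  define V where "V x = (quad N x - quad L x)\<^sup>2 + D x + \<delta>" for x
  have m1: "(\<lambda>x. corr_N n (coef x) m) \<in> borel_measurable (PiM UNIV (\<lambda>_. borel))" for m n
    by (intro borel_measurable_corr borel_measurable_coef measurable_component_singleton) simp
  have [measurable]: "D \<in> borel_measurable (PiM UNIV (\<lambda>_. borel))"
    unfolding D_def by (intro borel_measurable_wnorm2 borel_measurable_diff m1)
  have [measurable]: "V \<in> borel_measurable (PiM UNIV (\<lambda>_. borel))" unfolding V_def by measurable
  have D0: "0 \<le> D x" for x unfolding D_def by (intro wnorm2_nonneg weight_nonneg)
  have "(\<integral>\<^sup>+ \<omega>. ennreal ((interaction N \<omega> - interaction L \<omega>) ^ (2 * q)) \<partial>M) \<le> ennreal (4 * fact (2 * q)) * (\<integral>\<^sup>+ \<omega>. ennreal (V (\<lambda>n. g n \<omega>) ^ q) \<partial>M)"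
    unfolding interaction_diff[of L N, OF min.cobounded1[of N "2 ^ k", folded L_def]]
  proof (rule nn_integral_lin_power_le)
    show "half_upto N \<subseteq> half_modes - {0}" by (auto simp: half_upto_def)
    show "0 < V x" for x unfolding V_def using D0[of x] \<delta>(1) by (intro add_nonneg_pos add_nonneg_nonneg) auto
    show "lin_var (half_upto N) (1 / 2 * (quad N x - quad L x)) (\<lambda>m. hcoef N x m - hcoef L x m) \<le> V x" for x
    proof -
      have "lin_var (half_upto N) (1 / 2 * (quad N x - quad L x)) (\<lambda>m. hcoef N x m - hcoef L x m) = (quad N x - quad L x)\<^sup>2 / 4 + D x / 2"
        unfolding lin_var_def sum_hcoef_diff D_def power_mult_distrib by (simp add: power_divide)
      then show ?thesis using D0[of x] \<delta>(1) zero_le_power2[of "quad N x - quad L x"] unfolding V_def by linarith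
    qed
  qed measurable
  also have "\<dots> \<le> ennreal (4 * fact (2 * q)) * ennreal (3 ^ q * (6 * fact (2 * q) * 4 ^ q + 2 * (8 * real q + 4) ^ q * fact q * 2 ^ q + 1) * \<delta> ^ q)"
  proof (rule mult_left_mono)
    let ?w = "\<lambda>\<omega>. wick (modes_upto N) \<omega> - wick (modes_upto L) \<omega>"
    have "(\<integral>\<^sup>+ \<omega>. ennreal (V (\<lambda>n. g n \<omega>) ^ q) \<partial>M)
       \<le> (\<integral>\<^sup>+ \<omega>. ennreal (3 ^ q) * (ennreal (?w \<omega> ^ (2 * q)) + ennreal ((D (\<lambda>n. g n \<omega>)) ^ q + \<delta> ^ q)) \<partial>M)"
    proof (intro nn_integral_mono ennreal_le_mult_add)
      fix \<omega>
      show "V (\<lambda>n. g n \<omega>) ^ q \<le> 3 ^ q * (?w \<omega> ^ (2 * q) + (D (\<lambda>n. g n \<omega>) ^ q + \<delta> ^ q))"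
        unfolding V_def quad_g power_mult add.assoc[symmetric] using D0 \<delta>(1) by (intro power_add3_le) auto
    qed (use D0 \<delta>(1) in \<open>auto simp: power_mult\<close>)
    also have "\<dots> = ennreal (3 ^ q) * (\<integral>\<^sup>+ \<omega>. ennreal (?w \<omega> ^ (2 * q)) + ennreal ((D (\<lambda>n. g n \<omega>)) ^ q + \<delta> ^ q) \<partial>M)"
      by (rule nn_integral_cmult) measurable
    also have "(\<integral>\<^sup>+ \<omega>. ennreal (?w \<omega> ^ (2 * q)) + ennreal ((D (\<lambda>n. g n \<omega>)) ^ q + \<delta> ^ q) \<partial>M)
       = (\<integral>\<^sup>+ \<omega>. ennreal (?w \<omega> ^ (2 * q)) \<partial>M) + (\<integral>\<^sup>+ \<omega>. ennreal ((D (\<lambda>n. g n \<omega>)) ^ q + \<delta> ^ q) \<partial>M)"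
      by (rule nn_integral_add) measurable
    also have "(\<integral>\<^sup>+ \<omega>. ennreal ((D (\<lambda>n. g n \<omega>)) ^ q + \<delta> ^ q) \<partial>M) = (\<integral>\<^sup>+ \<omega>. ennreal ((D (\<lambda>n. g n \<omega>)) ^ q) + ennreal (\<delta> ^ q) \<partial>M)"
      using D0 \<delta>(1) by (intro nn_integral_cong ennreal_plus) auto
    also have "\<dots> = (\<integral>\<^sup>+ \<omega>. ennreal ((D (\<lambda>n. g n \<omega>)) ^ q) \<partial>M) + (\<integral>\<^sup>+ \<omega>. ennreal (\<delta> ^ q) \<partial>M)"
      by (rule nn_integral_add) measurable
    also have "ennreal (3 ^ q) * ((\<integral>\<^sup>+ \<omega>. ennreal (?w \<omega> ^ (2 * q)) \<partial>M) + \<dots>)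
       \<le> ennreal (3 ^ q) * (ennreal (6 * fact (2 * q) * 4 ^ q * \<delta> ^ q) + (ennreal (2 * (8 * real q + 4) ^ q * fact q * 2 ^ q * \<delta> ^ q) + ennreal (\<delta> ^ q)))"
    proof (rule mult_left_mono[OF add_mono[OF _ add_mono]])
      show "(\<integral>\<^sup>+ \<omega>. ennreal (?w \<omega> ^ (2 * q)) \<partial>M) \<le> ennreal (6 * fact (2 * q) * 4 ^ q * \<delta> ^ q)"
        unfolding L_def using \<delta> by (intro order.trans[OF nn_integral_wick_increment_le] ennreal_leI mult_left_mono power_mono) auto
      show "(\<integral>\<^sup>+ \<omega>. ennreal (D (\<lambda>n. g n \<omega>) ^ q) \<partial>M) \<le> ennreal (2 * (8 * real q + 4) ^ q * fact q * 2 ^ q * \<delta> ^ q)"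
        unfolding L_def D_def using \<delta> s by (intro order.trans[OF nn_integral_incr_power_le[OF _ _ admissible_weight]] ennreal_leI mult_left_mono power_mono) auto
      show "(\<integral>\<^sup>+ \<omega>. ennreal (\<delta> ^ q) \<partial>M) \<le> ennreal (\<delta> ^ q)" by (simp add: emeasure_space_1)
    qed simp
    also have "\<dots> = ennreal (3 ^ q * (6 * fact (2 * q) * 4 ^ q * \<delta> ^ q + (2 * (8 * real q + 4) ^ q * fact q * 2 ^ q * \<delta> ^ q + \<delta> ^ q)))"
    proof -
      have p: "0 \<le> 6 * fact (2 * q) * 4 ^ q * \<delta> ^ q" "0 \<le> 2 * (8 * real q + 4) ^ q * fact q * 2 ^ q * \<delta> ^ q" "0 \<le> \<delta> ^ q"
        using \<delta>(1) by auto
      show ?thesis by (subst ennreal_mult) (use p in \<open>simp_all only: ennreal_plus add_nonneg_nonneg zero_le_power zero_le_numeral\<close>)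
    qed
    also have "3 ^ q * (6 * fact (2 * q) * 4 ^ q * \<delta> ^ q + (2 * (8 * real q + 4) ^ q * fact q * 2 ^ q * \<delta> ^ q + \<delta> ^ q))
        = 3 ^ q * (6 * fact (2 * q) * 4 ^ q + 2 * (8 * real q + 4) ^ q * fact q * 2 ^ q + 1) * \<delta> ^ q"
      by (simp only: distrib_left distrib_right mult.assoc mult_1 add.assoc)
    finally show "(\<integral>\<^sup>+ \<omega>. ennreal (V (\<lambda>n. g n \<omega>) ^ q) \<partial>M) \<le> ennreal (3 ^ q * (6 * fact (2 * q) * 4 ^ q + 2 * (8 * real q + 4) ^ q * fact q * 2 ^ q + 1) * \<delta> ^ q)" .
  qed simp
  also have "\<dots> = ennreal (rate q k)"
    unfolding rate_def \<delta>_def[symmetric] using \<delta>(1) by (subst ennreal_mult[symmetric]) (auto simp: mult.assoc)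
  finally show ?thesis unfolding L_def .
qed

text \<open>Integration over \<open>h\<close> replaces \<open>- p\<close> times the interaction by
  \<open>p\<^sup>2 / 2\<close> times its conditional variance. The zero mode contributes
  \<open>p\<^sup>2 / 8\<close> times the squared Wick mass, bounded by the cutoff; the other modes
  contribute \<open>C = p\<^sup>2 / 4\<close> times the weighted norm, estimated on the larger event
  where the Wick mass is at most \<open>K\<close>.\<close>

lemma cut_exp_interaction_bounded:
  assumes K: "0 \<le> K" and p: "1 \<le> p"
  shows "\<exists>B. \<forall>N. (\<integral>\<^sup>+ \<omega>. ennreal (\<bar>cut_exp K (wick (modes_upto N)) (interaction N) \<omega>\<bar> powr p) \<partial>M) \<le> ennreal B"
proof -
  define C where "C = p\<^sup>2 / 4"
  obtain B where B: "0 \<le> B" "\<And>N \<rho> D. admissible s \<rho> D \<Longrightarrow>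
    (\<integral>\<^sup>+ \<omega>. ennreal (indicator {\<omega>. wick (modes_upto N) \<omega> \<le> K} \<omega> * exp (C * wnorm2 \<rho> D (corr_N N (modes_at \<omega>)))) \<partial>M) \<le> ennreal B"
    using exp_wnorm2_cutoff_bounded[OF s K, of C] by (auto simp: C_def)
  have "(\<integral>\<^sup>+ \<omega>. ennreal (\<bar>cut_exp K (wick (modes_upto N)) (interaction N) \<omega>\<bar> powr p) \<partial>M) \<le> ennreal (exp (p\<^sup>2 * K\<^sup>2 / 8) * B)" for N
  proof -
    let ?E = "half_upto N" and ?G = "\<lambda>\<omega> n. g n \<omega>"
    define \<Phi> where "\<Phi> x = (if \<bar>quad N x\<bar> \<le> K then 1 else 0 :: ennreal)" for x
    define a where "a x = - p * (1 / 2 * quad N x)" for x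
    define c where "c x m = of_real (- p) * hcoef N x m" for x m
    have [measurable]: "\<Phi> \<in> borel_measurable (PiM UNIV (\<lambda>_. borel))" unfolding \<Phi>_def by measurable
    have [measurable]: "a \<in> borel_measurable (PiM UNIV (\<lambda>_. borel))" unfolding a_def by measurable
    have [measurable]: "(\<lambda>x. c x m) \<in> borel_measurable (PiM UNIV (\<lambda>_. borel))" for m unfolding c_def by measurable
    have lin: "lin ?E (a x) (c x) y = - p * lin ?E (1 / 2 * quad N x) (hcoef N x) y" for x y
      by (simp add: lin_def a_def c_def sum_distrib_left sum_negf distrib_left right_diff_distrib mult.assoc minus_mult_left[symmetric] sum_subtractf)
    have var: "lin_var ?E (a x) (c x) / 2 = p\<^sup>2 * (quad N x)\<^sup>2 / 8 + C * wnorm2 weight ?E (corr_N N (coef x))" for x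
      unfolding lin_var_def a_def c_def norm_mult norm_of_real power_mult_distrib power2_abs sum_distrib_left[symmetric] sum_hcoef
      by (simp add: C_def power_divide add_divide_distrib)
    have "(\<integral>\<^sup>+ \<omega>. ennreal (\<bar>cut_exp K (wick (modes_upto N)) (interaction N) \<omega>\<bar> powr p) \<partial>M)
       = (\<integral>\<^sup>+ \<omega>. \<Phi> (?G \<omega>) * ennreal (exp (lin ?E (a (?G \<omega>)) (c (?G \<omega>)) (\<lambda>m. h m \<omega>))) \<partial>M)"
    proof (rule nn_integral_cong)
      fix \<omega>
      show "ennreal (\<bar>cut_exp K (wick (modes_upto N)) (interaction N) \<omega>\<bar> powr p) = \<Phi> (?G \<omega>) * ennreal (exp (lin ?E (a (?G \<omega>)) (c (?G \<omega>)) (\<lambda>m. h m \<omega>)))"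
        unfolding lin interaction_def[symmetric] using p
        by (simp add: cut_exp_def \<Phi>_def quad_g indicator_def abs_mult exp_powr_real mult.commute)
    qed
    also have "\<dots> = (\<integral>\<^sup>+ \<omega>. \<Phi> (?G \<omega>) * ennreal (exp (lin_var ?E (a (?G \<omega>)) (c (?G \<omega>)) / 2)) \<partial>M)"
      by (rule nn_integral_condition_g) (auto simp: half_upto_def)
    also have "\<dots> \<le> (\<integral>\<^sup>+ \<omega>. ennreal (exp (p\<^sup>2 * K\<^sup>2 / 8)) * ennreal (indicator {\<omega>. wick (modes_upto N) \<omega> \<le> K} \<omega> * exp (C * wnorm2 weight ?E (corr_N N (modes_at \<omega>)))) \<partial>M)"
    proof (rule nn_integral_mono)
      fix \<omega>
      show "\<Phi> (?G \<omega>) * ennreal (exp (lin_var ?E (a (?G \<omega>)) (c (?G \<omega>)) / 2))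
         \<le> ennreal (exp (p\<^sup>2 * K\<^sup>2 / 8)) * ennreal (indicator {\<omega>. wick (modes_upto N) \<omega> \<le> K} \<omega> * exp (C * wnorm2 weight ?E (corr_N N (modes_at \<omega>))))"
      proof (cases "\<bar>wick (modes_upto N) \<omega>\<bar> \<le> K")
        case True
        then have "(wick (modes_upto N) \<omega>)\<^sup>2 \<le> K\<^sup>2" using power_mono[OF True, of 2] by simp
        then have "p\<^sup>2 * (wick (modes_upto N) \<omega>)\<^sup>2 / 8 \<le> p\<^sup>2 * K\<^sup>2 / 8" by (simp add: mult_left_mono)
        then have "exp (p\<^sup>2 * (wick (modes_upto N) \<omega>)\<^sup>2 / 8 + C * wnorm2 weight ?E (corr_N N (modes_at \<omega>)))
           \<le> exp (p\<^sup>2 * K\<^sup>2 / 8 + C * wnorm2 weight ?E (corr_N N (modes_at \<omega>)))" by simp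
        also have "\<dots> = exp (p\<^sup>2 * K\<^sup>2 / 8) * exp (C * wnorm2 weight ?E (corr_N N (modes_at \<omega>)))" by (rule exp_add)
        finally show ?thesis using True unfolding var quad_g \<Phi>_def
          by (simp add: ennreal_mult[symmetric] ennreal_leI)
      qed (simp add: \<Phi>_def quad_g)
    qed
    also have "\<dots> = ennreal (exp (p\<^sup>2 * K\<^sup>2 / 8)) * (\<integral>\<^sup>+ \<omega>. ennreal (indicator {\<omega>. wick (modes_upto N) \<omega> \<le> K} \<omega> * exp (C * wnorm2 weight ?E (corr_N N (modes_at \<omega>)))) \<partial>M)"
    proof (rule nn_integral_cmult)
      have "(\<lambda>\<omega>. indicator {\<omega>. wick (modes_upto N) \<omega> \<le> K} \<omega> :: real) = (\<lambda>\<omega>. if wick (modes_upto N) \<omega> \<le> K then 1 else 0)"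
        by (auto simp: indicator_def)
      moreover have "(\<lambda>\<omega>. if wick (modes_upto N) \<omega> \<le> K then 1 else 0 :: real) \<in> borel_measurable M" by measurable
      ultimately have [measurable]: "(\<lambda>\<omega>. indicator {\<omega>. wick (modes_upto N) \<omega> \<le> K} \<omega> :: real) \<in> borel_measurable M" by simp
      have [measurable]: "(\<lambda>\<omega>. wnorm2 weight ?E (corr_N N (modes_at \<omega>))) \<in> borel_measurable M"
        by (intro wnorm2_measurable corr_measurable)
      show "(\<lambda>\<omega>. ennreal (indicator {\<omega>. wick (modes_upto N) \<omega> \<le> K} \<omega> * exp (C * wnorm2 weight ?E (corr_N N (modes_at \<omega>))))) \<in> borel_measurable M"
        by measurable
    qed
    also have "\<dots> \<le> ennreal (exp (p\<^sup>2 * K\<^sup>2 / 8)) * ennreal B"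
      by (intro mult_left_mono B(2) admissible_weight) simp
    also have "\<dots> = ennreal (exp (p\<^sup>2 * K\<^sup>2 / 8) * B)" using B(1) by (subst ennreal_mult[symmetric]) auto
    finally show ?thesis .
  qed
  then show ?thesis by blast
qed

end

section \<open>The Gibbs measures\<close>

theorem theorem1p5:
  fixes \<gamma> K :: real
    and M :: "'a measure"
    and g h l :: "mode \<Rightarrow> 'a \<Rightarrow> complex"
    and u w0 w1 :: "'a \<Rightarrow> dist"
  assumes "0 \<le> \<gamma>" and "\<gamma> < 1" and "0 < K"
    and "gaussian_family M g h l"
    and "gaussian_fields \<gamma> M g h l u w0 w1"
  shows "let \<mu> = law_u M u;
             \<nu> = law_triple M u w0 w1;
             f = (\<lambda>N. cutoff_weight K (wick_mass N) (Q_N N))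
    in \<exists>(m :: dist \<Rightarrow> real) (Q :: dist \<Rightarrow> dist \<Rightarrow> real).
         (\<forall>p\<ge>1. Lp_tendsto \<mu> p wick_mass m) \<and>
         (\<forall>p\<ge>1. Lp_tendsto \<nu> p (\<lambda>N (u, w, w'). Q_N N u w) (\<lambda>(u, w, w'). Q u w)) \<and>
         (\<forall>p\<ge>1. \<exists>C>0. \<forall>N. in_Lp \<nu> p (f N) \<and> Lp_norm \<nu> p (f N) \<le> C) \<and>
         (\<forall>p\<ge>1. Lp_tendsto \<nu> p f (cutoff_weight K m Q)) \<and>
         (\<forall>N. prob_space (gibbs_measure \<nu> (f N))) \<and>
         prob_space (gibbs_measure \<nu> (cutoff_weight K m Q)) \<and>
         (\<forall>p\<ge>1. Lp_tendsto \<nu> p (\<lambda>N. gibbs_density \<nu> (f N))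
                                  (gibbs_density \<nu> (cutoff_weight K m Q))) \<and>
         absolutely_continuous \<nu> (gibbs_measure \<nu> (cutoff_weight K m Q))"
proof -
  \<comment> \<open>The parameter \<open>s\<close> is the decay exponent of the coefficients of
    \<open>w0\<close>.\<close>
  interpret gaussian_interaction M g h l "1 - \<gamma>"
    using assms by unfold_locales auto
  let ?S = "dist_space \<Otimes>\<^sub>M real_dist_space \<Otimes>\<^sub>M real_dist_space"
  define T where "T \<omega> = (u \<omega>, w0 \<omega>, w1 \<omega>)" for \<omega>
  define \<nu> where "\<nu> = law_triple M u w0 w1"
  define f where "f N = cutoff_weight K (wick_mass N) (Q_N N)" for N
  have fields: "u \<in> measurable M dist_space" "w0 \<in> measurable M real_dist_space" "w1 \<in> measurable M real_dist_space"
    "AE \<omega> in M. is_fourier_series (\<lambda>n. g n \<omega> / of_real (jbracket n)) (u \<omega>)"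
    "AE \<omega> in M. is_fourier_series (\<lambda>n. h n \<omega> / of_real (jbracket n powr (1 - \<gamma>))) (w0 \<omega>)"
    using assms(5) unfolding gaussian_fields_def by blast+
  note [measurable] = fields(1-3)
  have T[measurable]: "T \<in> measurable M ?S" unfolding T_def by measurable
  have \<nu>_eq: "\<nu> = distr M ?S T" by (simp add: \<nu>_def law_triple_def T_def[abs_def])
  interpret \<nu>: prob_space \<nu> unfolding \<nu>_eq by (rule prob_space_distr) simp
  \<comment> \<open>All estimates live on the probability space; \<open>X\<close> and
    \<open>Y\<close> are the functionals pulled back along the fields, and the results return to the
    laws by change of variables.\<close>
  define X where "X N \<omega> = wick_mass N (u \<omega>)" for N \<omega>
  define Y where "Y N \<omega> = Q_N N (u \<omega>) (w0 \<omega>)" for N \<omega>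
  have [measurable]: "X N \<in> borel_measurable M" for N
    unfolding X_def[abs_def] by (rule measurable_compose[OF fields(1) wick_mass_measurable])
  have [measurable]: "Y N \<in> borel_measurable M" for N
    using measurable_compose[OF T Q_N_measurable[of N]] by (simp add: Y_def[abs_def] T_def)
  have u_coef: "AE \<omega> in M. fourier_coeff (u \<omega>) = modes_at \<omega>"
    using fields(4)
  proof eventually_elim
    case (elim \<omega>)
    show ?case using fourier_coeff_of_series[OF elim] by (simp add: fun_eq_iff coef_def)
  qed
  \<comment> \<open>One exceptional null set serves all \<open>N\<close>, so the identity can be
    used inside limits.\<close>
  have X_eq: "AE \<omega> in M. \<forall>N. X N \<omega> = wick (modes_upto N) \<omega>"
    using u_coef
  proof eventually_elim
    case (elim \<omega>)
    show ?case by (simp add: X_def wick_mass_eq elim mass_modes_at sigma_N_def)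
  qed
  have Y_eq: "AE \<omega> in M. \<forall>N. Y N \<omega> = interaction N \<omega>"
    using u_coef X_eq fields(5) AE_space
  proof eventually_elim
    case (elim \<omega>)
    have w: "w0 \<omega> \<in> real_distributions"
      using measurable_space[OF fields(2) elim(4)] space_real_dist_space by blast
    have "fourier_coeff (w0 \<omega>) n = of_real (jbracket n powr (- (1 - \<gamma>))) * h n \<omega>" for n
      unfolding fourier_coeff_of_series[OF elim(3)] powr_minus by (simp add: divide_inverse mult.commute)
    moreover have "jbracket 0 = 1" by (simp add: jbracket_def freq_def flip: zero_prod_def)
    ultimately show ?case
      using elim(2) by (simp add: Y_def Q_N_eq[OF w] X_def elim(1) interaction_def lin_def quad_g hcoef_def mult_ac)
  qed
  have X_mom: "(\<integral>\<^sup>+ \<omega>. ennreal (X N \<omega> ^ (2 * q)) \<partial>M) < \<infinity>" for N q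
  proof -
    have "(\<integral>\<^sup>+ \<omega>. ennreal (X N \<omega> ^ (2 * q)) \<partial>M) = (\<integral>\<^sup>+ \<omega>. ennreal (wick (modes_upto N) \<omega> ^ (2 * q)) \<partial>M)"
      using X_eq by (intro nn_integral_cong_AE) (auto elim!: eventually_mono)
    then show ?thesis using nn_integral_wick_power_finite by simp
  qed
  have X_inc: "(\<integral>\<^sup>+ \<omega>. ennreal ((X N \<omega> - X (min N (2 ^ k)) \<omega>) ^ (2 * q)) \<partial>M) \<le> ennreal (6 * fact (2 * q) * 4 ^ q * (50 / 4 ^ k) ^ q)" for N k q
  proof -
    have "(\<integral>\<^sup>+ \<omega>. ennreal ((X N \<omega> - X (min N (2 ^ k)) \<omega>) ^ (2 * q)) \<partial>M)
      = (\<integral>\<^sup>+ \<omega>. ennreal ((wick (modes_upto N) \<omega> - wick (modes_upto (min N (2 ^ k))) \<omega>) ^ (2 * q)) \<partial>M)"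
      using X_eq by (intro nn_integral_cong_AE) (auto elim!: eventually_mono)
    then show ?thesis using nn_integral_wick_increment_le by simp
  qed
  have X_rate: "(\<lambda>k. 6 * fact (2 * q) * 4 ^ q * (50 / 4 ^ k) ^ q :: real) \<longlonglongrightarrow> 0" if "1 \<le> q" for q
  proof -
    have "(\<lambda>k. 50 * (1 / 4) ^ k :: real) \<longlonglongrightarrow> 50 * 0" by (intro tendsto_intros LIMSEQ_power_zero) simp
    then have "(\<lambda>k. 50 / 4 ^ k :: real) \<longlonglongrightarrow> 0" by (simp add: power_divide)
    from tendsto_mult[OF tendsto_const tendsto_power[OF this, of q], of "6 * fact (2 * q) * 4 ^ q"]
    show ?thesis using that by (simp add: power_0_left)
  qed
  obtain r where r: "AE \<omega> in M. convergent (\<lambda>i. X (r i) \<omega>)"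
    "\<And>p. 1 \<le> p \<Longrightarrow> Lp_tendsto M p X (\<lambda>\<omega>. lim (\<lambda>i. X (r i) \<omega>))"
    by (rule Lp_limit_of_even_moments[of X, OF _ X_mom X_inc X_rate]) auto
  have Y_mom: "(\<integral>\<^sup>+ \<omega>. ennreal (Y N \<omega> ^ (2 * q)) \<partial>M) < \<infinity>" for N q
  proof -
    have "(\<integral>\<^sup>+ \<omega>. ennreal (Y N \<omega> ^ (2 * q)) \<partial>M) = (\<integral>\<^sup>+ \<omega>. ennreal (interaction N \<omega> ^ (2 * q)) \<partial>M)"
      using Y_eq by (intro nn_integral_cong_AE) (auto elim!: eventually_mono)
    then show ?thesis using nn_integral_interaction_power_finite by simp
  qed
  have Y_inc: "(\<integral>\<^sup>+ \<omega>. ennreal ((Y N \<omega> - Y (min N (2 ^ k)) \<omega>) ^ (2 * q)) \<partial>M) \<le> ennreal (rate q k)" for N k q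
  proof -
    have "(\<integral>\<^sup>+ \<omega>. ennreal ((Y N \<omega> - Y (min N (2 ^ k)) \<omega>) ^ (2 * q)) \<partial>M)
      = (\<integral>\<^sup>+ \<omega>. ennreal ((interaction N \<omega> - interaction (min N (2 ^ k)) \<omega>) ^ (2 * q)) \<partial>M)"
      using Y_eq by (intro nn_integral_cong_AE) (auto elim!: eventually_mono)
    then show ?thesis using nn_integral_interaction_increment_le by simp
  qed
  obtain r' where r': "AE \<omega> in M. convergent (\<lambda>i. Y (r' i) \<omega>)"
    "\<And>p. 1 \<le> p \<Longrightarrow> Lp_tendsto M p Y (\<lambda>\<omega>. lim (\<lambda>i. Y (r' i) \<omega>))"
    by (rule Lp_limit_of_even_moments[of Y, OF _ Y_mom Y_inc rate_tendsto_0]) auto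
  \<comment> \<open>Limits along the subsequences found above, now as functions of distributions;
    the value of \<open>lim\<close> is unspecified where the sequence diverges, which happens only
    on a null set.\<close>
  define m where "m u = lim (\<lambda>i. wick_mass (r i) u)" for u
  define Q where "Q u w = lim (\<lambda>i. Q_N (r' i) u w)" for u w
  define X' where "X' \<omega> = m (u \<omega>)" for \<omega>
  define Y' where "Y' \<omega> = Q (u \<omega>) (w0 \<omega>)" for \<omega>
  define F where "F = cutoff_weight K m Q"
  have LX: "Lp_tendsto M p X X'" if "1 \<le> p" for p
    using r(2)[OF that] by (simp add: X'_def[abs_def] m_def X_def)
  have LY: "Lp_tendsto M p Y Y'" if "1 \<le> p" for p
    using r'(2)[OF that] by (simp add: Y'_def[abs_def] Q_def Y_def)
  have lim_wick: "AE \<omega> in M. (\<lambda>i. wick (modes_upto (r i)) \<omega>) \<longlonglongrightarrow> X' \<omega>"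
    using r(1) X_eq
  proof eventually_elim
    case (elim \<omega>)
    then have "(\<lambda>i. X (r i) \<omega>) \<longlonglongrightarrow> X' \<omega>" by (simp add: convergent_LIMSEQ_iff X'_def m_def X_def)
    then show ?case using elim(2) by simp
  qed
  have fT: "f N (T \<omega>) = cut_exp K (X N) (Y N) \<omega>" for N \<omega>
    by (simp add: f_def cutoff_weight_def T_def cut_exp_def X_def Y_def indicator_def)
  have FT: "F (T \<omega>) = cut_exp K X' Y' \<omega>" for \<omega>
    by (simp add: F_def cutoff_weight_def T_def cut_exp_def X'_def Y'_def indicator_def)
  have bound: "\<exists>B. \<forall>N. (\<integral>\<^sup>+ \<omega>. ennreal (\<bar>cut_exp K (X N) (Y N) \<omega>\<bar> powr p) \<partial>M) \<le> ennreal B" if p: "1 \<le> p" for p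
  proof -
    obtain B where B: "\<And>N. (\<integral>\<^sup>+ \<omega>. ennreal (\<bar>cut_exp K (wick (modes_upto N)) (interaction N) \<omega>\<bar> powr p) \<partial>M) \<le> ennreal B"
      using cut_exp_interaction_bounded[of K p] p assms(3) by auto
    have "(\<integral>\<^sup>+ \<omega>. ennreal (\<bar>cut_exp K (X N) (Y N) \<omega>\<bar> powr p) \<partial>M)
       = (\<integral>\<^sup>+ \<omega>. ennreal (\<bar>cut_exp K (wick (modes_upto N)) (interaction N) \<omega>\<bar> powr p) \<partial>M)" for N
    proof (rule nn_integral_cong_AE)
      show "AE \<omega> in M. ennreal (\<bar>cut_exp K (X N) (Y N) \<omega>\<bar> powr p) = ennreal (\<bar>cut_exp K (wick (modes_upto N)) (interaction N) \<omega>\<bar> powr p)"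
        using X_eq Y_eq by eventually_elim (simp add: cut_exp_def indicator_def)
    qed
    with B show ?thesis by auto
  qed
  have null: "AE \<omega> in M. \<bar>X' \<omega>\<bar> \<noteq> K" by (rule wick_limit_cutoff(2)[OF assms(3) lim_wick])
  have LW: "Lp_tendsto M p (\<lambda>N. cut_exp K (X N) (Y N)) (cut_exp K X' Y')" if "1 \<le> p" for p
    by (rule Lp_tendsto_cut_exp[OF LX LY null bound that]) auto
  have pos: "0 < (\<integral>\<omega>. cut_exp K V W \<omega> \<partial>M)"
    if "in_Lp M 1 (cut_exp K V W)" "\<not> (AE \<omega> in M. \<not> \<bar>V \<omega>\<bar> \<le> K)" for V W
  proof -
    have int: "integrable M (cut_exp K V W)" using that(1) by (simp add: in_Lp_iff integrable_iff_bounded)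
    have nn: "0 \<le> cut_exp K V W \<omega>" for \<omega> by (simp add: cut_exp_def)
    have "(\<integral>\<omega>. cut_exp K V W \<omega> \<partial>M) \<noteq> 0"
    proof
      assume "(\<integral>\<omega>. cut_exp K V W \<omega> \<partial>M) = 0"
      then have "AE \<omega> in M. cut_exp K V W \<omega> = 0"
        using integral_nonneg_eq_0_iff_AE[OF int] nn by auto
      then have "AE \<omega> in M. \<not> \<bar>V \<omega>\<bar> \<le> K" by eventually_elim (auto simp: cut_exp_def indicator_def)
      with that(2) show False by contradiction
    qed
    moreover have "0 \<le> (\<integral>\<omega>. cut_exp K V W \<omega> \<partial>M)" using nn by simp
    ultimately show ?thesis by simp
  qed
  have pos_N: "0 < (\<integral>\<omega>. cut_exp K (X N) (Y N) \<omega> \<partial>M)" for N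
  proof (rule pos)
    show "in_Lp M 1 (cut_exp K (X N) (Y N))" using LW[of 1] by (simp add: Lp_tendsto_def)
    have "AE \<omega> in M. \<not> \<bar>wick (modes_upto N) \<omega>\<bar> \<le> K" if "AE \<omega> in M. \<not> \<bar>X N \<omega>\<bar> \<le> K"
      using that X_eq by eventually_elim simp
    with wick_cutoff_pos[OF assms(3), of N] show "\<not> (AE \<omega> in M. \<not> \<bar>X N \<omega>\<bar> \<le> K)" by blast
  qed
  have pos_lim: "0 < (\<integral>\<omega>. cut_exp K X' Y' \<omega> \<partial>M)"
  proof (rule pos)
    show "in_Lp M 1 (cut_exp K X' Y')" using LW[of 1] by (simp add: Lp_tendsto_def)
    show "\<not> (AE \<omega> in M. \<not> \<bar>X' \<omega>\<bar> \<le> K)" by (rule wick_limit_cutoff(1)[OF assms(3) lim_wick])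
  qed
  have m_meas[measurable]: "m \<in> borel_measurable dist_space" unfolding m_def by measurable
  have QN_meas[measurable]: "(\<lambda>z. Q_N N (fst z) (fst (snd z))) \<in> borel_measurable ?S" for N
    using Q_N_measurable[of N] by (simp add: case_prod_beta')
  have Q_meas[measurable]: "(\<lambda>z. Q (fst z) (fst (snd z))) \<in> borel_measurable ?S" unfolding Q_def by measurable
  have cw: "cutoff_weight K m' Q' = (\<lambda>z. (if \<bar>m' (fst z)\<bar> \<le> K then 1 else 0) * exp (- Q' (fst z) (fst (snd z))))" for m' Q'
    by (auto simp: cutoff_weight_def indicator_def fun_eq_iff)
  have f_meas[measurable]: "f N \<in> borel_measurable ?S" for N unfolding f_def cw by measurable
  have F_meas[measurable]: "F \<in> borel_measurable ?S" unfolding F_def cw by measurable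
  have Lf: "Lp_tendsto \<nu> p f F" if "1 \<le> p" for p
    unfolding \<nu>_eq by (subst Lp_tendsto_distr) (use LW[OF that] in \<open>auto simp: fT FT\<close>)
  have int_f: "(\<integral>z. f N z \<partial>\<nu>) = (\<integral>\<omega>. cut_exp K (X N) (Y N) \<omega> \<partial>M)" for N
    unfolding \<nu>_eq by (subst integral_distr) (auto simp: fT)
  have int_F: "(\<integral>z. F z \<partial>\<nu>) = (\<integral>\<omega>. cut_exp K X' Y' \<omega> \<partial>M)"
    unfolding \<nu>_eq by (subst integral_distr) (auto simp: FT)
  have f0: "0 \<le> f N z" "0 \<le> F z" for N z by (simp_all add: f_def F_def cw)
  have f1: "in_Lp \<nu> 1 (f N)" "in_Lp \<nu> 1 F" for N using Lf[of 1] by (auto simp: Lp_tendsto_def)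
  have goal1: "Lp_tendsto (law_u M u) p wick_mass m" if "1 \<le> p" for p
    unfolding law_u_def by (subst Lp_tendsto_distr) (use LX[OF that] in \<open>auto simp: X_def[abs_def] X'_def[abs_def]\<close>)
  have goal2: "Lp_tendsto \<nu> p (\<lambda>N (u, w, w'). Q_N N u w) (\<lambda>(u, w, w'). Q u w)" if "1 \<le> p" for p
    unfolding \<nu>_eq case_prod_beta'
    by (subst Lp_tendsto_distr) (use LY[OF that] in \<open>auto simp: Y_def[abs_def] Y'_def[abs_def] T_def\<close>)
  have goal3: "\<exists>C>0. \<forall>N. in_Lp \<nu> p (f N) \<and> Lp_norm \<nu> p (f N) \<le> C" if p: "1 \<le> p" for p
  proof -
    obtain B where B: "\<And>N. (\<integral>\<^sup>+ \<omega>. ennreal (\<bar>cut_exp K (X N) (Y N) \<omega>\<bar> powr p) \<partial>M) \<le> ennreal B" using bound[OF p] by blast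
    \<comment> \<open>\<open>\<bar>B\<bar> + 1\<close> instead of \<open>B\<close>, since the
      constant has to be positive.\<close>
    have "Lp_norm \<nu> p (f N) \<le> (\<bar>B\<bar> + 1) powr (1 / p)" for N
    proof -
      have "(\<integral>z. \<bar>f N z\<bar> powr p \<partial>\<nu>) = (\<integral>\<omega>. \<bar>cut_exp K (X N) (Y N) \<omega>\<bar> powr p \<partial>M)"
        unfolding \<nu>_eq by (subst integral_distr) (auto simp: fT)
      also have "\<dots> = enn2real (\<integral>\<^sup>+ \<omega>. ennreal (\<bar>cut_exp K (X N) (Y N) \<omega>\<bar> powr p) \<partial>M)"
        by (rule integral_eq_nn_integral) auto
      also have "\<dots> \<le> \<bar>B\<bar> + 1"
        using order.trans[OF B ennreal_leI[of B "\<bar>B\<bar> + 1"]] by (intro enn2real_leI) auto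
      finally show ?thesis unfolding Lp_norm_def using p by (intro powr_mono2) auto
    qed
    moreover have "in_Lp \<nu> p (f N)" for N using Lf[OF p] by (simp add: Lp_tendsto_def)
    ultimately show ?thesis by (intro exI[of _ "(\<bar>B\<bar> + 1) powr (1 / p)"]) auto
  qed
  have "prob_space (gibbs_measure \<nu> (f N))" for N
    by (rule \<nu>.gibbs_measure_props(1)[OF f1(1) f0(1)]) (simp add: int_f pos_N)
  moreover have "prob_space (gibbs_measure \<nu> F)" "absolutely_continuous \<nu> (gibbs_measure \<nu> F)"
    by (rule \<nu>.gibbs_measure_props[OF f1(2) f0(2)], simp add: int_F pos_lim)+
  moreover have "Lp_tendsto \<nu> p (\<lambda>N. gibbs_density \<nu> (f N)) (gibbs_density \<nu> F)" if "1 \<le> p" for p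
    by (rule \<nu>.Lp_tendsto_gibbs_density[OF Lf _ that]) (simp_all add: int_F pos_lim)
  ultimately have "(\<forall>p\<ge>1. Lp_tendsto (law_u M u) p wick_mass m) \<and>
         (\<forall>p\<ge>1. Lp_tendsto \<nu> p (\<lambda>N (u, w, w'). Q_N N u w) (\<lambda>(u, w, w'). Q u w)) \<and>
         (\<forall>p\<ge>1. \<exists>C>0. \<forall>N. in_Lp \<nu> p (f N) \<and> Lp_norm \<nu> p (f N) \<le> C) \<and>
         (\<forall>p\<ge>1. Lp_tendsto \<nu> p f (cutoff_weight K m Q)) \<and>
         (\<forall>N. prob_space (gibbs_measure \<nu> (f N))) \<and>
         prob_space (gibbs_measure \<nu> (cutoff_weight K m Q)) \<and>
         (\<forall>p\<ge>1. Lp_tendsto \<nu> p (\<lambda>N. gibbs_density \<nu> (f N)) (gibbs_density \<nu> (cutoff_weight K m Q))) \<and>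
         absolutely_continuous \<nu> (gibbs_measure \<nu> (cutoff_weight K m Q))"
    using goal1 goal2 goal3 Lf unfolding F_def by (intro conjI allI impI) auto
  then show ?thesis
    unfolding Let_def \<nu>_def[symmetric] f_def[abs_def, symmetric] by blast
qed

end
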